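(* Let $\Gamma$ be a countable discrete $C^*$-simple group, and let $\mathcal{A}$ be a $\Gamma$-$C^*$-algebra. Suppose that for some $C^*$-simple measure $\mu\in\operatorname{Prob}(\Gamma)$, all $\mu$-stationary states on $\mathcal{A}$ are faithful. Then any intermediate $C^*$-subalgebra $C^*_r(\Gamma)\subseteq\mathcal{B}\subseteq\Gamma\ltimes_r\mathcal{A}$ is simple.
   Context: A $\Gamma$-$C^*$-algebra is a unital $C^*$-algebra on which $\Gamma$ acts by $*$-automorphisms. $\operatorname{Prob}(\Gamma)$ is the set of probability measures on $\Gamma$. Simple means having no non-zero proper closed two-sided ideals. $\lambda:\Gamma\to\mathbb{B}(\ell^2(\Gamma))$ is the left regular representation, and $C^*_r(\Gamma)$ is the $C^*$-algebra generated by $\{\lambda_s:s\in\Gamma\}$. $\Gamma$ is $C^*$-simple if $C^*_r(\Gamma)$ is simple. $\tau_0$ is the canonical trace on $C^*_r(\Gamma)$, with $\tau_0(\lambda_e)=1$ and $\tau_0(\lambda_s)=0$ for $s\neq e$. $\Gamma$ acts on $C^*_r(\Gamma)$ by the inner automorphisms $a\mapsto\lambda_s a\lambda_s^*$. For a state $\tau$ on a $\Gamma$-$C^*$-algebra, $(s\tau)(a)=\tau(s^{-1}(a))$. For $\mu\in\operatorname{Prob}(\Gamma)$, $\mu*\tau=\sum_{s\in\Gamma}\mu(s)\,s\tau$, and $\tau$ is $\mu$-stationary if $\mu*\tau=\tau$. A measure $\mu\in\operatorname{Prob}(\Gamma)$ is a $C^*$-simple measure if $\tau_0$ is the unique $\mu$-stationary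 state on $C^*_r(\Gamma)$. Reduced crossed product: fix a faithful $*$-representation $\pi:\mathcal{A}\to\mathbb{B}(H)$ on a Hilbert space $H$. On $\ell^2(\Gamma,H)$ define $(\tilde\lambda_s\xi)(t)=\xi(s^{-1}t)$ and $[\sigma(a)\xi](t)=\pi(t^{-1}a)(\xi(t))$ for $s,t\in\Gamma$, $a\in\mathcal{A}$. Then $\Gamma\ltimes_r\mathcal{A}$ is the $C^*$-algebra generated by $\{\tilde\lambda_s\}_{s\in\Gamma}$ and $\sigma(\mathcal{A})$. $C^*_r(\Gamma)$ is identified with the $C^*$-subalgebra of $\Gamma\ltimes_r\mathcal{A}$ generated by $\{\tilde\lambda_s:s\in\Gamma\}$ via $\lambda_s\mapsto\tilde\lambda_s$. *)

theory Defs
  imports "HOL-Analysis.Analysis" "HOL-Probability.Probability_Mass_Function"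
begin

subsection \<open>Complex Hilbert spaces\<close>

class complex_vector = real_vector +
  fixes scaleC :: "complex \<Rightarrow> 'a \<Rightarrow> 'a" (infixr "*\<^sub>C" 75)
  assumes scaleC_add_right: "c *\<^sub>C (x + y) = c *\<^sub>C x + c *\<^sub>C y"
    and scaleC_add_left: "(c + d) *\<^sub>C x = c *\<^sub>C x + d *\<^sub>C x"
    and scaleC_scaleC: "c *\<^sub>C d *\<^sub>C x = (c * d) *\<^sub>C x"
    and scaleR_scaleC: "r *\<^sub>R x = complex_of_real r *\<^sub>C x"

lemma scaleC_one [simp]: "1 *\<^sub>C x = x"
  using scaleR_scaleC[of 1 x] by simp

lemma scaleC_zero_right [simp]: "c *\<^sub>C 0 = 0"
  using scaleC_add_right[of c 0 0] by simp

lemma scaleC_zero_left [simp]: "0 *\<^sub>C x = 0"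
  using scaleC_add_left[of 0 0 x] by simp

lemma scaleC_minus_right: "c *\<^sub>C (- x) = - (c *\<^sub>C x)"
  using scaleC_add_right[of c x "- x"] by (simp add: eq_neg_iff_add_eq_0 add.commute)

lemma scaleC_diff_right: "c *\<^sub>C (x - y) = c *\<^sub>C x - c *\<^sub>C y"
  using scaleC_add_right[of c x "- y"] by (simp add: scaleC_minus_right)

lemma scaleC_minus_one: "(- 1) *\<^sub>C x = - x"
  using scaleR_scaleC[of "- 1" x] by simp

text \<open>The inner product is conjugate-linear in its first argument.\<close>

class complex_inner = complex_vector + real_normed_vector +
  fixes cinner :: "'a \<Rightarrow> 'a \<Rightarrow> complex"
  assumes cinner_commute: "cinner x y = cnj (cinner y x)"
    and cinner_add_right: "cinner x (y + z) = cinner x y + cinner x z"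
    and cinner_scaleC_right: "cinner x (c *\<^sub>C y) = c * cinner x y"
    and cinner_self: "cinner x x = complex_of_real ((norm x)\<^sup>2)"

lemma cinner_add_left: "cinner (x + y) z = cinner x z + cinner y z"
  by (metis cinner_add_right cinner_commute complex_cnj_add)

lemma cinner_scaleC_left: "cinner (c *\<^sub>C x) y = cnj c * cinner x y"
  by (metis cinner_scaleC_right cinner_commute complex_cnj_mult)

lemma cinner_zero_right [simp]: "cinner x 0 = 0"
  using cinner_add_right[of x 0 0] by simp

lemma cinner_zero_left [simp]: "cinner 0 x = 0"
  using cinner_add_left[of 0 0 x] by simp

lemma cinner_minus_right [simp]: "cinner x (- y) = - cinner x y"
  using cinner_add_right[of x y "- y"] by (simp add: eq_neg_iff_add_eq_0 add.commute)

lemma cinner_minus_left [simp]: "cinner (- x) y = - cinner x y"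
  using cinner_add_left[of x "- x" y] by (simp add: eq_neg_iff_add_eq_0 add.commute)

lemma cinner_diff_right: "cinner x (y - z) = cinner x y - cinner x z"
  using cinner_add_right[of x y "- z"] by simp

lemma cinner_diff_left: "cinner (x - y) z = cinner x z - cinner y z"
  using cinner_add_left[of x "- y" z] by simp

lemma cinner_scaleR_right: "cinner x (r *\<^sub>R y) = complex_of_real r * cinner x y"
  by (simp add: scaleR_scaleC cinner_scaleC_right)

lemma cinner_scaleR_left: "cinner (r *\<^sub>R x) y = complex_of_real r * cinner x y"
  by (simp add: scaleR_scaleC cinner_scaleC_left)

lemma power2_norm_add: "(norm (x + y))\<^sup>2 = (norm x)\<^sup>2 + 2 * Re (cinner x y) + (norm y)\<^sup>2"
proof -
  have "complex_of_real ((norm (x + y))\<^sup>2) = cinner (x + y) (x + y)"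
    by (rule cinner_self[symmetric])
  also have "\<dots> = cinner x x + (cinner x y + cnj (cinner x y)) + cinner y y"
    by (simp add: cinner_add_right cinner_add_left cinner_commute[of y x])
  also have "\<dots> = complex_of_real ((norm x)\<^sup>2 + 2 * Re (cinner x y) + (norm y)\<^sup>2)"
    by (simp add: cinner_self complex_add_cnj)
  finally show ?thesis
    using of_real_eq_iff by blast
qed

lemma norm_scaleC: "norm (c *\<^sub>C (x::'a::complex_inner)) = cmod c * norm x"
proof -
  have "complex_of_real ((norm (c *\<^sub>C x))\<^sup>2) = cinner (c *\<^sub>C x) (c *\<^sub>C x)"
    by (rule cinner_self[symmetric])
  also have "\<dots> = (c * cnj c) * cinner x x"
    by (simp add: cinner_scaleC_left cinner_scaleC_right)
  also have "\<dots> = complex_of_real ((cmod c * norm x)\<^sup>2)"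
    by (simp add: cinner_self complex_norm_square[symmetric] power_mult_distrib)
  finally have "(norm (c *\<^sub>C x))\<^sup>2 = (cmod c * norm x)\<^sup>2"
    using of_real_eq_iff by blast
  then show ?thesis
    by (simp add: power2_eq_iff_nonneg)
qed

lemma Cauchy_Schwarz_cinner: "cmod (cinner x y) \<le> norm x * norm y"
proof (cases "cinner x y = 0")
  case False
  define c where "c = cnj (cinner x y) / cmod (cinner x y)"
  have c1: "cmod c = 1"
    using False by (simp add: c_def norm_divide)
  have "cinner x (c *\<^sub>C y) = complex_of_real (cmod (cinner x y))"
    using False
    by (simp add: cinner_scaleC_right c_def mult.commute complex_norm_square[symmetric] power2_eq_square)
  then have re: "Re (cinner x (c *\<^sub>C y)) = cmod (cinner x y)"
    by simp
  have "(norm (x + c *\<^sub>C y))\<^sup>2 \<le> (norm x + norm (c *\<^sub>C y))\<^sup>2"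
    using norm_triangle_ineq by (intro power_mono) auto
  then show ?thesis
    using re c1 by (simp add: power2_norm_add norm_scaleC power2_sum)
qed auto

lemma cinner_ext: "(\<And>z. cinner z x = cinner z y) \<Longrightarrow> x = y"
proof -
  assume "\<And>z. cinner z x = cinner z y"
  then have "cinner (x - y) (x - y) = 0"
    by (simp add: cinner_diff_right)
  then show ?thesis
    by (simp add: cinner_self)
qed

lemma bounded_bilinear_cinner: "bounded_bilinear (cinner :: 'a::complex_inner \<Rightarrow> 'a \<Rightarrow> complex)"
proof
  show "\<exists>K. \<forall>a b::'a. norm (cinner a b) \<le> norm a * norm b * K"
    by (rule exI[of _ 1]) (simp add: Cauchy_Schwarz_cinner)
qed (simp_all add: cinner_add_left cinner_add_right cinner_scaleR_left cinner_scaleR_right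
      scaleR_conv_of_real)

class chilbert_space = complex_inner + complete_space

instance chilbert_space \<subseteq> banach ..

instantiation complex :: chilbert_space
begin

definition scaleC_complex :: "complex \<Rightarrow> complex \<Rightarrow> complex"
  where "scaleC_complex c x = c * x"

definition cinner_complex :: "complex \<Rightarrow> complex \<Rightarrow> complex"
  where "cinner_complex x y = cnj x * y"

instance
  by standard
    (simp_all add: scaleC_complex_def cinner_complex_def algebra_simps scaleR_conv_of_real
      complex_norm_square[symmetric])

end

subsection \<open>Riesz representation and adjoints\<close>

lemma Riesz_real:
  fixes f :: "'a::chilbert_space \<Rightarrow> real"
  assumes "bounded_linear f"
  shows "\<exists>z. \<forall>h. f h = Re (cinner z h)"
proof -
  interpret f: bounded_linear f by fact
  obtain K where K: "\<And>x. norm (f x) \<le> norm x * K"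
    using f.bounded by blast
  define J where "J x = (norm x)\<^sup>2 / 2 - f x" for x
  have lower: "J x \<ge> - (K\<^sup>2 / 2)" for x
  proof -
    have "f x \<le> norm x * K"
      using K[of x] by simp
    moreover have "0 \<le> (norm x - K)\<^sup>2"
      by simp
    ultimately show ?thesis
      by (simp add: J_def power2_diff)
  qed
  define m where "m = Inf (range J)"
  have bdd: "bdd_below (range J)"
    using lower by (auto intro!: bdd_belowI)
  have m_le: "m \<le> J x" for x
    unfolding m_def by (rule cInf_lower[OF _ bdd]) auto
  have "\<exists>x. J x < m + e" if "e > 0" for e
    using cInf_lessD[of "range J" "m + e"] that by (auto simp: m_def)
  then have "\<forall>n. \<exists>x. J x < m + inverse (real (Suc n))"
    by simp
  then obtain X where X: "\<And>n. J (X n) < m + inverse (real (Suc n))"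
    by metis
  have par: "(norm (x - y))\<^sup>2 = 4 * (J x + J y - 2 * J ((1/2) *\<^sub>R (x + y)))" for x y
  proof -
    have "(norm (x - y))\<^sup>2 = (norm x)\<^sup>2 - 2 * Re (cinner x y) + (norm y)\<^sup>2"
      using power2_norm_add[of x "- y"] by simp
    moreover have "(norm (x + y))\<^sup>2 = (norm x)\<^sup>2 + 2 * Re (cinner x y) + (norm y)\<^sup>2"
      by (rule power2_norm_add)
    moreover have "J ((1/2) *\<^sub>R (x + y)) = (norm (x + y))\<^sup>2 / 8 - (f x + f y) / 2"
      by (simp add: J_def f.scaleR f.add power_mult_distrib power_divide)
    ultimately show ?thesis
      by (simp add: J_def field_simps)
  qed
  have "Cauchy X"
  proof (rule CauchyI)
    fix e :: real
    assume "e > 0"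
    then obtain N where N: "inverse (real (Suc N)) < e\<^sup>2 / 8"
      using reals_Archimedean[of "e\<^sup>2 / 8"] by auto
    have small: "J (X n) < m + e\<^sup>2 / 8" if "n \<ge> N" for n
    proof -
      have "inverse (real (Suc n)) \<le> inverse (real (Suc N))"
        using that by (intro le_imp_inverse_le) auto
      then show ?thesis
        using X[of n] N by linarith
    qed
    have "norm (X i - X j) < e" if "i \<ge> N" "j \<ge> N" for i j
    proof -
      define w where "w = (1/2) *\<^sub>R (X i + X j)"
      have "(norm (X i - X j))\<^sup>2 = 4 * (J (X i) + J (X j) - 2 * J w)"
        unfolding w_def by (rule par)
      then have "(norm (X i - X j))\<^sup>2 < e\<^sup>2"
        using m_le[of w] small[OF that(1)] small[OF that(2)] by argo
      then show ?thesis
        using \<open>e > 0\<close> by (meson less_imp_le power2_less_imp_less)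
    qed
    then show "\<exists>M. \<forall>i\<ge>M. \<forall>j\<ge>M. norm (X i - X j) < e"
      by blast
  qed
  then obtain z where z: "X \<longlonglongrightarrow> z"
    using Cauchy_convergent convergent_def by blast
  have "(\<lambda>n. J (X n)) \<longlonglongrightarrow> J z"
    unfolding J_def by (intro tendsto_intros f.tendsto z) auto
  moreover have "(\<lambda>n. m + inverse (real (Suc n))) \<longlonglongrightarrow> m + 0"
    by (intro tendsto_intros LIMSEQ_inverse_real_of_nat)
  ultimately have Jz: "J z \<le> m"
    using X by (metis (no_types, lifting) LIMSEQ_le add_0_right less_imp_le)
  have "f h = Re (cinner z h)" for h
  proof (rule ccontr)
    assume ne: "f h \<noteq> Re (cinner z h)"
    define d where "d = f h - Re (cinner z h)"
    define t where "t = d / ((norm h)\<^sup>2 + 1)"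
    have pos: "(norm h)\<^sup>2 + 1 > 0"
      by (simp add: add_nonneg_pos)
    have "J (z + t *\<^sub>R h) = J z + t * Re (cinner z h) + t\<^sup>2 * (norm h)\<^sup>2 / 2 - t * f h"
      by (simp add: J_def power2_norm_add f.add f.scaleR cinner_scaleR_right power_mult_distrib field_simps)
    then have "0 \<le> t\<^sup>2 * (norm h)\<^sup>2 / 2 - t * d"
      using Jz m_le[of "z + t *\<^sub>R h"] by (simp add: d_def algebra_simps)
    moreover have "t * d = t\<^sup>2 * ((norm h)\<^sup>2 + 1)"
      using pos by (simp add: t_def power2_eq_square)
    ultimately have "0 \<le> - (t\<^sup>2 * (norm h)\<^sup>2 / 2 + t\<^sup>2)"
      by (simp add: algebra_simps)
    moreover have "t\<^sup>2 > 0"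
      using ne pos by (simp add: t_def d_def)
    moreover have "t\<^sup>2 * (norm h)\<^sup>2 \<ge> 0"
      by simp
    ultimately show False
      by linarith
  qed
  then show ?thesis
    by blast
qed

lemma Riesz:
  fixes f :: "'a::chilbert_space \<Rightarrow> complex"
  assumes "bounded_linear f" and sc: "\<And>c x. f (c *\<^sub>C x) = c * f x"
  shows "\<exists>z. \<forall>h. f h = cinner z h"
proof -
  have "bounded_linear (\<lambda>x. Re (f x))"
    by (rule bounded_linear_compose[OF bounded_linear_Re assms(1)])
  then obtain z where z: "\<And>h. Re (f h) = Re (cinner z h)"
    using Riesz_real by blast
  have "Im (f h) = Im (cinner z h)" for h
    using z[of "\<i> *\<^sub>C h"] by (simp add: sc cinner_scaleC_right)
  then show ?thesis
    using z complex_eqI by blast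
qed

subsection \<open>C*-algebras and bounded operators\<close>

text \<open>Unital C*-algebras. The zero algebra (in which \<open>1 = 0\<close>) is not excluded, so that all bounded
  operators on an arbitrary Hilbert space, possibly \<open>{0}\<close>, form an instance; it has no states.\<close>

class cstar_algebra = complex_vector + real_normed_algebra + monoid_mult + complete_space +
  fixes star :: "'a \<Rightarrow> 'a"
  assumes scaleC_mult_left: "(c *\<^sub>C x) * y = c *\<^sub>C (x * y)"
    and scaleC_mult_right: "x * (c *\<^sub>C y) = c *\<^sub>C (x * y)"
    and star_star [simp]: "star (star x) = x"
    and star_add: "star (x + y) = star x + star y"
    and star_scaleC: "star (c *\<^sub>C x) = cnj c *\<^sub>C star x"
    and star_mult: "star (x * y) = star y * star x"
    and norm_star_mult: "norm (star x * x) = (norm x)\<^sup>2"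

instance cstar_algebra \<subseteq> banach ..

typedef (overloaded) 'a bop =
    "{f :: 'a::chilbert_space \<Rightarrow>\<^sub>L 'a. \<forall>c x. blinfun_apply f (c *\<^sub>C x) = c *\<^sub>C blinfun_apply f x}"
  by (rule exI[of _ 0]) simp

setup_lifting type_definition_bop

lift_definition bop_apply :: "'a::chilbert_space bop \<Rightarrow> 'a \<Rightarrow> 'a" is blinfun_apply .

lemma bop_eqI: "(\<And>x. bop_apply f x = bop_apply g x) \<Longrightarrow> f = g"
  by transfer (auto intro: blinfun_eqI)

lemma bounded_linear_bop_apply: "bounded_linear (bop_apply f)"
  by transfer (rule blinfun.bounded_linear_right)

lemma bop_apply_scaleC: "bop_apply f (c *\<^sub>C x) = c *\<^sub>C bop_apply f x"
  by transfer blast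

lemma bop_exists:
  fixes f :: "'a::chilbert_space \<Rightarrow> 'a"
  assumes "\<And>x y. f (x + y) = f x + f y" "\<And>c x. f (c *\<^sub>C x) = c *\<^sub>C f x"
    and "\<And>x. norm (f x) \<le> norm x * K"
  shows "\<exists>T. bop_apply T = f"
proof -
  have "bounded_linear f"
    by (rule bounded_linear_intro[of _ K]) (use assms in \<open>auto simp: scaleR_scaleC\<close>)
  then show ?thesis
    using assms(2)
    by (intro exI[of _ "Abs_bop (Blinfun f)"])
      (simp add: bop_apply.rep_eq Abs_bop_inverse bounded_linear_Blinfun_apply)
qed

lemma adjoint_exists:
  fixes f :: "'a::chilbert_space bop"
  shows "\<exists>g. \<forall>x y. cinner x (bop_apply g y) = cinner (bop_apply f x) y"
proof -
  interpret f: bounded_linear "bop_apply f"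
    by (rule bounded_linear_bop_apply)
  obtain K where K: "\<And>x. norm (bop_apply f x) \<le> norm x * K" and K0: "K \<ge> 0"
    using f.nonneg_bounded by blast
  have "\<exists>z. \<forall>h. cinner y (bop_apply f h) = cinner z h" for y
  proof (rule Riesz)
    show "bounded_linear (\<lambda>h. cinner y (bop_apply f h))"
      using bounded_linear_compose[OF bounded_bilinear.bounded_linear_right[OF bounded_bilinear_cinner]
          bounded_linear_bop_apply] by blast
  qed (simp add: bop_apply_scaleC cinner_scaleC_right)
  then obtain g where g: "\<And>y h. cinner y (bop_apply f h) = cinner (g y) h"
    by metis
  have g': "cinner h (g y) = cinner (bop_apply f h) y" for h y
    by (metis g cinner_commute)
  have "\<exists>T. bop_apply T = g"
  proof (rule bop_exists)
    show "g (x + y) = g x + g y" for x y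
      by (rule cinner_ext) (simp add: g' cinner_add_right)
    show "g (c *\<^sub>C x) = c *\<^sub>C g x" for c x
      by (rule cinner_ext) (simp add: g' cinner_scaleC_right)
    show "norm (g x) \<le> norm x * K" for x
    proof (cases "g x = 0")
      case False
      have "(norm (g x))\<^sup>2 = cmod (cinner (g x) (g x))"
        by (simp add: cinner_self norm_power)
      also have "\<dots> = cmod (cinner (bop_apply f (g x)) x)"
        by (simp only: g')
      also have "\<dots> \<le> norm (bop_apply f (g x)) * norm x"
        by (rule Cauchy_Schwarz_cinner)
      also have "\<dots> \<le> (norm (g x) * K) * norm x"
        by (intro mult_right_mono K) auto
      finally have "norm (g x) * norm (g x) \<le> norm (g x) * (norm x * K)"
        by (simp add: power2_eq_square algebra_simps)
      then show ?thesis
        using False by simp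
    qed (use K0 in simp)
  qed
  then show ?thesis
    using g' by auto
qed

lemma bounded_linear_scaleC: "bounded_linear (\<lambda>x::'b::complex_inner. c *\<^sub>C x)"
  by (rule bounded_linear_intro[of _ "cmod c"])
    (simp_all add: scaleC_add_right scaleR_scaleC scaleC_scaleC norm_scaleC mult.commute)

instantiation bop :: (chilbert_space) "{complex_vector, real_normed_vector}"
begin

lift_definition zero_bop :: "'a bop" is 0 by simp
lift_definition plus_bop :: "'a bop \<Rightarrow> 'a bop \<Rightarrow> 'a bop" is "(+)"
  by (simp add: blinfun.add_left scaleC_add_right)
lift_definition minus_bop :: "'a bop \<Rightarrow> 'a bop \<Rightarrow> 'a bop" is "(-)"
  by (simp add: blinfun.diff_left scaleC_diff_right)
lift_definition uminus_bop :: "'a bop \<Rightarrow> 'a bop" is uminus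
  by (simp add: blinfun.minus_left scaleC_minus_right)
lift_definition scaleR_bop :: "real \<Rightarrow> 'a bop \<Rightarrow> 'a bop" is "(*\<^sub>R)"
  by (simp add: blinfun.scaleR_left scaleR_scaleC scaleC_scaleC mult.commute)
lift_definition norm_bop :: "'a bop \<Rightarrow> real" is norm .

lift_definition scaleC_bop :: "complex \<Rightarrow> 'a bop \<Rightarrow> 'a bop"
  is "\<lambda>c f. Blinfun (\<lambda>x. c *\<^sub>C x) o\<^sub>L f"
  by (simp add: bounded_linear_Blinfun_apply bounded_linear_scaleC scaleC_scaleC mult.commute)

definition dist_bop :: "'a bop \<Rightarrow> 'a bop \<Rightarrow> real"
  where "dist_bop f g = norm (f - g)"
definition sgn_bop :: "'a bop \<Rightarrow> 'a bop"
  where "sgn_bop f = inverse (norm f) *\<^sub>R f"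
definition uniformity_bop :: "('a bop \<times> 'a bop) filter"
  where "uniformity_bop = (INF e\<in>{0 <..}. principal {(x, y). dist x y < e})"
definition open_bop :: "'a bop set \<Rightarrow> bool"
  where "open_bop U \<longleftrightarrow> (\<forall>x\<in>U. \<forall>\<^sub>F (x', y) in uniformity. x' = x \<longrightarrow> y \<in> U)"

lemma bop_apply_plus: "bop_apply (f + g) x = bop_apply f x + bop_apply g x"
  by transfer (rule blinfun.add_left)
lemma bop_apply_scaleC_left: "bop_apply (c *\<^sub>C f) x = c *\<^sub>C bop_apply f x"
  by transfer (simp add: bounded_linear_Blinfun_apply bounded_linear_scaleC)

instance
proof
  fix f g h :: "'a bop" and r s :: real and c d :: complex
  show "f + g + h = f + (g + h)" "f + g = g + f" "0 + f = f" "- f + f = 0" "f - g = f + - g"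
    "r *\<^sub>R (f + g) = r *\<^sub>R f + r *\<^sub>R g" "(r + s) *\<^sub>R f = r *\<^sub>R f + s *\<^sub>R f"
    "r *\<^sub>R s *\<^sub>R f = (r * s) *\<^sub>R f" "1 *\<^sub>R f = f"
    by (transfer, simp add: algebra_simps)+
  show "r *\<^sub>R f = complex_of_real r *\<^sub>C f"
    by transfer (auto intro!: blinfun_eqI
        simp: bounded_linear_Blinfun_apply bounded_linear_scaleC blinfun.scaleR_left scaleR_scaleC)
  show "c *\<^sub>C (f + g) = c *\<^sub>C f + c *\<^sub>C g" "(c + d) *\<^sub>C f = c *\<^sub>C f + d *\<^sub>C f"
    "c *\<^sub>C d *\<^sub>C f = (c * d) *\<^sub>C f"
    by (auto intro!: bop_eqI simp: bop_apply_scaleC_left bop_apply_plus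
        scaleC_add_right scaleC_add_left scaleC_scaleC)
  show "dist f g = norm (f - g)" by (rule dist_bop_def)
  show "sgn f = inverse (norm f) *\<^sub>R f" by (rule sgn_bop_def)
  show "uniformity = (INF e\<in>{0 <..}. principal {(x :: 'a bop, y). dist x y < e})"
    by (rule uniformity_bop_def)
  show "open U \<longleftrightarrow> (\<forall>x\<in>U. \<forall>\<^sub>F (x', y) in uniformity. x' = x \<longrightarrow> y \<in> U)" for U :: "'a bop set"
    by (rule open_bop_def)
  show "(norm f = 0) = (f = 0)" "norm (r *\<^sub>R f) = \<bar>r\<bar> * norm f" 
    by (transfer, simp)+
  show "norm (f + g) \<le> norm f + norm g" by transfer (rule norm_triangle_ineq)
qed

end

instantiation bop :: (chilbert_space) cstar_algebra
begin

lift_definition one_bop :: "'a bop" is id_blinfun by simp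
lift_definition times_bop :: "'a bop \<Rightarrow> 'a bop \<Rightarrow> 'a bop" is "(o\<^sub>L)"
  by simp
definition star_bop :: "'a bop \<Rightarrow> 'a bop"
  where "star_bop f = (THE g. \<forall>x y. cinner x (bop_apply g y) = cinner (bop_apply f x) y)"

lemma bop_apply_times: "bop_apply (f * g) x = bop_apply f (bop_apply g x)"
  by transfer simp
lemma bop_apply_one: "bop_apply 1 x = x"
  by transfer simp
lemma norm_bop_apply: "norm (bop_apply f x) \<le> norm f * norm x"
  by transfer (rule norm_blinfun)
lemma norm_bop_bound: "0 \<le> K \<Longrightarrow> (\<And>x. norm (bop_apply f x) \<le> K * norm x) \<Longrightarrow> norm f \<le> K"
  by transfer (rule norm_blinfun_bound)

lemma cinner_star: "cinner x (bop_apply (star f) y) = cinner (bop_apply f x) y"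
proof -
  obtain g where g: "\<And>x y. cinner x (bop_apply g y) = cinner (bop_apply f x) y"
    using adjoint_exists[of f] by auto
  have "star f = g"
    unfolding star_bop_def
  proof (rule the_equality)
    fix h
    assume "\<forall>x y. cinner x (bop_apply h y) = cinner (bop_apply f x) y"
    then show "h = g"
      using g by - (rule bop_eqI, rule cinner_ext, simp)
  qed (use g in blast)
  then show ?thesis
    using g by simp
qed

lemma star_bop_eqI:
  "(\<And>x y. cinner x (bop_apply g y) = cinner (bop_apply f x) y) \<Longrightarrow> star f = g"
  by (rule bop_eqI, rule cinner_ext) (simp add: cinner_star)

lemma cinner_star_left: "cinner (bop_apply (star f) x) y = cinner x (bop_apply f y)"
  by (subst (1 2) cinner_commute) (simp add: cinner_star)

lemma norm_star_le: "norm (bop_apply f x) ^ 2 \<le> norm (star f * f) * norm x ^ 2"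
proof -
  have "complex_of_real (norm (bop_apply f x) ^ 2) = cinner (bop_apply f x) (bop_apply f x)"
    by (simp add: cinner_self)
  also have "\<dots> = cinner x (bop_apply (star f * f) x)"
    by (simp add: bop_apply_times cinner_star)
  finally have "norm (bop_apply f x) ^ 2 = cmod (cinner x (bop_apply (star f * f) x))"
    by (metis abs_of_nonneg norm_of_real zero_le_power2)
  also have "\<dots> \<le> norm x * norm (bop_apply (star f * f) x)"
    by (rule Cauchy_Schwarz_cinner)
  also have "\<dots> \<le> norm x * (norm (star f * f) * norm x)"
    by (intro mult_left_mono norm_bop_apply) auto
  finally show ?thesis
    by (simp add: power2_eq_square algebra_simps)
qed

lemma norm_bop_times: "norm (f * g) \<le> norm f * norm g" for f g :: "'a bop"
  by transfer (rule norm_blinfun_compose)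

lemma star_star_bop: "star (star f) = f" for f :: "'a bop"
  by (rule star_bop_eqI) (rule cinner_star_left[symmetric])

lemma power2_norm_bop_le: "(norm f)\<^sup>2 \<le> norm (star f * f)" for f :: "'a bop"
proof -
  have "norm f \<le> sqrt (norm (star f * f))"
  proof (rule norm_bop_bound)
    show "norm (bop_apply f x) \<le> sqrt (norm (star f * f)) * norm x" for x
    proof (rule power2_le_imp_le)
      show "(norm (bop_apply f x))\<^sup>2 \<le> (sqrt (norm (star f * f)) * norm x)\<^sup>2"
        using norm_star_le[of f x] by (simp add: power_mult_distrib)
    qed simp
  qed simp
  then have "(norm f)\<^sup>2 \<le> (sqrt (norm (star f * f)))\<^sup>2"
    by (rule power_mono) (rule norm_ge_zero)
  then show ?thesis
    by simp
qed

lemma norm_star_bop_ge: "norm f \<le> norm (star f)" for f :: "'a bop"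
proof (cases "norm f = 0")
  case False
  then have "norm f > 0"
    by simp
  moreover have "norm f * norm f \<le> norm (star f) * norm f"
    using power2_norm_bop_le[of f] norm_bop_times[of "star f" f] unfolding power2_eq_square
    by (rule order_trans)
  ultimately show ?thesis
    by (rule mult_right_le_imp_le[rotated])
qed simp

lemma norm_star_mult_bop: "norm (star f * f) = (norm f)\<^sup>2" for f :: "'a bop"
proof (rule antisym)
  have "norm (star f) = norm f"
    using norm_star_bop_ge[of f] norm_star_bop_ge[of "star f"] by (simp add: star_star_bop)
  then show "norm (star f * f) \<le> (norm f)\<^sup>2"
    using norm_bop_times[of "star f" f] by (simp add: power2_eq_square)
qed (rule power2_norm_bop_le)

instance
proof
  fix f g h :: "'a bop" and r s :: real and c d :: complex
  show "(c *\<^sub>C f) * g = c *\<^sub>C (f * g)" "f * (c *\<^sub>C g) = c *\<^sub>C (f * g)"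
    by (auto intro!: bop_eqI simp: bop_apply_scaleC_left bop_apply_times bop_apply_scaleC)
  show "(f + g) * h = f * h + g * h" "f * (g + h) = f * g + f * h" "f * g * h = f * (g * h)"
    "1 * f = f" "f * 1 = f"
    by (auto intro!: bop_eqI simp: bop_apply_plus bop_apply_times bop_apply_one
        linear_add[OF bounded_linear.linear[OF bounded_linear_bop_apply]])
  show "(r *\<^sub>R f) * g = r *\<^sub>R (f * g)" "f * (r *\<^sub>R g) = r *\<^sub>R (f * g)"
    by (transfer, auto intro!: blinfun_eqI simp: blinfun.bilinear_simps)+
  show "star (star f) = f"
    by (rule star_star_bop)
  show "star (f + g) = star f + star g"
    by (rule star_bop_eqI) (simp add: bop_apply_plus cinner_star cinner_add_left cinner_add_right)
  show "star (c *\<^sub>C f) = cnj c *\<^sub>C star f"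
    by (rule star_bop_eqI)
      (simp add: bop_apply_scaleC_left cinner_star cinner_scaleC_left cinner_scaleC_right)
  show "star (f * g) = star g * star f"
    by (rule star_bop_eqI) (simp add: bop_apply_times cinner_star)
  show "norm (f * g) \<le> norm f * norm g"
    by (rule norm_bop_times)
  show "norm (star f * f) = (norm f)\<^sup>2"
    by (rule norm_star_mult_bop)
  fix X :: "nat \<Rightarrow> 'a bop"
  have dist_eq: "dist (Rep_bop f) (Rep_bop g) = dist f g" for f g :: "'a bop"
    by (simp add: dist_norm dist_bop_def norm_bop.rep_eq minus_bop.rep_eq)
  assume "Cauchy X"
  then have "Cauchy (\<lambda>n. Rep_bop (X n))"
    by (auto simp: Cauchy_def dist_eq)
  then obtain L where L: "(\<lambda>n. Rep_bop (X n)) \<longlonglongrightarrow> L"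
    using Cauchy_convergent convergent_def by blast
  have "blinfun_apply L (c *\<^sub>C x) = c *\<^sub>C blinfun_apply L x" for c x
  proof (rule LIMSEQ_unique)
    show "(\<lambda>n. blinfun_apply (Rep_bop (X n)) (c *\<^sub>C x)) \<longlonglongrightarrow> blinfun_apply L (c *\<^sub>C x)"
      by (intro blinfun.tendsto L tendsto_const)
    have "(\<lambda>n. c *\<^sub>C blinfun_apply (Rep_bop (X n)) x) \<longlonglongrightarrow> c *\<^sub>C blinfun_apply L x"
      by (intro bounded_linear.tendsto[OF bounded_linear_scaleC] blinfun.tendsto L tendsto_const)
    moreover have "blinfun_apply (Rep_bop (X n)) (c *\<^sub>C x) = c *\<^sub>C blinfun_apply (Rep_bop (X n)) x" for n
      using Rep_bop by blast
    ultimately show "(\<lambda>n. blinfun_apply (Rep_bop (X n)) (c *\<^sub>C x)) \<longlonglongrightarrow> c *\<^sub>C blinfun_apply L x"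
      by simp
  qed
  then have "Rep_bop (Abs_bop L) = L"
    by (simp add: Abs_bop_inverse)
  then have "dist (X n) (Abs_bop L) = dist (Rep_bop (X n)) L" for n
    using dist_eq[of "X n" "Abs_bop L"] by simp
  then have "X \<longlonglongrightarrow> Abs_bop L"
    using L by (simp only: tendsto_dist_iff[of X] tendsto_dist_iff[of "\<lambda>n. Rep_bop (X n)"])
  then show "convergent X"
    by (rule convergentI)
qed

end

subsection \<open>The Hilbert space of square-summable functions\<close>

typedef (overloaded) ('i, 'a) ell2 =
    "{f :: 'i \<Rightarrow> 'a::chilbert_space. (\<lambda>i. (norm (f i))\<^sup>2) summable_on UNIV}"
  morphisms ell2_apply Abs_ell2
  by (rule exI[of _ "\<lambda>_. 0"]) simp

setup_lifting type_definition_ell2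

lemma ell2_eqI: "(\<And>i. ell2_apply f i = ell2_apply g i) \<Longrightarrow> f = g"
  by (metis ell2_apply_inject ext)

lemma ell2_apply_summable: "(\<lambda>i. (norm (ell2_apply f i))\<^sup>2) summable_on UNIV"
  using ell2_apply by auto

lemma square_summableI:
  assumes "\<And>F. finite F \<Longrightarrow> L2_set (\<lambda>i. norm (f i)) F \<le> B"
  shows "(\<lambda>i. (norm (f i))\<^sup>2) summable_on UNIV"
proof (rule nonneg_bdd_above_summable_on)
  show "bdd_above (sum (\<lambda>i. (norm (f i))\<^sup>2) ` {F. F \<subseteq> UNIV \<and> finite F})"
  proof (rule bdd_aboveI2)
    fix F :: "'a set"
    assume "F \<in> {F. F \<subseteq> UNIV \<and> finite F}"
    then have "L2_set (\<lambda>i. norm (f i)) F \<le> B"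
      using assms by simp
    then have "(L2_set (\<lambda>i. norm (f i)) F)\<^sup>2 \<le> B\<^sup>2"
      by (rule power_mono) (simp add: L2_set_nonneg)
    then show "(\<Sum>i\<in>F. (norm (f i))\<^sup>2) \<le> B\<^sup>2"
      by (simp add: L2_set_def sum_nonneg)
  qed
qed simp

lemma L2_set_le_ell2:
  assumes "(\<lambda>i. (norm (f i))\<^sup>2) summable_on UNIV" "finite F"
  shows "L2_set (\<lambda>i. norm (f i)) F \<le> sqrt (\<Sum>\<^sub>\<infinity>i. (norm (f i))\<^sup>2)"
  unfolding L2_set_def using assms by (intro real_sqrt_le_mono finite_sum_le_infsum) auto

lemma ell2_le_L2_set:
  assumes "(\<lambda>i. (norm (f i))\<^sup>2) summable_on UNIV"
    and "\<And>F. finite F \<Longrightarrow> L2_set (\<lambda>i. norm (f i)) F \<le> B"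
  shows "sqrt (\<Sum>\<^sub>\<infinity>i. (norm (f i))\<^sup>2) \<le> B"
proof (rule real_le_lsqrt)
  show B: "0 \<le> B"
    using assms(2)[of "{}"] by simp
  show "(\<Sum>\<^sub>\<infinity>i. (norm (f i))\<^sup>2) \<le> B\<^sup>2"
  proof (rule infsum_le_finite_sums[OF assms(1)])
    fix F :: "'a set"
    assume "finite F"
    then have "(L2_set (\<lambda>i. norm (f i)) F)\<^sup>2 \<le> B\<^sup>2"
      by (intro power_mono assms(2)) (simp_all add: L2_set_nonneg)
    then show "(\<Sum>i\<in>F. (norm (f i))\<^sup>2) \<le> B\<^sup>2"
      by (simp add: L2_set_def sum_nonneg)
  qed
qed

lemma L2_set_norm_add:
  "L2_set (\<lambda>i. norm (f i + g i)) F \<le> L2_set (\<lambda>i. norm (f i)) F + L2_set (\<lambda>i. norm (g i)) F"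
proof -
  have "L2_set (\<lambda>i. norm (f i + g i)) F \<le> L2_set (\<lambda>i. norm (f i) + norm (g i)) F"
    by (intro L2_set_mono norm_triangle_ineq) simp
  also have "\<dots> \<le> L2_set (\<lambda>i. norm (f i)) F + L2_set (\<lambda>i. norm (g i)) F"
    by (rule L2_set_triangle_ineq)
  finally show ?thesis .
qed

lemma square_summable_add:
  assumes "(\<lambda>i. (norm (f i))\<^sup>2) summable_on UNIV" "(\<lambda>i. (norm (g i))\<^sup>2) summable_on UNIV"
  shows "(\<lambda>i. (norm (f i + g i))\<^sup>2) summable_on UNIV"
    and "sqrt (\<Sum>\<^sub>\<infinity>i. (norm (f i + g i))\<^sup>2)
      \<le> sqrt (\<Sum>\<^sub>\<infinity>i. (norm (f i))\<^sup>2) + sqrt (\<Sum>\<^sub>\<infinity>i. (norm (g i))\<^sup>2)"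
proof -
  have *: "L2_set (\<lambda>i. norm (f i + g i)) F
      \<le> sqrt (\<Sum>\<^sub>\<infinity>i. (norm (f i))\<^sup>2) + sqrt (\<Sum>\<^sub>\<infinity>i. (norm (g i))\<^sup>2)" if "finite F" for F
    using L2_set_norm_add[of f g F] L2_set_le_ell2[OF assms(1) that] L2_set_le_ell2[OF assms(2) that]
    by linarith
  show s: "(\<lambda>i. (norm (f i + g i))\<^sup>2) summable_on UNIV"
    by (rule square_summableI) (rule *)
  show "sqrt (\<Sum>\<^sub>\<infinity>i. (norm (f i + g i))\<^sup>2)
      \<le> sqrt (\<Sum>\<^sub>\<infinity>i. (norm (f i))\<^sup>2) + sqrt (\<Sum>\<^sub>\<infinity>i. (norm (g i))\<^sup>2)"
    by (rule ell2_le_L2_set[OF s *])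
qed

lemma square_summable_scaleC:
  fixes f :: "'i \<Rightarrow> 'a::chilbert_space"
  assumes "(\<lambda>i. (norm (f i))\<^sup>2) summable_on UNIV"
  shows "(\<lambda>i. (norm (c *\<^sub>C f i))\<^sup>2) summable_on UNIV"
  using assms by (simp add: norm_scaleC power_mult_distrib summable_on_cmult_right)

instantiation ell2 :: (type, chilbert_space) "{complex_vector, real_normed_vector}"
begin

lift_definition zero_ell2 :: "('a, 'b) ell2" is "\<lambda>_. 0" by simp
lift_definition plus_ell2 :: "('a, 'b) ell2 \<Rightarrow> ('a, 'b) ell2 \<Rightarrow> ('a, 'b) ell2"
  is "\<lambda>f g i. f i + g i" by (rule square_summable_add)
lift_definition uminus_ell2 :: "('a, 'b) ell2 \<Rightarrow> ('a, 'b) ell2" is "\<lambda>f i. - f i" by simp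
lift_definition minus_ell2 :: "('a, 'b) ell2 \<Rightarrow> ('a, 'b) ell2 \<Rightarrow> ('a, 'b) ell2"
  is "\<lambda>f g i. f i - g i"
  subgoal for f g using square_summable_add(1)[of f "\<lambda>i. - g i"] by simp
  done
lift_definition scaleC_ell2 :: "complex \<Rightarrow> ('a, 'b) ell2 \<Rightarrow> ('a, 'b) ell2"
  is "\<lambda>c f i. c *\<^sub>C f i" by (rule square_summable_scaleC)
lift_definition scaleR_ell2 :: "real \<Rightarrow> ('a, 'b) ell2 \<Rightarrow> ('a, 'b) ell2"
  is "\<lambda>r f i. r *\<^sub>R f i" by (simp add: scaleR_scaleC square_summable_scaleC del: norm_scaleR)
lift_definition norm_ell2 :: "('a, 'b) ell2 \<Rightarrow> real" is "\<lambda>f. sqrt (\<Sum>\<^sub>\<infinity>i. (norm (f i))\<^sup>2)" .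

definition dist_ell2 :: "('a, 'b) ell2 \<Rightarrow> ('a, 'b) ell2 \<Rightarrow> real"
  where "dist_ell2 f g = norm (f - g)"
definition sgn_ell2 :: "('a, 'b) ell2 \<Rightarrow> ('a, 'b) ell2"
  where "sgn_ell2 f = inverse (norm f) *\<^sub>R f"
definition uniformity_ell2 :: "(('a, 'b) ell2 \<times> ('a, 'b) ell2) filter"
  where "uniformity_ell2 = (INF e\<in>{0 <..}. principal {(x, y). dist x y < e})"
definition open_ell2 :: "('a, 'b) ell2 set \<Rightarrow> bool"
  where "open_ell2 U \<longleftrightarrow> (\<forall>x\<in>U. \<forall>\<^sub>F (x', y) in uniformity. x' = x \<longrightarrow> y \<in> U)"

instance
proof
  fix f g h :: "('a, 'b) ell2" and r s :: real and c d :: complex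
  show "f + g + h = f + (g + h)" "f + g = g + f" "0 + f = f" "- f + f = 0" "f - g = f + - g"
    "r *\<^sub>R (f + g) = r *\<^sub>R f + r *\<^sub>R g" "(r + s) *\<^sub>R f = r *\<^sub>R f + s *\<^sub>R f"
    "r *\<^sub>R s *\<^sub>R f = (r * s) *\<^sub>R f" "1 *\<^sub>R f = f"
    by (transfer, simp add: algebra_simps)+
  show "r *\<^sub>R f = complex_of_real r *\<^sub>C f"
    by transfer (simp add: scaleR_scaleC)
  show "c *\<^sub>C (f + g) = c *\<^sub>C f + c *\<^sub>C g" "(c + d) *\<^sub>C f = c *\<^sub>C f + d *\<^sub>C f"
    "c *\<^sub>C d *\<^sub>C f = (c * d) *\<^sub>C f"
    by (transfer, simp add: scaleC_add_right scaleC_add_left scaleC_scaleC)+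
  show "dist f g = norm (f - g)" by (rule dist_ell2_def)
  show "sgn f = inverse (norm f) *\<^sub>R f" by (rule sgn_ell2_def)
  show "uniformity = (INF e\<in>{0 <..}. principal {(x :: ('a, 'b) ell2, y). dist x y < e})"
    by (rule uniformity_ell2_def)
  show "open U \<longleftrightarrow> (\<forall>x\<in>U. \<forall>\<^sub>F (x', y) in uniformity. x' = x \<longrightarrow> y \<in> U)" for U :: "('a, 'b) ell2 set"
    by (rule open_ell2_def)
  show "norm f = 0 \<longleftrightarrow> f = 0"
  proof
    assume "norm f = 0"
    then have *: "(\<Sum>\<^sub>\<infinity>i. (norm (ell2_apply f i))\<^sup>2) = 0"
      by (simp add: norm_ell2.rep_eq)
    have "(norm (ell2_apply f i))\<^sup>2 = 0" for i
      by (rule nonneg_infsum_le_0D[OF _ ell2_apply_summable[of f]]) (use * in auto)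
    then show "f = 0"
      by (auto intro!: ell2_eqI simp: zero_ell2.rep_eq)
  qed (simp add: norm_ell2.rep_eq zero_ell2.rep_eq)
  show "norm (f + g) \<le> norm f + norm g"
    by transfer (rule square_summable_add)
  show "norm (r *\<^sub>R f) = \<bar>r\<bar> * norm f"
  proof -
    have "(\<Sum>\<^sub>\<infinity>i. (norm (ell2_apply (r *\<^sub>R f) i))\<^sup>2)
        = (\<Sum>\<^sub>\<infinity>i. r\<^sup>2 * (norm (ell2_apply f i))\<^sup>2)"
      by (simp add: scaleR_ell2.rep_eq power_mult_distrib)
    also have "\<dots> = r\<^sup>2 * (\<Sum>\<^sub>\<infinity>i. (norm (ell2_apply f i))\<^sup>2)"
      by (rule infsum_cmult_right')
    finally show ?thesis
      unfolding norm_ell2.rep_eq by (simp only: real_sqrt_mult real_sqrt_abs)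
  qed
qed

end

lemma summable_on_cinner:
  fixes f g :: "'i \<Rightarrow> 'a::chilbert_space"
  assumes "(\<lambda>i. (norm (f i))\<^sup>2) summable_on UNIV" "(\<lambda>i. (norm (g i))\<^sup>2) summable_on UNIV"
  shows "(\<lambda>i. cinner (f i) (g i)) summable_on UNIV"
proof (rule abs_summable_summable, rule Infinite_Sum.abs_summable_on_comparison_test)
  show "(\<lambda>i. norm ((norm (f i))\<^sup>2 + (norm (g i))\<^sup>2)) summable_on UNIV"
    using summable_on_add[OF assms] by simp
  show "norm (cinner (f i) (g i)) \<le> norm ((norm (f i))\<^sup>2 + (norm (g i))\<^sup>2)" for i
  proof -
    have "2 * (norm (f i) * norm (g i)) \<le> (norm (f i))\<^sup>2 + (norm (g i))\<^sup>2"
      using sum_squares_bound[of "norm (f i)" "norm (g i)"] by simp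
    moreover have "0 \<le> norm (f i) * norm (g i)"
      by simp
    ultimately have "cmod (cinner (f i) (g i)) \<le> (norm (f i))\<^sup>2 + (norm (g i))\<^sup>2"
      using Cauchy_Schwarz_cinner[of "f i" "g i"] by linarith
    then show ?thesis
      by simp
  qed
qed

lemma norm_ell2_apply_le: "norm (ell2_apply f i) \<le> norm f"
  using L2_set_le_ell2[OF ell2_apply_summable[of f], of "{i}"] by (simp add: norm_ell2.rep_eq)

instantiation ell2 :: (type, chilbert_space) chilbert_space
begin

lift_definition cinner_ell2 :: "('a, 'b) ell2 \<Rightarrow> ('a, 'b) ell2 \<Rightarrow> complex"
  is "\<lambda>f g. \<Sum>\<^sub>\<infinity>i. cinner (f i) (g i)" .

instance
proof
  fix f g h :: "('a, 'b) ell2" and c :: complex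
  show "cinner f g = cnj (cinner g f)"
    unfolding cinner_ell2.rep_eq infsum_cnj[symmetric] by (rule infsum_cong) (rule cinner_commute)
  show "cinner f (g + h) = cinner f g + cinner f h"
    by transfer (simp add: cinner_add_right infsum_add summable_on_cinner)
  show "cinner f (c *\<^sub>C g) = c * cinner f g"
    unfolding cinner_ell2.rep_eq scaleC_ell2.rep_eq cinner_scaleC_right
    by (rule infsum_cmult_right')
  show "cinner f f = complex_of_real ((norm f)\<^sup>2)"
  proof -
    have "((\<lambda>i. complex_of_real ((norm (ell2_apply f i))\<^sup>2)) has_sum
        complex_of_real (\<Sum>\<^sub>\<infinity>i. (norm (ell2_apply f i))\<^sup>2)) UNIV"
      unfolding has_sum_of_real_iff by (rule has_sum_infsum[OF ell2_apply_summable])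
    then show ?thesis
      unfolding cinner_ell2.rep_eq cinner_self
      by (simp add: infsumI norm_ell2.rep_eq infsum_nonneg del: of_real_power)
  qed
next
  fix X :: "nat \<Rightarrow> ('a, 'b) ell2"
  assume X: "Cauchy X"
  have "Cauchy (\<lambda>n. ell2_apply (X n) i)" for i
  proof (rule metric_CauchyI)
    fix e :: real
    assume "e > 0"
    then obtain M where M: "\<And>m n. m \<ge> M \<Longrightarrow> n \<ge> M \<Longrightarrow> dist (X m) (X n) < e"
      using metric_CauchyD[OF X] by metis
    have "dist (ell2_apply (X m) i) (ell2_apply (X n) i) \<le> dist (X m) (X n)" for m n
      using norm_ell2_apply_le[of "X m - X n" i] by (simp add: dist_norm minus_ell2.rep_eq)
    then show "\<exists>M. \<forall>m\<ge>M. \<forall>n\<ge>M. dist (ell2_apply (X m) i) (ell2_apply (X n) i) < e"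
      using M le_less_trans by blast
  qed
  then have "(\<lambda>n. ell2_apply (X n) i) \<longlonglongrightarrow> lim (\<lambda>n. ell2_apply (X n) i)" for i
    by (simp add: Cauchy_convergent convergent_LIMSEQ_iff[symmetric])
  then obtain L where L: "\<And>i. (\<lambda>n. ell2_apply (X n) i) \<longlonglongrightarrow> L i"
    by (rule that)
  have tail: "L2_set (\<lambda>i. norm (ell2_apply (X m) i - L i)) F \<le> e"
    if "finite F" "\<And>n. n \<ge> M \<Longrightarrow> norm (X m - X n) \<le> e" for F m M e
  proof (rule LIMSEQ_le_const2)
    show "(\<lambda>n. L2_set (\<lambda>i. norm (ell2_apply (X m) i - ell2_apply (X n) i)) F)
        \<longlonglongrightarrow> L2_set (\<lambda>i. norm (ell2_apply (X m) i - L i)) F"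
      unfolding L2_set_def by (intro tendsto_intros L)
    have "L2_set (\<lambda>i. norm (ell2_apply (X m) i - ell2_apply (X n) i)) F \<le> norm (X m - X n)" for n
      using L2_set_le_ell2[OF ell2_apply_summable[of "X m - X n"] that(1)]
      by (simp add: norm_ell2.rep_eq minus_ell2.rep_eq)
    then show "\<exists>N. \<forall>n\<ge>N. L2_set (\<lambda>i. norm (ell2_apply (X m) i - ell2_apply (X n) i)) F \<le> e"
      using that(2) order_trans by blast
  qed
  have tail_ex: "\<exists>M. \<forall>m\<ge>M. \<forall>n\<ge>M. norm (X m - X n) \<le> e" if "e > 0" for e
    using CauchyD[OF X that] by (meson less_imp_le)
  obtain M where M: "\<And>m n. m \<ge> M \<Longrightarrow> n \<ge> M \<Longrightarrow> norm (X m - X n) \<le> 1"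
    using tail_ex[of 1] by auto
  have "(\<lambda>i. (norm (ell2_apply (X M) i - L i))\<^sup>2) summable_on UNIV"
    by (rule square_summableI) (rule tail[of _ M], use M in auto)
  then have "(\<lambda>i. (norm (- (ell2_apply (X M) i - L i)))\<^sup>2) summable_on UNIV"
    by (simp only: norm_minus_cancel)
  from square_summable_add(1)[OF ell2_apply_summable[of "X M"] this]
  have "(\<lambda>i. (norm (L i))\<^sup>2) summable_on UNIV"
    by simp
  then have L': "ell2_apply (Abs_ell2 L) = L"
    by (simp add: Abs_ell2_inverse)
  have "X \<longlonglongrightarrow> Abs_ell2 L"
  proof (rule LIMSEQ_I)
    fix e :: real
    assume "e > 0"
    then obtain M where M: "\<And>m n. m \<ge> M \<Longrightarrow> n \<ge> M \<Longrightarrow> norm (X m - X n) \<le> e / 2"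
      using tail_ex[of "e / 2"] by auto
    have *: "norm (X m - Abs_ell2 L) \<le> e / 2" if "m \<ge> M" for m
    proof -
      have "L2_set (\<lambda>i. norm (ell2_apply (X m - Abs_ell2 L) i)) F \<le> e / 2" if "finite F" for F
        using tail[OF that M[OF \<open>m \<ge> M\<close>]] by (simp add: minus_ell2.rep_eq L')
      then show ?thesis
        unfolding norm_ell2.rep_eq by (rule ell2_le_L2_set[OF ell2_apply_summable])
    qed
    have "norm (X n - Abs_ell2 L) < e" if "n \<ge> M" for n
      using *[OF that] \<open>e > 0\<close> by linarith
    then show "\<exists>no. \<forall>n\<ge>no. norm (X n - Abs_ell2 L) < e"
      by blast
  qed
  then show "convergent X"
    by (rule convergentI)
qed

end

subsection \<open>C*-subalgebras, simplicity and states\<close>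

definition cstar_subalgebra :: "'a::cstar_algebra set \<Rightarrow> bool" where
  "cstar_subalgebra S \<longleftrightarrow> closed S \<and> 0 \<in> S
    \<and> (\<forall>x\<in>S. \<forall>y\<in>S. x + y \<in> S \<and> x * y \<in> S)
    \<and> (\<forall>c. \<forall>x\<in>S. c *\<^sub>C x \<in> S)
    \<and> (\<forall>x\<in>S. star x \<in> S)"

definition cstar_generated :: "'a::cstar_algebra set \<Rightarrow> 'a set" where
  "cstar_generated X = \<Inter>{S. cstar_subalgebra S \<and> X \<subseteq> S}"

definition closed_ideal :: "'a::cstar_algebra set \<Rightarrow> 'a set \<Rightarrow> bool" where
  "closed_ideal I S \<longleftrightarrow> I \<subseteq> S \<and> closed I \<and> 0 \<in> I
    \<and> (\<forall>x\<in>I. \<forall>y\<in>I. x + y \<in> I)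
    \<and> (\<forall>c. \<forall>x\<in>I. c *\<^sub>C x \<in> I)
    \<and> (\<forall>a\<in>S. \<forall>x\<in>I. a * x \<in> I \<and> x * a \<in> I)"

definition simple_cstar :: "'a::cstar_algebra set \<Rightarrow> bool" where
  "simple_cstar S \<longleftrightarrow> (\<forall>I. closed_ideal I S \<longrightarrow> I = {0} \<or> I = S)"

text \<open>In the next definitions \<open>S\<close> is a C*-subalgebra containing \<open>1\<close>; functionals on \<open>S\<close> are total
  functions of which only the values on \<open>S\<close> matter.\<close>

definition state_on :: "'a::cstar_algebra set \<Rightarrow> ('a \<Rightarrow> complex) \<Rightarrow> bool" where
  "state_on S \<tau> \<longleftrightarrow>
    (\<forall>x\<in>S. \<forall>y\<in>S. \<tau> (x + y) = \<tau> x + \<tau> y)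
    \<and> (\<forall>c. \<forall>x\<in>S. \<tau> (c *\<^sub>C x) = c * \<tau> x)
    \<and> (\<forall>x\<in>S. \<tau> (star x * x) \<in> \<real>\<^sub>\<ge>\<^sub>0)
    \<and> \<tau> 1 = 1"

definition faithful_state_on :: "'a::cstar_algebra set \<Rightarrow> ('a \<Rightarrow> complex) \<Rightarrow> bool" where
  "faithful_state_on S \<tau> \<longleftrightarrow> state_on S \<tau> \<and> (\<forall>x\<in>S. \<tau> (star x * x) = 0 \<longrightarrow> x = 0)"

definition star_hom :: "('a::cstar_algebra \<Rightarrow> 'b::cstar_algebra) \<Rightarrow> bool" where
  "star_hom f \<longleftrightarrow> (\<forall>x y. f (x + y) = f x + f y) \<and> (\<forall>c x. f (c *\<^sub>C x) = c *\<^sub>C f x)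
    \<and> (\<forall>x y. f (x * y) = f x * f y) \<and> (\<forall>x. f (star x) = star (f x))"

definition faithful_representation ::
    "('a::cstar_algebra \<Rightarrow> 'h::chilbert_space bop) \<Rightarrow> bool" where
  "faithful_representation \<pi> \<longleftrightarrow> star_hom \<pi> \<and> \<pi> 1 = 1 \<and> inj \<pi>"

subsection \<open>Group actions and stationary states\<close>

text \<open>The type class of not necessarily commutative groups is written additively: \<open>s + t\<close>, \<open>- s\<close> and
  \<open>0\<close> are the product, the inverse and the neutral element of the group.\<close>

definition gamma_cstar_algebra :: "('g::group_add \<Rightarrow> 'a::cstar_algebra \<Rightarrow> 'a) \<Rightarrow> bool" where
  "gamma_cstar_algebra \<alpha> \<longleftrightarrow> (\<forall>s. star_hom (\<alpha> s) \<and> bij (\<alpha> s))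
    \<and> \<alpha> 0 = id \<and> (\<forall>s t. \<alpha> (s + t) = \<alpha> s \<circ> \<alpha> t)"

text \<open>The sum converges absolutely whenever \<open>\<tau>\<close> is a state on an invariant C*-subalgebra; this is
  \<open>convolution_summable\<close> below.\<close>

definition state_convolution ::
    "'g::group_add pmf \<Rightarrow> ('g \<Rightarrow> 'a \<Rightarrow> 'a) \<Rightarrow> ('a \<Rightarrow> complex) \<Rightarrow> 'a \<Rightarrow> complex" where
  "state_convolution \<mu> \<alpha> \<tau> a = (\<Sum>\<^sub>\<infinity>s. complex_of_real (pmf \<mu> s) * \<tau> (\<alpha> (- s) a))"

definition stationary_state_on ::
    "'g::group_add pmf \<Rightarrow> ('g \<Rightarrow> 'a \<Rightarrow> 'a) \<Rightarrow> 'a::cstar_algebra set \<Rightarrow> ('a \<Rightarrow> complex) \<Rightarrow> bool" where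
  "stationary_state_on \<mu> \<alpha> S \<tau> \<longleftrightarrow> state_on S \<tau> \<and> (\<forall>a\<in>S. state_convolution \<mu> \<alpha> \<tau> a = \<tau> a)"

subsection \<open>The square root of 1 - x, and contractivity\<close>

lemma norm_star [simp]: "norm (star x) = norm (x::'a::cstar_algebra)"
proof -
  have *: "norm x \<le> norm (star x)" for x :: 'a
  proof (cases "x = 0")
    case False
    have "norm x * norm x \<le> norm (star x) * norm x"
      using norm_mult_ineq[of "star x" x] by (simp add: norm_star_mult power2_eq_square)
    then show ?thesis
      using False by simp
  qed simp
  show ?thesis
    using *[of x] *[of "star x"] by simp
qed

lemma star_one [simp]: "star (1::'a::cstar_algebra) = 1"
  by (metis mult_1 mult_1_right star_mult star_star)

lemma norm_one_le: "norm (1::'a::cstar_algebra) \<le> 1"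
proof -
  have "norm (1::'a) = norm (1::'a) * norm (1::'a)"
    using norm_star_mult[of "1::'a"] by (simp add: power2_eq_square)
  then have "norm (1::'a) = 0 \<or> norm (1::'a) = 1"
    by simp
  then show ?thesis
    by linarith
qed

lemma bounded_linear_star: "bounded_linear (star :: 'a::cstar_algebra \<Rightarrow> 'a)"
  by (rule bounded_linear_intro[of _ 1]) (simp_all add: star_add scaleR_scaleC star_scaleC)

lemma star_power: "star (x ^ n) = star x ^ n" for x :: "'a::cstar_algebra"
  by (induction n) (simp_all add: star_mult power_commutes)

lemma norm_power_le: "norm (x ^ n) \<le> norm x ^ n" for x :: "'a::cstar_algebra"
proof (induction n)
  case (Suc n)
  have "norm (x ^ Suc n) \<le> norm x * norm (x ^ n)"
    by (simp add: norm_mult_ineq)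
  also have "\<dots> \<le> norm x * norm x ^ n"
    by (intro mult_left_mono Suc) simp
  finally show ?case
    by simp
qed (simp add: norm_one_le)

lemma abs_half_gchoose_le: "\<bar>(1/2 :: real) gchoose n\<bar> \<le> 1"
proof (induction n)
  case (Suc n)
  have "(1/2 :: real) gchoose Suc n = ((1/2) gchoose n) * ((1/2 - real n) / (real n + 1))"
    using gbinomial_mult_1[of "1/2::real" n] by (simp add: field_simps)
  moreover have "\<bar>(1/2 - real n) / (real n + 1)\<bar> \<le> 1"
    by (simp add: abs_le_iff field_simps)
  ultimately show ?case
    using mult_le_one[OF Suc abs_ge_zero] by (simp only: abs_mult)
qed simp

lemma cstar_subalgebra_power:
  "cstar_subalgebra S \<Longrightarrow> 1 \<in> S \<Longrightarrow> x \<in> S \<Longrightarrow> x ^ n \<in> S"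
  by (induction n) (auto simp: cstar_subalgebra_def)

lemma cstar_subalgebra_sum:
  "cstar_subalgebra S \<Longrightarrow> (\<And>i. i \<in> A \<Longrightarrow> f i \<in> S) \<Longrightarrow> sum f A \<in> S"
  by (induction A rule: infinite_finite_induct) (auto simp: cstar_subalgebra_def)

lemma sqrt_one_minus:
  fixes x :: "'a::cstar_algebra"
  assumes sa: "star x = x" and less: "norm x < 1"
  shows "\<exists>y. star y = y \<and> y * y = 1 - x
    \<and> (\<forall>S. cstar_subalgebra S \<longrightarrow> 1 \<in> S \<longrightarrow> x \<in> S \<longrightarrow> y \<in> S)"
proof -
  define b where "b n = ((1/2 :: real) gchoose n) * (-1) ^ n" for n
  define f where "f n = b n *\<^sub>R x ^ n" for n
  have b_le: "\<bar>b n\<bar> \<le> 1" for n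
    by (simp add: b_def abs_mult power_abs abs_half_gchoose_le)
  have "norm (f n) \<le> norm x ^ n" for n
  proof -
    have "norm (f n) \<le> 1 * norm x ^ n"
      unfolding f_def norm_scaleR by (intro mult_mono b_le norm_power_le) auto
    then show ?thesis by simp
  qed
  then have sn: "summable (\<lambda>n. norm (f n))"
    by (intro summable_comparison_test'[OF summable_geometric[of "norm x"], of 0]) (use less in auto)
  then have s: "summable f"
    by (rule summable_norm_cancel)
  define y where "y = (\<Sum>n. f n)"
  have "star y = (\<Sum>n. star (f n))"
    unfolding y_def by (rule bounded_linear.suminf[OF bounded_linear_star s])
  also have "(\<lambda>n. star (f n)) = f"
    by (rule ext) (simp add: f_def scaleR_scaleC star_scaleC star_power sa)
  finally have "star y = y"
    by (simp add: y_def)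
  moreover have "y * y = 1 - x"
  proof -
    have conv: "(\<Sum>i\<le>k. f i * f (k - i)) = (((1::real) gchoose k) * (-1) ^ k) *\<^sub>R x ^ k" for k
    proof -
      have "f i * f (k - i) = (((1/2 gchoose i) * (1/2 gchoose (k - i))) * (-1) ^ k) *\<^sub>R x ^ k"
        if "i \<le> k" for i
      proof -
        have "(-1 :: real) ^ i * (-1) ^ (k - i) = (-1) ^ k" "x ^ i * x ^ (k - i) = x ^ k"
          using that by (simp_all flip: power_add)
        then show ?thesis
          by (simp add: f_def b_def algebra_simps)
      qed
      then have "(\<Sum>i\<le>k. f i * f (k - i))
          = ((\<Sum>i\<le>k. (1/2 gchoose i) * (1/2 gchoose (k - i))) * (-1) ^ k) *\<^sub>R x ^ k"
        by (simp add: scaleR_sum_left sum_distrib_right)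
      also have "(\<Sum>i\<le>k. ((1/2 :: real) gchoose i) * (1/2 gchoose (k - i))) = 1 gchoose k"
        using gbinomial_Vandermonde[of "1/2::real" "1/2" k] by (simp add: atMost_atLeast0)
      finally show ?thesis .
    qed
    have "y * y = (\<Sum>k. \<Sum>i\<le>k. f i * f (k - i))"
      unfolding y_def by (rule Cauchy_product[OF sn sn])
    also have "\<dots> = (\<Sum>k. (((1::real) gchoose k) * (-1) ^ k) *\<^sub>R x ^ k)"
      by (simp only: conv)
    also have "\<dots> = (\<Sum>k\<in>{0, 1}. (((1::real) gchoose k) * (-1) ^ k) *\<^sub>R x ^ k)"
    proof (rule suminf_finite)
      fix k :: nat
      assume "k \<notin> {0, 1}"
      then have "1 choose k = 0"
        by (intro binomial_eq_0) auto
      moreover have "(1::real) gchoose k = real (1 choose k)"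
        by (simp add: binomial_gbinomial)
      ultimately have "(1::real) gchoose k = 0"
        by (simp only: of_nat_0)
      then show "(((1::real) gchoose k) * (-1) ^ k) *\<^sub>R x ^ k = 0"
        by simp
    qed simp
    also have "\<dots> = 1 - x"
      by simp
    finally show ?thesis .
  qed
  moreover have "y \<in> S" if S: "cstar_subalgebra S" "1 \<in> S" "x \<in> S" for S
  proof -
    have "f n \<in> S" for n
      using cstar_subalgebra_power[OF S, of n] S(1) by (simp add: f_def scaleR_scaleC cstar_subalgebra_def)
    then have "sum f {..<n} \<in> S" for n
      by (intro cstar_subalgebra_sum S(1))
    moreover have "(\<lambda>n. sum f {..<n}) \<longlonglongrightarrow> y"
      unfolding y_def by (rule summable_LIMSEQ[OF s])
    moreover have "closed S"
      using S(1) by (simp add: cstar_subalgebra_def)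
    ultimately show ?thesis
      using closed_sequentially[of S "\<lambda>n. sum f {..<n}" y] by simp
  qed
  ultimately show ?thesis
    by blast
qed

lemma cstar_subalgebra_commutant:
  fixes h :: "'a::cstar_algebra"
  assumes "star h = h"
  shows "cstar_subalgebra {z. z * h = h * z}"
  unfolding cstar_subalgebra_def
proof (intro conjI ballI allI)
  show "closed {z. z * h = h * z}"
    by (intro closed_Collect_eq continuous_intros)
  fix z
  assume "z \<in> {z. z * h = h * z}"
  then have "star (z * h) = star (h * z)"
    by simp
  then show "star z \<in> {z. z * h = h * z}"
    by (simp add: star_mult assms)
next
  fix z w
  assume "z \<in> {z. z * h = h * z}" "w \<in> {z. z * h = h * z}"
  then have z: "z * h = h * z" and w: "w * h = h * w"
    by simp_all
  show "z + w \<in> {z. z * h = h * z}"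
    by (simp add: distrib_left distrib_right z w)
  have "(z * w) * h = z * (h * w)"
    by (simp add: mult.assoc w)
  also have "\<dots> = h * (z * w)"
    by (simp add: z flip: mult.assoc)
  finally show "z * w \<in> {z. z * h = h * z}"
    by simp
qed (simp_all add: scaleC_mult_left scaleC_mult_right)

lemma star_hom_contractive:
  fixes f :: "'a::cstar_algebra \<Rightarrow> 'b::cstar_algebra"
  assumes f: "star_hom f" and one: "f 1 = 1"
  shows "norm (f a) \<le> norm a"
proof -
  have add: "f (x + y) = f x + f y" and sc: "f (c *\<^sub>C x) = c *\<^sub>C f x"
    and mul: "f (x * y) = f x * f y" and st: "f (star x) = star (f x)" for c x y
    using f by (auto simp: star_hom_def)
  have unit_ball: "norm (f h) \<le> 1" if sa: "star h = h" and less: "norm h < 1" for h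
  proof -
    have "norm (h * h) < 1"
      using norm_star_mult[of h] sa less by (simp add: power_less_one_iff)
    moreover have "star (h * h) = h * h"
      by (simp add: star_mult sa)
    ultimately obtain y where y: "star y = y" "y * y = 1 - h * h"
      and S: "\<And>S. cstar_subalgebra S \<Longrightarrow> 1 \<in> S \<Longrightarrow> h * h \<in> S \<Longrightarrow> y \<in> S"
      using sqrt_one_minus by blast
    have comm: "y * h = h * y"
      using S[OF cstar_subalgebra_commutant[OF sa]] by (simp add: mult.assoc)
    define u where "u = h + \<i> *\<^sub>C y"
    have su: "star u = h + (- \<i>) *\<^sub>C y"
      by (simp add: u_def star_add star_scaleC sa y)
    have "star u * u = h * h + y * y + (\<i> *\<^sub>C (h * y) + (- \<i>) *\<^sub>C (h * y))"
      unfolding su unfolding u_def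
      by (simp add: distrib_left distrib_right scaleC_mult_left scaleC_mult_right
          scaleC_scaleC scaleC_add_right comm add_ac)
    also have "\<i> *\<^sub>C (h * y) + (- \<i>) *\<^sub>C (h * y) = 0"
      by (simp flip: scaleC_add_left)
    finally have "star u * u = h * h + y * y"
      by simp
    then have "star u * u = 1"
      by (simp add: y)
    then have "(norm (f u))\<^sup>2 = norm (1::'b)"
      by (metis mul norm_star_mult one st)
    then have "(norm (f u))\<^sup>2 \<le> 1\<^sup>2"
      using norm_one_le[where 'a = 'b] by simp
    then have fu: "norm (f u) \<le> 1"
      by (rule power2_le_imp_le) simp
    have "u + star u = 2 *\<^sub>C h"
      using scaleC_add_left[of 1 1 h]
      unfolding su unfolding u_def by (simp add: add_ac flip: scaleC_add_left)
    then have "2 *\<^sub>C f h = f u + star (f u)"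
      by (metis add sc st)
    then have "norm (2 *\<^sub>R f h) \<le> norm (f u) + norm (star (f u))"
      by (metis norm_triangle_ineq scaleR_scaleC of_real_numeral)
    then show ?thesis
      using fu by simp
  qed
  have selfadj: "norm (f k) \<le> norm k" if sa: "star k = k" for k
  proof (rule field_le_epsilon)
    fix e :: real
    assume "e > 0"
    define r where "r = norm k + e"
    have r: "r > 0" "norm k < r"
      using \<open>e > 0\<close> by (auto simp: r_def add_nonneg_pos)
    have *: "norm (f (complex_of_real (inverse r) *\<^sub>C k)) \<le> 1"
    proof (rule unit_ball)
      show "norm (complex_of_real (inverse r) *\<^sub>C k) < 1"
        using r unfolding scaleR_scaleC[symmetric] by (simp add: divide_simps)
    qed (simp add: star_scaleC sa)
    have "norm (inverse r *\<^sub>R f k) \<le> 1"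
      using * unfolding scaleR_scaleC by (simp only: sc)
    then have "norm (f k) / r \<le> 1"
      using r(1) by (simp add: divide_inverse mult.commute)
    then show "norm (f k) \<le> norm k + e"
      using r by (simp add: r_def)
  qed
  have "(norm (f a))\<^sup>2 = norm (f (star a * a))"
    by (simp add: mul st norm_star_mult)
  also have "\<dots> \<le> norm (star a * a)"
    by (rule selfadj) (simp add: star_mult)
  also have "\<dots> = (norm a)\<^sup>2"
    by (rule norm_star_mult)
  finally show ?thesis
    by (rule power2_le_imp_le) simp
qed

lemma star_hom_surj_one:
  assumes "star_hom f" "surj f"
  shows "f 1 = 1"
proof -
  obtain x where x: "f x = 1"
    using surjD[OF assms(2), of 1] by auto
  have "f (1 * x) = f 1 * f x"
    using assms(1) unfolding star_hom_def by blast
  then show ?thesis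
    unfolding mult_1 x mult_1_right by (rule sym)
qed

lemma gamma_action_contractive:
  assumes "gamma_cstar_algebra \<alpha>"
  shows "norm (\<alpha> s a) \<le> norm a"
proof (rule star_hom_contractive)
  show hom: "star_hom (\<alpha> s)"
    using assms by (simp add: gamma_cstar_algebra_def)
  have "bij (\<alpha> s)"
    using assms by (simp add: gamma_cstar_algebra_def)
  then show "\<alpha> s 1 = 1"
    using star_hom_surj_one[OF hom] bij_is_surj by blast
qed

subsection \<open>The regular representation and the reduced crossed product\<close>

text \<open>That these descriptions determine bounded operators is shown in \<open>left_translation_apply\<close> and
  \<open>crossed_representation_apply\<close>.\<close>

definition left_translation :: "'g::group_add \<Rightarrow> ('g, 'h::chilbert_space) ell2 bop" where
  "left_translation s = (THE T. \<forall>\<xi> t. ell2_apply (bop_apply T \<xi>) t = ell2_apply \<xi> (- s + t))"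

definition crossed_representation ::
    "('g::group_add \<Rightarrow> 'a \<Rightarrow> 'a) \<Rightarrow> ('a \<Rightarrow> 'h::chilbert_space bop) \<Rightarrow> 'a \<Rightarrow> ('g, 'h) ell2 bop" where
  "crossed_representation \<alpha> \<pi> a =
    (THE T. \<forall>\<xi> t. ell2_apply (bop_apply T \<xi>) t = bop_apply (\<pi> (\<alpha> (- t) a)) (ell2_apply \<xi> t))"

lemma ell2_bop_exists1:
  fixes F :: "('g \<Rightarrow> 'h::chilbert_space) \<Rightarrow> 'g \<Rightarrow> 'h"
  assumes add: "\<And>(\<xi> :: 'g \<Rightarrow> 'h) \<eta> t. F (\<lambda>t. \<xi> t + \<eta> t) t = F \<xi> t + F \<eta> t"
    and scale: "\<And>c \<xi> t. F (\<lambda>t. c *\<^sub>C \<xi> t) t = c *\<^sub>C F \<xi> t"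
    and bounded: "\<And>\<xi> (A :: 'g set). finite A \<Longrightarrow> \<exists>A'. finite A' \<and>
      L2_set (\<lambda>t. norm (F \<xi> t)) A \<le> L2_set (\<lambda>t. norm (\<xi> t)) A' * K"
    and K: "K \<ge> 0"
  shows "\<exists>!T. \<forall>\<xi> t. ell2_apply (bop_apply T \<xi>) t = F (ell2_apply \<xi>) t"
proof -
  have bound: "L2_set (\<lambda>t. norm (F (ell2_apply \<xi>) t)) A \<le> norm \<xi> * K" if A: "finite A" for \<xi> A
  proof -
    obtain A' where A': "finite A'"
      "L2_set (\<lambda>t. norm (F (ell2_apply \<xi>) t)) A \<le> L2_set (\<lambda>t. norm (ell2_apply \<xi> t)) A' * K"
      using bounded[OF A, of "ell2_apply \<xi>"] by blast
    moreover have "L2_set (\<lambda>t. norm (ell2_apply \<xi> t)) A' \<le> norm \<xi>"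
      unfolding norm_ell2.rep_eq by (rule L2_set_le_ell2[OF ell2_apply_summable A'(1)])
    ultimately show ?thesis
      using K by (meson mult_right_mono order_trans)
  qed
  then have s: "(\<lambda>t. (norm (F (ell2_apply \<xi>) t))\<^sup>2) summable_on UNIV" for \<xi>
    by (rule square_summableI)
  define G where "G \<xi> = Abs_ell2 (F (ell2_apply \<xi>))" for \<xi>
  have G: "ell2_apply (G \<xi>) = F (ell2_apply \<xi>)" for \<xi>
    using s by (simp add: G_def Abs_ell2_inverse)
  have "\<exists>T. bop_apply T = G"
  proof (rule bop_exists)
    show "G (x + y) = G x + G y" for x y
      by (rule ell2_eqI) (simp add: G plus_ell2.rep_eq add)
    show "G (c *\<^sub>C x) = c *\<^sub>C G x" for c x
      by (rule ell2_eqI) (simp add: G scaleC_ell2.rep_eq scale)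
    show "norm (G x) \<le> norm x * K" for x
      unfolding norm_ell2.rep_eq[of "G x"]
      by (rule ell2_le_L2_set[OF ell2_apply_summable]) (simp add: G bound)
  qed
  then obtain T where T: "bop_apply T = G"
    by blast
  show ?thesis
  proof (rule ex1I[of _ T])
    show "\<forall>\<xi> t. ell2_apply (bop_apply T \<xi>) t = F (ell2_apply \<xi>) t"
      by (simp add: T G)
    fix T'
    assume "\<forall>\<xi> t. ell2_apply (bop_apply T' \<xi>) t = F (ell2_apply \<xi>) t"
    then show "T' = T"
      by - (rule bop_eqI, rule ell2_eqI, simp add: T G)
  qed
qed

lemma left_translation_apply:
  fixes \<xi> :: "('g::group_add, 'h::chilbert_space) ell2"
  shows "ell2_apply (bop_apply (left_translation s) \<xi>) t = ell2_apply \<xi> (- s + t)"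
proof -
  have "\<exists>!T. \<forall>(\<xi> :: ('g, 'h) ell2) t.
      ell2_apply (bop_apply T \<xi>) t = (\<lambda>\<xi> t. \<xi> (- s + t)) (ell2_apply \<xi>) t"
  proof (rule ell2_bop_exists1[where K = 1])
    fix \<xi> :: "'g \<Rightarrow> 'h" and A :: "'g set"
    assume "finite A"
    moreover have "L2_set (\<lambda>t. norm (\<xi> (- s + t))) A = L2_set (\<lambda>t. norm (\<xi> t)) ((+) (- s) ` A)"
      by (simp add: L2_set_def sum.reindex)
    ultimately show "\<exists>A'. finite A' \<and>
        L2_set (\<lambda>t. norm (\<xi> (- s + t))) A \<le> L2_set (\<lambda>t. norm (\<xi> t)) A' * 1"
      by (intro exI[of _ "(+) (- s) ` A"]) simp
  qed simp_all
  from theI'[OF this] show ?thesis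
    unfolding left_translation_def by blast
qed

lemma crossed_representation_apply:
  fixes \<xi> :: "('g::group_add, 'h::chilbert_space) ell2"
  assumes \<alpha>: "gamma_cstar_algebra \<alpha>" and \<pi>: "star_hom \<pi>" "\<pi> 1 = 1"
  shows "ell2_apply (bop_apply (crossed_representation \<alpha> \<pi> a) \<xi>) t
    = bop_apply (\<pi> (\<alpha> (- t) a)) (ell2_apply \<xi> t)"
proof -
  have le: "norm (\<pi> (\<alpha> s a)) \<le> norm a" for s
    by (rule order_trans[OF star_hom_contractive[OF \<pi>] gamma_action_contractive[OF \<alpha>]])
  have "\<exists>!T. \<forall>(\<xi> :: ('g, 'h) ell2) t. ell2_apply (bop_apply T \<xi>) t
      = (\<lambda>\<xi> t. bop_apply (\<pi> (\<alpha> (- t) a)) (\<xi> t)) (ell2_apply \<xi>) t"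
  proof (rule ell2_bop_exists1[where K = "norm a"])
    fix \<xi> :: "'g \<Rightarrow> 'h" and A :: "'g set"
    assume "finite A"
    have "norm (bop_apply (\<pi> (\<alpha> (- t) a)) (\<xi> t)) \<le> norm (\<xi> t) * norm a" for t
    proof -
      have "norm (bop_apply (\<pi> (\<alpha> (- t) a)) (\<xi> t)) \<le> norm (\<pi> (\<alpha> (- t) a)) * norm (\<xi> t)"
        by (rule norm_bop_apply)
      also have "\<dots> \<le> norm a * norm (\<xi> t)"
        by (intro mult_right_mono le) simp
      finally show ?thesis
        by (simp add: mult.commute)
    qed
    then have "L2_set (\<lambda>t. norm (bop_apply (\<pi> (\<alpha> (- t) a)) (\<xi> t))) A
        \<le> L2_set (\<lambda>t. norm (\<xi> t) * norm a) A"
      by (intro L2_set_mono) simp_all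
    then show "\<exists>A'. finite A' \<and> L2_set (\<lambda>t. norm (bop_apply (\<pi> (\<alpha> (- t) a)) (\<xi> t))) A
        \<le> L2_set (\<lambda>t. norm (\<xi> t)) A' * norm a"
      using \<open>finite A\<close> by (intro exI[of _ A]) (simp add: L2_set_left_distrib)
  qed (simp_all add: bop_apply_scaleC linear_add[OF bounded_linear.linear[OF bounded_linear_bop_apply]])
  from theI'[OF this] show ?thesis
    unfolding crossed_representation_def by blast
qed

lemma state_star:
  assumes S: "cstar_subalgebra S" "1 \<in> S" and \<tau>: "state_on S \<tau>" and a: "a \<in> S"
  shows "\<tau> (star a) = cnj (\<tau> a)"
    and "(cmod (\<tau> a))\<^sup>2 \<le> Re (\<tau> (star a * a))"
proof -
  have clos: "\<And>x y. x \<in> S \<Longrightarrow> y \<in> S \<Longrightarrow> x + y \<in> S" "\<And>x y. x \<in> S \<Longrightarrow> y \<in> S \<Longrightarrow> x * y \<in> S"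
      "\<And>c x. x \<in> S \<Longrightarrow> c *\<^sub>C x \<in> S" "\<And>x. x \<in> S \<Longrightarrow> star x \<in> S"
    using S by (auto simp: cstar_subalgebra_def)
  have lin: "\<And>x y. x \<in> S \<Longrightarrow> y \<in> S \<Longrightarrow> \<tau> (x + y) = \<tau> x + \<tau> y"
      "\<And>c x. x \<in> S \<Longrightarrow> \<tau> (c *\<^sub>C x) = c * \<tau> x" "\<tau> 1 = 1"
    and pos: "\<And>x. x \<in> S \<Longrightarrow> \<tau> (star x * x) \<in> \<real>\<^sub>\<ge>\<^sub>0"
    using \<tau> by (auto simp: state_on_def)
  have expand: "\<tau> (star a * a) + c * \<tau> (star a) + (cnj c * \<tau> a + cnj c * c) \<in> \<real>\<^sub>\<ge>\<^sub>0" for c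
  proof -
    have "star (a + c *\<^sub>C 1) * (a + c *\<^sub>C 1)
        = (star a * a + c *\<^sub>C star a) + (cnj c *\<^sub>C a + (cnj c * c) *\<^sub>C 1)"
      by (simp add: star_add star_scaleC distrib_left distrib_right scaleC_mult_left
          scaleC_mult_right scaleC_scaleC scaleC_add_right mult.commute add_ac)
    then show ?thesis
      using pos[of "a + c *\<^sub>C 1"] a S(2) by (simp add: clos lin)
  qed
  have "Im (\<tau> (star a * a)) = 0"
    using pos[OF a] by (simp add: complex_nonneg_Reals_iff)
  then show herm: "\<tau> (star a) = cnj (\<tau> a)"
    using expand[of 1] expand[of \<i>] by (simp add: complex_nonneg_Reals_iff complex_eq_iff)
  show "(cmod (\<tau> a))\<^sup>2 \<le> Re (\<tau> (star a * a))"
    using expand[of "- \<tau> a"]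
    by (simp add: herm complex_nonneg_Reals_iff cmod_power2 flip: power2_eq_square)
qed

lemma state_contractive:
  assumes S: "cstar_subalgebra S" "1 \<in> S" and \<tau>: "state_on S \<tau>" and a: "a \<in> S"
  shows "cmod (\<tau> a) \<le> norm a"
proof (rule field_le_epsilon)
  fix e :: real
  assume "e > 0"
  define r where "r = norm a + e"
  have r: "r > 0" "norm a < r"
    using \<open>e > 0\<close> by (auto simp: r_def add_nonneg_pos)
  define d where "d = complex_of_real (inverse r) *\<^sub>C a"
  have dS: "d \<in> S" "star d * d \<in> S"
    using a S by (auto simp: d_def cstar_subalgebra_def)
  have "norm d < 1"
    using r unfolding d_def scaleR_scaleC[symmetric] by (simp add: divide_simps)
  then have "norm (star d * d) < 1"
    by (simp add: norm_star_mult power_less_one_iff)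
  moreover have "star (star d * d) = star d * d"
    by (simp add: star_mult)
  ultimately obtain y where y: "star y = y" "y * y = 1 - star d * d" "y \<in> S"
    using sqrt_one_minus[of "star d * d"] S dS by blast
  have lin: "\<And>x y. x \<in> S \<Longrightarrow> y \<in> S \<Longrightarrow> \<tau> (x + y) = \<tau> x + \<tau> y"
      "\<And>c x. x \<in> S \<Longrightarrow> \<tau> (c *\<^sub>C x) = c * \<tau> x" "\<tau> 1 = 1"
    and pos: "\<And>x. x \<in> S \<Longrightarrow> \<tau> (star x * x) \<in> \<real>\<^sub>\<ge>\<^sub>0"
    using \<tau> by (auto simp: state_on_def)
  have "y * y \<in> S"
    using S(1) y(3) by (simp add: cstar_subalgebra_def)
  then have "\<tau> (y * y) + \<tau> (star d * d) = 1"
    using lin(1)[of "y * y" "star d * d"] dS y(2) lin(3) by simp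
  from arg_cong[OF this, of Re] have "Re (\<tau> (y * y)) + Re (\<tau> (star d * d)) = 1"
    by simp
  moreover have "Re (\<tau> (y * y)) \<ge> 0"
    using pos[OF y(3)] y(1) by (simp add: complex_nonneg_Reals_iff)
  ultimately have "Re (\<tau> (star d * d)) \<le> 1"
    by linarith
  then have "(cmod (\<tau> d))\<^sup>2 \<le> 1\<^sup>2"
    using state_star(2)[OF S \<tau> dS(1)] by simp
  then have "cmod (\<tau> d) \<le> 1"
    by (rule power2_le_imp_le) simp
  moreover have "cmod (\<tau> d) = cmod (\<tau> a) / r"
  proof -
    have "\<tau> d = complex_of_real (inverse r) * \<tau> a"
      unfolding d_def by (rule lin(2)[OF a])
    then show ?thesis
      using r(1) by (simp add: norm_mult norm_inverse divide_inverse mult.commute)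
  qed
  ultimately have "cmod (\<tau> a) \<le> r"
    using r(1) by simp
  then show "cmod (\<tau> a) \<le> norm a + e"
    by (simp only: r_def)
qed

lemma convolution_summable:
  assumes S: "cstar_subalgebra S" "1 \<in> S" and \<tau>: "state_on S \<tau>"
    and \<alpha>: "\<And>s. \<alpha> s a \<in> S" "\<And>s. norm (\<alpha> s a) \<le> norm a"
  shows "(\<lambda>s. complex_of_real (pmf \<mu> s) * \<tau> (\<alpha> (- s) a)) summable_on UNIV"
proof (rule abs_summable_summable, rule Infinite_Sum.abs_summable_on_comparison_test)
  have "(\<lambda>s. norm (pmf \<mu> s)) summable_on UNIV"
    by (rule iffD2[OF abs_summable_equivalent pmf_abs_summable])
  then have "(\<lambda>s. pmf \<mu> s * norm a) summable_on UNIV"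
    by (intro summable_on_cmult_left) simp
  then show "(\<lambda>s. norm (pmf \<mu> s * norm a)) summable_on UNIV"
    by simp
  fix s
  have "cmod (\<tau> (\<alpha> (- s) a)) \<le> norm a"
    using state_contractive[OF S \<tau> \<alpha>(1)] \<alpha>(2) by (rule order_trans)
  then show "norm (complex_of_real (pmf \<mu> s) * \<tau> (\<alpha> (- s) a)) \<le> norm (pmf \<mu> s * norm a)"
    unfolding norm_mult by (intro mult_mono) simp_all
qed

text \<open>For \<open>'h = complex\<close> this is the reduced group C*-algebra itself; for general \<open>'h\<close> it is its copy
  inside the reduced crossed products acting on the same space.\<close>

definition reduced_group_cstar :: "('g::group_add, 'h::chilbert_space) ell2 bop set" where
  "reduced_group_cstar = cstar_generated (range left_translation)"

definition reduced_crossed_product ::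
    "('g::group_add \<Rightarrow> 'a::cstar_algebra \<Rightarrow> 'a) \<Rightarrow> ('a \<Rightarrow> 'h::chilbert_space bop) \<Rightarrow> ('g, 'h) ell2 bop set"
  where "reduced_crossed_product \<alpha> \<pi> =
    cstar_generated (range left_translation \<union> range (crossed_representation \<alpha> \<pi>))"

lift_definition ell2_delta :: "'g \<Rightarrow> ('g, complex) ell2" is "\<lambda>s t. if t = s then 1 else 0"
proof -
  fix s :: 'g
  show "(\<lambda>t. (norm (if t = s then 1 else 0 :: complex))\<^sup>2) summable_on UNIV"
  proof (rule square_summableI[of _ 1])
    fix F :: "'g set"
    assume "finite F"
    have "(\<Sum>t\<in>F. (norm (if t = s then 1 else 0 :: complex))\<^sup>2) = (\<Sum>t\<in>F. if t = s then 1 else 0)"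
      by (rule sum.cong) auto
    also have "\<dots> \<le> (1 :: real)"
      using \<open>finite F\<close> by simp
    finally show "L2_set (\<lambda>t. norm (if t = s then 1 else 0 :: complex)) F \<le> 1"
      by (simp add: L2_set_def)
  qed
qed

definition canonical_trace :: "('g::group_add, complex) ell2 bop \<Rightarrow> complex" where
  "canonical_trace a = cinner (ell2_delta 0) (bop_apply a (ell2_delta 0))"

lemma cinner_ell2_delta: "cinner (ell2_delta s) \<xi> = ell2_apply \<xi> s"
proof -
  have "cinner (ell2_delta s) \<xi> = (\<Sum>\<^sub>\<infinity>t\<in>{s}. cinner (ell2_apply (ell2_delta s) t) (ell2_apply \<xi> t))"
    unfolding cinner_ell2.rep_eq
    by (rule infsum_cong_neutral) (auto simp: ell2_delta.rep_eq cinner_complex_def)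
  then show ?thesis
    by (simp add: ell2_delta.rep_eq cinner_complex_def)
qed

lemma canonical_trace_left_translation:
  "canonical_trace (left_translation s) = (if s = 0 then 1 else 0)"
  by (simp add: canonical_trace_def cinner_ell2_delta left_translation_apply ell2_delta.rep_eq)

definition inner_action ::
    "'g::group_add \<Rightarrow> ('g, complex) ell2 bop \<Rightarrow> ('g, complex) ell2 bop" where
  "inner_action s a = left_translation s * a * star (left_translation s)"

definition cstar_simple_measure :: "'g::group_add pmf \<Rightarrow> bool" where
  "cstar_simple_measure \<mu> \<longleftrightarrow>
    stationary_state_on \<mu> inner_action reduced_group_cstar canonical_trace
    \<and> (\<forall>\<tau>. stationary_state_on \<mu> inner_action reduced_group_cstar \<tau>
        \<longrightarrow> (\<forall>a\<in>reduced_group_cstar. \<tau> a = canonical_trace a))"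

end

theory Submission
  imports Defs
begin

text \<open>Let \<open>I\<close> be an ideal of \<open>B\<close> with \<open>1 \<notin> I\<close>. Limits of vector states give a state that vanishes
  on \<open>I\<close>, and averaging it along \<open>\<mu>\<close> gives a stationary state \<open>\<phi>\<close> on all bounded operators that vanishes
  on \<open>I\<close>. Uniqueness of the stationary state on the reduced group algebra forces the averages of
  \<open>\<lambda>\<^sub>s\<close>, \<open>s \<noteq> 0\<close>, to be arbitrarily small in norm; because the weights are nonnegative, the averages
  of \<open>\<sigma>(a) \<lambda>\<^sub>s\<close> are dominated pointwise by \<open>norm a\<close> times those of \<open>\<lambda>\<^sub>s\<close>, so \<open>\<phi>\<close> vanishes on
  \<open>\<sigma>(a) \<lambda>\<^sub>s\<close> as well. Hence \<open>\<phi>\<close> is determined by the stationary, so faithful, state \<open>\<phi> \<circ> \<sigma>\<close>, and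
  the vanishing of \<open>\<phi>(y\<^sup>* y)\<close> for \<open>y \<in> I\<close> makes all coefficients of elements of \<open>I\<close> zero.\<close>

subsection \<open>Injective representations are isometric\<close>

text \<open>Since \<open>\<sigma>(a)\<close> need not lie in \<open>B\<close>, taking coefficients
  does not stay inside \<open>B\<close>. This is why \<open>\<phi>\<close> lives on all operators:
  vector states do so from the start, so no extension theorem enters, and Cauchy-Schwarz turns
  \<open>\<phi>(y\<^sup>* y) = 0\<close> into \<open>\<phi>(u\<^sup>* y) = 0\<close> for every
  operator \<open>u\<close>. If \<open>a\<close> is the coefficient of \<open>y\<close> at the
  neutral element, the choice \<open>u = \<sigma>(a)\<close> gives
  \<open>\<phi>(\<sigma>(a\<^sup>* a)) = 0\<close>, and faithfulness yields \<open>a = 0\<close>.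
  Averaging \<open>\<sigma>(a) \<lambda>\<^sub>s\<close> changes the coefficient from term to term,
  and the triangle inequality would destroy the cancellation-free smallness of the scalar averages.
  Comparing values at each point of the group keeps it. That the coefficient of a limit of
  polynomials again comes from the algebra requires \<open>\<pi>\<close> to be isometric. This is
  derived from injectivity with square roots given by power series, in place of spectral
  theory.\<close>

definition half_coeff :: "nat \<Rightarrow> real" where
  "half_coeff n = ((1/2 :: real) gchoose n) * (-1) ^ n"

lemma star_diff: "star (x - y) = star x - star (y :: 'a::cstar_algebra)"
  using bounded_linear_star by (rule linear_diff[OF bounded_linear.linear])

lemma half_coeff_0 [simp]: "half_coeff 0 = 1"
  by (simp add: half_coeff_def)

lemma half_coeff_Suc: "half_coeff (Suc n) = half_coeff n * ((real n - 1/2) / (real n + 1))"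
proof -
  have "(1/2 :: real) gchoose Suc n = ((1/2) gchoose n) * ((1/2 - real n) / (real n + 1))"
    using gbinomial_mult_1[of "1/2::real" n] by (simp add: field_simps)
  then show ?thesis
    by (simp only: half_coeff_def) (simp add: field_simps)
qed

text \<open>\<open>half_coeff\<close> lists the Taylor coefficients of sqrt(1 - x). In their
  recursion only the factor at index 0 is negative, so the sign changes just once.\<close>

lemma half_coeff_Suc_nonpos: "half_coeff (Suc n) \<le> 0"
proof (induction n)
  case (Suc n)
  have "half_coeff (Suc (Suc n)) = half_coeff (Suc n) * ((real (Suc n) - 1/2) / (real (Suc n) + 1))"
    by (rule half_coeff_Suc)
  also have "\<dots> \<le> 0"
    by (intro mult_nonpos_nonneg Suc divide_nonneg_nonneg) simp_all
  finally show ?case .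
qed (simp add: half_coeff_Suc)

text \<open>Partial sums of coefficients correspond to division by 1 - x, so these are the
  coefficients of (1 - x)^(-1/2), all of which are positive.\<close>

lemma sum_half_coeff_nonneg: "0 \<le> (\<Sum>k\<le>m. half_coeff k)"
proof -
  have "(\<Sum>k\<le>m. half_coeff k) = (- 1) ^ m * ((- 1/2 :: real) gchoose m)"
    using gbinomial_sum_lower_neg[of "1/2 :: real" m] by (simp add: half_coeff_def)
  also have "\<dots> \<ge> 0"
  proof (induction m)
    case (Suc m)
    have "(- 1/2 :: real) gchoose Suc m = ((- 1/2) gchoose m) * ((- 1/2 - real m) / (real m + 1))"
      using gbinomial_mult_1[of "- 1/2::real" m] by (simp add: field_simps)
    then have "(- 1) ^ Suc m * ((- 1/2 :: real) gchoose Suc m)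
        = ((- 1) ^ m * ((- 1/2 :: real) gchoose m)) * ((1/2 + real m) / (real m + 1))"
      by (simp only:) (simp add: field_simps)
    also have "\<dots> \<ge> 0"
      by (intro mult_nonneg_nonneg Suc divide_nonneg_nonneg) simp_all
    finally show ?case .
  qed simp
  finally show ?thesis .
qed

text \<open>All coefficients after the leading 1 have the same sign, so the absolute sum is 1 minus
  a nonnegative partial sum. This gives convergence on the closed unit ball.\<close>

lemma sum_abs_half_coeff_le: "(\<Sum>k<n. \<bar>half_coeff (Suc k)\<bar>) \<le> 1"
proof -
  have "(\<Sum>k<n. \<bar>half_coeff (Suc k)\<bar>) = - (\<Sum>k<n. half_coeff (Suc k))"
    using half_coeff_Suc_nonpos by (simp add: abs_of_nonpos sum_negf)
  moreover have "(\<Sum>k\<le>n. half_coeff k) = 1 + (\<Sum>k<n. half_coeff (Suc k))"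
    by (simp add: sum.atMost_shift)
  ultimately show ?thesis
    using sum_half_coeff_nonneg[of n] by linarith
qed

lemma summable_abs_half_coeff: "summable (\<lambda>n. \<bar>half_coeff n\<bar>)"
proof -
  have "summable (\<lambda>n. \<bar>half_coeff (Suc n)\<bar>)"
    by (rule summableI_nonneg_bounded[of _ 1]) (simp_all add: sum_abs_half_coeff_le)
  then show ?thesis
    by (subst (asm) summable_Suc_iff)
qed

text \<open>In contrast to \<open>sqrt_one_minus\<close>, the boundary case \<open>norm x = 1\<close> is included.\<close>

definition sqrt_series :: "'a::cstar_algebra \<Rightarrow> 'a" where
  "sqrt_series x = (\<Sum>n. half_coeff n *\<^sub>R x ^ n)"

context
  fixes x :: "'a::cstar_algebra"
  assumes x: "norm x \<le> 1"
begin

lemma norm_sqrt_series_term: "norm (half_coeff n *\<^sub>R x ^ n) \<le> \<bar>half_coeff n\<bar>"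
proof -
  have "norm (x ^ n) \<le> 1"
    using norm_power_le[of x n] power_le_one[OF norm_ge_zero x, of n] by linarith
  then show ?thesis
    by (simp add: mult_left_le)
qed

lemma summable_norm_sqrt_series: "summable (\<lambda>n. norm (half_coeff n *\<^sub>R x ^ n))"
  by (rule summable_comparison_test'[OF summable_abs_half_coeff, of 0])
    (use norm_sqrt_series_term in simp)

lemma summable_sqrt_series: "summable (\<lambda>n. half_coeff n *\<^sub>R x ^ n)"
  by (rule summable_norm_cancel) (rule summable_norm_sqrt_series)

lemma sqrt_series_square: "sqrt_series x * sqrt_series x = 1 - x"
proof -
  define f where "f n = half_coeff n *\<^sub>R x ^ n" for n
  \<comment> \<open>Vandermonde's identity: the exponents 1/2 and 1/2 add up to 1, and the series of
    exponent 1 stops after two terms.\<close>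
  have conv: "(\<Sum>i\<le>k. f i * f (k - i)) = (((1::real) gchoose k) * (-1) ^ k) *\<^sub>R x ^ k" for k
  proof -
    have "f i * f (k - i) = (((1/2 gchoose i) * (1/2 gchoose (k - i))) * (-1) ^ k) *\<^sub>R x ^ k"
      if "i \<le> k" for i
    proof -
      have "(-1 :: real) ^ i * (-1) ^ (k - i) = (-1) ^ k" "x ^ i * x ^ (k - i) = x ^ k"
        using that by (simp_all flip: power_add)
      then show ?thesis
        by (simp add: f_def half_coeff_def algebra_simps)
    qed
    then have "(\<Sum>i\<le>k. f i * f (k - i))
        = ((\<Sum>i\<le>k. (1/2 gchoose i) * (1/2 gchoose (k - i))) * (-1) ^ k) *\<^sub>R x ^ k"
      by (simp add: scaleR_sum_left sum_distrib_right)
    also have "(\<Sum>i\<le>k. ((1/2 :: real) gchoose i) * (1/2 gchoose (k - i))) = 1 gchoose k"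
      using gbinomial_Vandermonde[of "1/2::real" "1/2" k] by (simp add: atMost_atLeast0)
    finally show ?thesis .
  qed
  have "sqrt_series x * sqrt_series x = (\<Sum>k. \<Sum>i\<le>k. f i * f (k - i))"
    unfolding sqrt_series_def f_def
    by (rule Cauchy_product) (rule summable_norm_sqrt_series)+
  also have "\<dots> = (\<Sum>k. (((1::real) gchoose k) * (-1) ^ k) *\<^sub>R x ^ k)"
    by (simp only: conv)
  also have "\<dots> = (\<Sum>k\<in>{0, 1}. (((1::real) gchoose k) * (-1) ^ k) *\<^sub>R x ^ k)"
  proof (rule suminf_finite)
    fix k :: nat
    assume "k \<notin> {0, 1}"
    then have "1 choose k = 0"
      by (intro binomial_eq_0) auto
    moreover have "(1::real) gchoose k = real (1 choose k)"
      by (simp add: binomial_gbinomial)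
    ultimately have "(1::real) gchoose k = 0"
      by (simp only: of_nat_0)
    then show "(((1::real) gchoose k) * (-1) ^ k) *\<^sub>R x ^ k = 0"
      by simp
  qed simp
  also have "\<dots> = 1 - x"
    by simp
  finally show ?thesis .
qed

lemma star_sqrt_series:
  assumes "star x = x"
  shows "star (sqrt_series x) = sqrt_series x"
proof -
  have "star (sqrt_series x) = (\<Sum>n. star (half_coeff n *\<^sub>R x ^ n))"
    unfolding sqrt_series_def by (rule bounded_linear.suminf[OF bounded_linear_star
        summable_sqrt_series])
  then show ?thesis
    by (simp add: sqrt_series_def scaleR_scaleC star_scaleC star_power assms)
qed

lemma sqrt_series_commute:
  assumes "z * x = x * z"
  shows "z * sqrt_series x = sqrt_series x * z"
proof -
  have *: "z * x ^ n = x ^ n * z" for n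
    by (rule power_commuting_commutes[symmetric]) (rule assms[symmetric])
  have "z * sqrt_series x = (\<Sum>n. z * (half_coeff n *\<^sub>R x ^ n))"
    unfolding sqrt_series_def by (rule suminf_mult[OF summable_sqrt_series, symmetric])
  also have "\<dots> = (\<Sum>n. (half_coeff n *\<^sub>R x ^ n) * z)"
    by (simp add: *)
  also have "\<dots> = sqrt_series x * z"
    unfolding sqrt_series_def by (rule suminf_mult2[OF summable_sqrt_series, symmetric])
  finally show ?thesis .
qed

text \<open>Because \<open>1 - sqrt_series x\<close> stays in the closed unit ball, the series can
  be applied to it again, which produces fourth roots.\<close>

lemma norm_one_minus_sqrt_series: "norm (1 - sqrt_series x) \<le> 1"
proof -
  have s: "summable (\<lambda>n. half_coeff (Suc n) *\<^sub>R x ^ Suc n)"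
    using summable_sqrt_series summable_Suc_iff[of "\<lambda>n. half_coeff n *\<^sub>R x ^ n"] by blast
  have sn: "summable (\<lambda>n. norm (half_coeff (Suc n) *\<^sub>R x ^ Suc n))"
    using summable_norm_sqrt_series summable_Suc_iff[of "\<lambda>n. norm (half_coeff n *\<^sub>R x ^ n)"]
    by blast
  have sa: "summable (\<lambda>n. \<bar>half_coeff (Suc n)\<bar>)"
    using summable_abs_half_coeff summable_Suc_iff[of "\<lambda>n. \<bar>half_coeff n\<bar>"] by blast
  have "sqrt_series x = 1 + (\<Sum>n. half_coeff (Suc n) *\<^sub>R x ^ Suc n)"
    unfolding sqrt_series_def using suminf_split_head[OF summable_sqrt_series] by simp
  then have "norm (1 - sqrt_series x) = norm (\<Sum>n. half_coeff (Suc n) *\<^sub>R x ^ Suc n)"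
    by (metis add_diff_cancel_left' norm_minus_commute)
  also have "\<dots> \<le> (\<Sum>n. norm (half_coeff (Suc n) *\<^sub>R x ^ Suc n))"
    by (rule summable_norm[OF sn])
  also have "\<dots> \<le> (\<Sum>n. \<bar>half_coeff (Suc n)\<bar>)"
    by (rule suminf_le[OF _ sn sa]) (rule norm_sqrt_series_term)
  also have "\<dots> \<le> 1"
    by (rule suminf_le_const[OF sa]) (rule sum_abs_half_coeff_le)
  finally show ?thesis .
qed

end

text \<open>The element \<open>a + \<i> b\<close> is unitary and \<open>a\<close> is its real part.\<close>

lemma norm_le_one_if_squares_sum_to_one:
  fixes a b :: "'a::cstar_algebra"
  assumes a: "star a = a" and b: "star b = b" and comm: "a * b = b * a" and "a * a + b * b = 1"
  shows "norm a \<le> 1"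
proof -
  define u where "u = a + \<i> *\<^sub>C b"
  have su: "star u = a + (- \<i>) *\<^sub>C b"
    by (simp add: u_def star_add star_scaleC a b)
  have "star u * u = a * a + b * b + (\<i> *\<^sub>C (a * b) + (- \<i>) *\<^sub>C (a * b))"
    unfolding su unfolding u_def
    by (simp add: distrib_left distrib_right scaleC_mult_left scaleC_mult_right
        scaleC_scaleC scaleC_add_right comm add_ac)
  also have "\<i> *\<^sub>C (a * b) + (- \<i>) *\<^sub>C (a * b) = 0"
    by (simp flip: scaleC_add_left)
  finally have "star u * u = 1"
    by (simp add: assms)
  then have "(norm u)\<^sup>2 = norm (1::'a)"
    by (metis norm_star_mult)
  then have "(norm u)\<^sup>2 \<le> 1\<^sup>2"
    using norm_one_le[where 'a = 'a] by simp
  then have "norm u \<le> 1"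
    by (rule power2_le_imp_le) simp
  moreover have "u + star u = 2 *\<^sub>C a"
    using scaleC_add_left[of 1 1 a]
    unfolding su unfolding u_def by (simp add: add_ac flip: scaleC_add_left)
  then have "2 *\<^sub>R a = u + star u"
    by (simp add: scaleR_scaleC)
  then have "norm (2 *\<^sub>R a) \<le> norm u + norm (star u)"
    by (metis norm_triangle_ineq)
  ultimately show ?thesis
    by simp
qed

text \<open>With \<open>y\<close> the root of \<open>1 - h * h\<close>, the element
  \<open>y + \<i> h\<close> is unitary. Its real part \<open>y\<close> therefore lies in the unit
  ball, and so does \<open>y * y\<close>.\<close>

lemma norm_one_minus_square_le:
  fixes h :: "'a::cstar_algebra"
  assumes sa: "star h = h" and h: "norm h \<le> 1"
  shows "norm (1 - h * h) \<le> 1"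
proof -
  have hh: "norm (h * h) \<le> 1" "star (h * h) = h * h"
    using norm_star_mult[of h] sa h by (simp_all add: power_le_one star_mult)
  define y where "y = sqrt_series (h * h)"
  have y: "star y = y" "y * y = 1 - h * h"
    unfolding y_def by (rule star_sqrt_series[OF hh], rule sqrt_series_square[OF hh(1)])
  have "y * h = h * y"
    unfolding y_def by (rule sqrt_series_commute[OF hh(1), symmetric]) (simp add: mult.assoc)
  then have "norm y \<le> 1"
    by (intro norm_le_one_if_squares_sum_to_one[OF y(1) sa]) (simp_all add: y)
  then have "norm (y * y) \<le> 1"
    using norm_star_mult[of y] y(1) by (simp add: power_le_one)
  then show ?thesis
    by (simp add: y)
qed

text \<open>Here \<open>q * q\<close> is the absolute value of \<open>h\<close>.\<close>

lemma fourth_root_exists: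
  fixes h :: "'a::cstar_algebra"
  assumes sa: "star h = h" and h: "norm h \<le> 1"
  shows "\<exists>q. star q = q \<and> (q * q) * (q * q) = h * h \<and> (\<forall>z. z * h = h * z \<longrightarrow> z * q = q * z)"
proof -
  note n = norm_one_minus_square_le[OF sa h]
  \<comment> \<open>The series gives roots of 1 minus its argument, so the argument
    \<open>1 - h * h\<close> yields a root of \<open>h * h\<close>, and below \<open>1 - p\<close>
    yields a root of \<open>p\<close>.\<close>
  define p where "p = sqrt_series (1 - h * h)"
  have sp: "star (1 - p) = 1 - p"
    using star_sqrt_series[OF n] by (simp add: p_def star_diff star_mult sa)
  have pn: "norm (1 - p) \<le> 1"
    unfolding p_def by (rule norm_one_minus_sqrt_series[OF n])
  define q where "q = sqrt_series (1 - p)"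
  have "star q = q"
    unfolding q_def by (rule star_sqrt_series[OF pn sp])
  moreover have qq: "q * q = p"
    unfolding q_def using sqrt_series_square[OF pn] by simp
  moreover have "p * p = h * h"
    unfolding p_def using sqrt_series_square[OF n] by simp
  moreover have "z * q = q * z" if z: "z * h = h * z" for z
  proof -
    have "z * (h * h) = (h * h) * z"
      by (metis z mult.assoc)
    then have "z * p = p * z"
      unfolding p_def by (intro sqrt_series_commute[OF n]) (simp add: algebra_simps)
    then show ?thesis
      unfolding q_def by (intro sqrt_series_commute[OF pn]) (simp add: algebra_simps)
  qed
  ultimately show ?thesis
    by metis
qed

section \<open>Positive operators and the isometry of injective representations\<close>

lemma bop_apply_diff: "bop_apply (f - g) x = bop_apply f x - bop_apply g x"
  by (metis add_diff_cancel_right' bop_apply_plus diff_add_cancel)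

lemma bop_apply_scaleR: "bop_apply (r *\<^sub>R f) x = r *\<^sub>R bop_apply f x"
  by (simp add: scaleR_scaleC bop_apply_scaleC_left)

lemma cinner_star_mult_self: "cinner \<xi> (bop_apply (star x * x) \<xi>)
    = complex_of_real ((norm (bop_apply x \<xi>))\<^sup>2)"
  by (simp only: bop_apply_times cinner_star cinner_self)

lemma bop_eq_0I: "(\<And>\<xi>. bop_apply f \<xi> = 0) \<Longrightarrow> f = 0"
  by (metis bop_apply_diff bop_eqI diff_self)

text \<open>The difference \<open>D\<close> satisfies \<open>(Q\<^sup>2 + T) D = 0\<close>, so both positive operators \<open>Q\<^sup>2\<close> and \<open>T\<close>
  vanish on its range.\<close>

lemma positive_sqrt_unique:
  fixes T Q :: "'h::chilbert_space bop"
  assumes T: "star T = T" "\<And>\<xi>. 0 \<le> Re (cinner \<xi> (bop_apply T \<xi>))"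
    and Q: "star Q = Q" and comm: "T * Q = Q * T" and eq: "(Q * Q) * (Q * Q) = T * T"
  shows "Q * Q = T"
proof -
  define D where "D = Q * Q - T"
  have sD: "star D = D"
    by (simp add: D_def star_diff star_mult T Q)
  have TQ: "T * (Q * Q) = (Q * Q) * T"
    by (metis comm mult.assoc)
  have zero: "(Q * Q + T) * D = 0"
    using eq TQ by (simp add: D_def algebra_simps)
  have QD: "Q * D = 0"
  proof (rule bop_eq_0I)
    fix \<xi>
    define \<eta> where "\<eta> = bop_apply D \<xi>"
    have "bop_apply (Q * Q + T) \<eta> = 0"
      using zero by (metis \<eta>_def bop_apply_times bop_apply_diff diff_self)
    then have "Re (cinner \<eta> (bop_apply (star Q * Q) \<eta>)) + Re (cinner \<eta> (bop_apply T \<eta>)) = 0"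
      by (metis Q bop_apply_plus cinner_add_right cinner_zero_right plus_complex.sel(1)
          zero_complex.sel(1))
    then have "(norm (bop_apply Q \<eta>))\<^sup>2 = 0"
      using T(2)[of \<eta>] zero_le_power2[of "norm (bop_apply Q \<eta>)"]
      unfolding cinner_star_mult_self Re_complex_of_real by linarith
    then show "bop_apply (Q * D) \<xi> = 0"
      by (simp add: bop_apply_times \<eta>_def)
  qed
  have "T * D = 0"
    using zero QD by (simp add: distrib_right mult.assoc)
  then have "star D * D = 0"
    using QD by (simp add: sD) (simp add: D_def left_diff_distrib mult.assoc)
  then have "D = 0"
    by (metis norm_star_mult norm_zero zero_eq_power2 norm_eq_zero)
  then show ?thesis
    by (simp add: D_def)
qed

text \<open>The bound on \<open>\<pi> a\<close> makes the image of \<open>1 - a * a\<close> a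
  positive operator, hence equal to its own absolute value. Injectivity transports this equality
  back, so \<open>1 - a * a\<close> is the square of a self-adjoint \<open>w\<close> commuting with
  \<open>a\<close>, and \<open>a + \<i> w\<close> is unitary.\<close>

lemma faithful_representation_unit_ball:
  fixes \<pi> :: "'a::cstar_algebra \<Rightarrow> 'h::chilbert_space bop"
  assumes \<pi>: "faithful_representation \<pi>" and sa: "star a = a" and le: "norm (\<pi> a) \<le> 1"
  shows "norm a \<le> 1"
proof -
  have add: "\<pi> (x + y) = \<pi> x + \<pi> y" and sc: "\<pi> (c *\<^sub>C x) = c *\<^sub>C \<pi> x"
    and mul: "\<pi> (x * y) = \<pi> x * \<pi> y" and st: "\<pi> (star x) = star (\<pi> x)" for c x y
    using \<pi> by (auto simp: star_hom_def faithful_representation_def)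
  have one: "\<pi> 1 = 1" and inj: "inj \<pi>"
    using \<pi> by (auto simp: faithful_representation_def)
  have scR: "\<pi> (r *\<^sub>R x) = r *\<^sub>R \<pi> x" for r x
    by (simp add: scaleR_scaleC sc)
  have diff: "\<pi> (x - y) = \<pi> x - \<pi> y" for x y
    by (metis add add_diff_cancel_right' diff_add_cancel)
  \<comment> \<open>Rescaling brings \<open>h\<close> into the unit ball, where roots are available;
    the \<open>+ 1\<close> keeps \<open>k\<close> positive when \<open>a * a = 1\<close>.\<close>
  define k where "k = norm (1 - a * a) + 1"
  have k: "k > 0"
    by (simp add: k_def add_nonneg_pos)
  define h where "h = inverse k *\<^sub>R (1 - a * a)"
  have hs: "star h = h"
    by (simp add: h_def scaleR_scaleC star_scaleC star_diff star_mult sa)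
  have "norm h = norm (1 - a * a) / k"
    using k by (simp add: h_def divide_inverse mult.commute)
  then have hn: "norm h \<le> 1"
    using k by (simp add: k_def divide_le_eq)
  obtain q where q: "star q = q" "(q * q) * (q * q) = h * h"
    and comm: "\<And>z. z * h = h * z \<Longrightarrow> z * q = q * z"
    using fourth_root_exists[OF hs hn] by metis
  have "\<pi> q * \<pi> q = \<pi> h"
  proof (rule positive_sqrt_unique)
    show "star (\<pi> h) = \<pi> h" "star (\<pi> q) = \<pi> q"
      by (simp_all add: hs q flip: st)
    show "\<pi> h * \<pi> q = \<pi> q * \<pi> h"
      using comm[of h] by (simp flip: mul)
    show "\<pi> q * \<pi> q * (\<pi> q * \<pi> q) = \<pi> h * \<pi> h"
      by (simp add: q flip: mul)
    fix \<xi>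
    have "norm (bop_apply (\<pi> a) \<xi>) \<le> norm (\<pi> a) * norm \<xi>"
      by (rule norm_bop_apply)
    also have "\<dots> \<le> 1 * norm \<xi>"
      by (intro mult_right_mono le) simp
    finally have "(norm (bop_apply (\<pi> a) \<xi>))\<^sup>2 \<le> (norm \<xi>)\<^sup>2"
      by (intro power_mono) simp_all
    moreover have "\<pi> h = inverse k *\<^sub>R (1 - star (\<pi> a) * \<pi> a)"
      by (simp add: h_def scR diff mul one sa flip: st)
    then have "cinner \<xi> (bop_apply (\<pi> h) \<xi>) = inverse k * complex_of_real ((norm \<xi>)\<^sup>2 - (norm
        (bop_apply (\<pi> a) \<xi>))\<^sup>2)"
      by (simp only: bop_apply_scaleR bop_apply_diff bop_apply_one cinner_scaleR_right
          cinner_diff_right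
          cinner_star_mult_self cinner_self of_real_diff)
    then have "Re (cinner \<xi> (bop_apply (\<pi> h) \<xi>))
        = inverse k * ((norm \<xi>)\<^sup>2 - (norm (bop_apply (\<pi> a) \<xi>))\<^sup>2)"
      by (metis Re_complex_of_real of_real_mult)
    ultimately show "0 \<le> Re (cinner \<xi> (bop_apply (\<pi> h) \<xi>))"
      using k by (simp add: zero_le_mult_iff)
  qed
  \<comment> \<open>The only use of injectivity: \<open>h\<close> equals its absolute value already
    in the abstract algebra.\<close>
  then have qh: "q * q = h"
    using inj by (simp add: inj_eq flip: mul)
  have "a * h = h * a"
    by (simp add: h_def algebra_simps)
  then have aq: "a * q = q * a"
    by (rule comm)
  define w where "w = sqrt k *\<^sub>R q"
  show ?thesis
  proof (rule norm_le_one_if_squares_sum_to_one[of a w])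
    have "w * w = k *\<^sub>R h"
      using k by (simp add: w_def qh)
    then have "w * w = 1 - a * a"
      using k by (simp add: h_def)
    then show "a * a + w * w = 1"
      by simp
  qed (simp_all add: sa w_def aq q scaleR_scaleC star_scaleC scaleC_mult_left scaleC_mult_right)
qed

lemma faithful_representation_norm:
  fixes \<pi> :: "'a::cstar_algebra \<Rightarrow> 'h::chilbert_space bop"
  assumes \<pi>: "faithful_representation \<pi>"
  shows "norm (\<pi> a) = norm a"
proof (rule antisym)
  have hom: "star_hom \<pi>" "\<pi> 1 = 1"
    using \<pi> by (auto simp: faithful_representation_def)
  show "norm (\<pi> a) \<le> norm a"
    by (rule star_hom_contractive[OF hom])
  have *: "norm k \<le> norm (\<pi> k)" if sa: "star k = k" for k
  proof (rule field_le_epsilon)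
    fix e :: real
    assume "e > 0"
    \<comment> \<open>Adding \<open>e\<close> permits the division even if
      \<open>\<pi> k = 0\<close>.\<close>
    define r where "r = norm (\<pi> k) + e"
    have r: "r > 0"
      using \<open>e > 0\<close> by (auto simp: r_def add_nonneg_pos)
    have sc: "\<pi> (inverse r *\<^sub>R k) = inverse r *\<^sub>R \<pi> k"
      using hom by (simp add: star_hom_def scaleR_scaleC)
    have "norm (\<pi> (inverse r *\<^sub>R k)) = norm (\<pi> k) / r"
      unfolding sc using r by (simp add: divide_inverse mult.commute)
    also have "\<dots> \<le> 1"
      using r \<open>e > 0\<close> by (simp add: r_def)
    finally have "norm (inverse r *\<^sub>R k) \<le> 1"
      by (intro faithful_representation_unit_ball[OF \<pi>]) (simp_all add: scaleR_scaleC star_scaleC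
          sa)
    then have "norm k / r \<le> 1"
      using r by (simp add: divide_inverse mult.commute)
    then show "norm k \<le> norm (\<pi> k) + e"
      using r by (simp add: r_def)
  qed
  have "(norm a)\<^sup>2 = norm (star a * a)"
    by (simp add: norm_star_mult)
  also have "\<dots> \<le> norm (\<pi> (star a * a))"
    by (rule *) (simp add: star_mult)
  also have "\<dots> = (norm (\<pi> a))\<^sup>2"
    using hom by (simp add: star_hom_def norm_star_mult)
  finally show "norm a \<le> norm (\<pi> a)"
    by (rule power2_le_imp_le) simp
qed

subsection \<open>Stationary states\<close>

text \<open>Banach-Alaoglu through Tychonoff: the functions bounded pointwise by the norm form a
  product of closed discs. A finer filter \<open>G\<close> plays the part of a subnet.\<close>

lemma pointwise_cluster_point:
  fixes f :: "'i \<Rightarrow> 'a::real_normed_vector \<Rightarrow> complex"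
  assumes F: "F \<noteq> bot" and le: "\<And>i x. cmod (f i x) \<le> norm x"
  obtains \<phi> G where "G \<noteq> bot" "G \<le> F" "\<And>x. ((\<lambda>i. f i x) \<longlongrightarrow> \<phi> x) G"
proof -
  define K where "K = (PiE UNIV (\<lambda>x. cball 0 (norm x)) :: ('a \<Rightarrow> complex) set)"
  have "compactin (product_topology (\<lambda>_. euclidean) UNIV) K"
    unfolding K_def compactin_PiE by simp
  then have "compact K"
    by (simp add: euclidean_product_topology)
  moreover have "filtermap f F \<noteq> bot"
    using F by (simp add: filtermap_bot_iff)
  moreover have "eventually (\<lambda>g. g \<in> K) (filtermap f F)"
    by (simp add: eventually_filtermap K_def PiE_iff le)
  ultimately obtain \<phi> where \<phi>: "inf (nhds \<phi>) (filtermap f F) \<noteq> bot"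
    unfolding compact_filter by blast
  \<comment> \<open>Pulling back the neighbourhoods of \<open>\<phi>\<close> forces convergence;
    that \<open>\<phi>\<close> is a cluster point keeps the intersection with \<open>F\<close>
    proper.\<close>
  define G where "G = inf (filtercomap f (nhds \<phi>)) F"
  have "G \<noteq> bot"
  proof
    assume "G = bot"
    then have "eventually (\<lambda>_. False) G"
      by simp
    then obtain P Q where PQ: "eventually P (filtercomap f (nhds \<phi>))" "eventually Q F" "\<And>i. P i
        \<Longrightarrow> Q i \<Longrightarrow> False"
      unfolding G_def eventually_inf by blast
    then obtain P' where P': "eventually P' (nhds \<phi>)" "\<And>i. P' (f i) \<Longrightarrow> P i"
      unfolding eventually_filtercomap by blast
    have "eventually (\<lambda>g. \<not> P' g) (filtermap f F)"
      unfolding eventually_filtermap by (rule eventually_mono[OF PQ(2)]) (use PQ(3) P'(2) in blast)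
    with P'(1) have "eventually (\<lambda>_. False) (inf (nhds \<phi>) (filtermap f F))"
      unfolding eventually_inf by blast
    then show False
      using \<phi> by (simp add: trivial_limit_def)
  qed
  moreover have "G \<le> F"
    by (simp add: G_def)
  moreover have "((\<lambda>i. f i x) \<longlongrightarrow> \<phi> x) G" for x
  proof (rule continuous_on_tendsto_compose[OF continuous_on_product_coordinates[of x]])
    show "(f \<longlongrightarrow> \<phi>) G"
      unfolding G_def by (rule filterlim_mono[OF filterlim_filtercomap order_refl]) simp
  qed simp_all
  ultimately show ?thesis
    by (rule that)
qed

lemma cstar_subalgebra_UNIV: "cstar_subalgebra UNIV"
  by (simp add: cstar_subalgebra_def)

lemma
  assumes "state_on UNIV \<phi>"
  shows state_add: "\<phi> (x + y) = \<phi> x + \<phi> y"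
    and state_scaleC: "\<phi> (c *\<^sub>C x) = c * \<phi> x"
    and state_nonneg: "\<phi> (star x * x) \<in> \<real>\<^sub>\<ge>\<^sub>0"
    and state_one: "\<phi> 1 = 1"
  using assms by (simp_all add: state_on_def)

lemma state_norm_le: "state_on UNIV \<phi> \<Longrightarrow> cmod (\<phi> x) \<le> norm x"
  by (rule state_contractive[OF cstar_subalgebra_UNIV]) simp_all

lemma state_bounded_linear: "state_on UNIV \<phi> \<Longrightarrow> bounded_linear \<phi>"
  by (rule bounded_linear_intro[of _ 1])
    (simp_all add: state_add state_scaleC state_norm_le scaleR_scaleC scaleC_complex_def)

lemma state_limit:
  assumes G: "G \<noteq> bot" and \<psi>: "\<And>i. state_on UNIV (\<psi> i)" and lim: "\<And>x. ((\<lambda>i. \<psi> i x) \<longlongrightarrow> \<phi> x) G"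
  shows "state_on UNIV \<phi>"
  unfolding state_on_def
proof (intro conjI ballI allI)
  fix x y c
  show "\<phi> (x + y) = \<phi> x + \<phi> y"
    using lim[of "x + y"] tendsto_add[OF lim[of x] lim[of y]]
    by (intro tendsto_unique[OF G]) (simp_all add: state_add[OF \<psi>])
  show "\<phi> (c *\<^sub>C x) = c * \<phi> x"
    using lim[of "c *\<^sub>C x"] tendsto_mult[OF tendsto_const lim[of x]]
    by (intro tendsto_unique[OF G]) (simp_all add: state_scaleC[OF \<psi>])
  show "\<phi> (star x * x) \<in> \<real>\<^sub>\<ge>\<^sub>0"
    by (rule Lim_in_closed_set[OF closed_nonneg_Reals_complex _ G lim]) (simp add: state_nonneg[OF
        \<psi>])
  show "\<phi> 1 = 1"
    by (rule tendsto_unique[OF G lim[of 1]]) (simp add: state_one[OF \<psi>])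
qed

lemma vector_state:
  assumes "norm \<xi> = 1"
  shows "state_on UNIV (\<lambda>x. cinner \<xi> (bop_apply x \<xi>))"
  unfolding state_on_def
proof (intro conjI ballI allI)
  show "cinner \<xi> (bop_apply (star x * x) \<xi>) \<in> \<real>\<^sub>\<ge>\<^sub>0" for x
    unfolding cinner_star_mult_self by (simp add: nonneg_Reals_of_real_iff)
qed (simp_all add: bop_apply_plus cinner_add_right bop_apply_scaleC_left cinner_scaleC_right
    bop_apply_one cinner_self assms)

section \<open>Translations and averages along \<mu>\<close>

lemma left_translation_mult: "left_translation s * left_translation t = left_translation (s + t)"
  by (rule bop_eqI, rule ell2_eqI)
    (simp add: bop_apply_times left_translation_apply minus_add add.assoc del: add_uminus_conv_diff)

lemma left_translation_0: "left_translation 0 = 1"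
  by (rule bop_eqI, rule ell2_eqI) (simp add: left_translation_apply bop_apply_one)

lemma left_translation_inverse [simp]:
  "left_translation (- s) * left_translation s = 1" "left_translation s * left_translation (- s)
      = 1"
  by (simp_all add: left_translation_mult left_translation_0)

lemma star_left_translation: "star (left_translation s) = left_translation (- s)"
proof (rule star_bop_eqI)
  fix \<xi> \<eta> :: "('a, 'b) ell2"
  have "cinner \<xi> (bop_apply (left_translation (- s)) \<eta>)
      = (\<Sum>\<^sub>\<infinity>t\<in>UNIV. cinner (ell2_apply \<xi> (- s + (s + t))) (ell2_apply \<eta> (s + t)))"
    by (simp add: cinner_ell2.rep_eq left_translation_apply flip: add.assoc)
  also have "\<dots> = (\<Sum>\<^sub>\<infinity>t\<in>range ((+) s). cinner (ell2_apply \<xi> (- s + t)) (ell2_apply \<eta> t))"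
    by (subst infsum_reindex) (simp_all add: o_def)
  also have "range ((+) s) = UNIV"
    by simp
  finally show "cinner \<xi> (bop_apply (left_translation (- s)) \<eta>)
      = cinner (bop_apply (left_translation s) \<xi>) \<eta>"
    by (simp add: cinner_ell2.rep_eq left_translation_apply)
qed

lemma norm_left_translation_le: "norm (left_translation s) \<le> 1"
proof -
  have "(norm (left_translation s :: ('a, 'b) ell2 bop))\<^sup>2 = norm (1 :: ('a, 'b) ell2 bop)"
    by (simp add: star_left_translation flip: norm_star_mult)
  also have "\<dots> \<le> 1\<^sup>2"
    using norm_one_le by simp
  finally show ?thesis
    by (rule power2_le_imp_le) simp
qed

lemma norm_translation_conj_le:
  fixes x :: "('g::group_add, 'h::chilbert_space) ell2 bop"
  shows "norm (left_translation s * x * left_translation t) \<le> norm x"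
proof -
  have "norm (left_translation s * x * left_translation t)
      \<le> norm (left_translation s * x) * norm (left_translation t :: ('g, 'h) ell2 bop)"
    by (rule norm_mult_ineq)
  also have "\<dots> \<le> norm (left_translation s * x) * 1"
    by (intro mult_left_mono norm_left_translation_le) simp
  also have "\<dots> \<le> norm (left_translation s :: ('g, 'h) ell2 bop) * norm x"
    using norm_mult_ineq[of "left_translation s" x] by simp
  also have "\<dots> \<le> 1 * norm x"
    by (intro mult_right_mono norm_left_translation_le) simp
  finally show ?thesis
    by simp
qed

text \<open>The dual side of convolution: a state applied to this average is \<mu> convolved with
  the state for conjugation by translations. The inverse \<open>- s\<close> stands on the left for
  that reason, and stationary means invariant under the average.\<close>

definition translation_average ::
    "'g::group_add pmf \<Rightarrow> ('g, 'h::chilbert_space) ell2 bop \<Rightarrow> ('g, 'h) ell2 bop" where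
  "translation_average \<mu> x =
    (\<Sum>\<^sub>\<infinity>s. pmf \<mu> s *\<^sub>R (left_translation (- s) * x * left_translation s))"

lemma pmf_has_sum: "(pmf \<mu> has_sum 1) UNIV"
proof -
  have "pmf \<mu> summable_on UNIV"
    by (rule abs_summable_summable) (rule iffD2[OF abs_summable_equivalent pmf_abs_summable])
  moreover have "infsum (pmf \<mu>) UNIV = 1"
    using infsetsum_infsum[OF pmf_abs_summable[of \<mu> UNIV]] infsetsum_pmf_eq_1[of \<mu> UNIV] by simp
  ultimately show ?thesis
    by (metis has_sum_infsum)
qed

lemma translation_average_has_sum:
  "((\<lambda>s. pmf \<mu> s *\<^sub>R (left_translation (- s) * x * left_translation s))
      has_sum translation_average \<mu> x) UNIV"
  unfolding translation_average_def
proof (rule has_sum_infsum, rule abs_summable_summable,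
    rule Infinite_Sum.abs_summable_on_comparison_test)
  show "(\<lambda>s. norm (pmf \<mu> s * norm x)) summable_on UNIV"
    using has_sum_cmult_left[OF pmf_has_sum[of \<mu>], of "norm x"]
    by (auto simp: summable_on_def abs_mult)
  show "norm (pmf \<mu> s *\<^sub>R (left_translation (- s) * x * left_translation s))
      \<le> norm (pmf \<mu> s * norm x)" for s
    using norm_translation_conj_le[of "- s" x s] by (simp add: abs_mult mult_left_mono)
qed

lemma translation_average_add:
  "translation_average \<mu> (x + y) = translation_average \<mu> x + translation_average \<mu> y"
proof (rule infsumI[OF translation_average_has_sum, symmetric, THEN trans])
  show "(\<Sum>\<^sub>\<infinity>s. pmf \<mu> s *\<^sub>R (left_translation (- s) * (x + y) * left_translation s))
      = translation_average \<mu> x + translation_average \<mu> y"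
    using has_sum_add[OF translation_average_has_sum[of \<mu> x] translation_average_has_sum[of \<mu> y]]
    by (intro infsumI) (simp add: algebra_simps)
qed

lemma translation_average_scaleC: "translation_average \<mu> (c *\<^sub>C x) = c *\<^sub>C translation_average \<mu> x"
proof (rule infsumI[OF translation_average_has_sum, symmetric, THEN trans])
  have "pmf \<mu> s *\<^sub>R (left_translation (- s) * (c *\<^sub>C x) * left_translation s)
      = c *\<^sub>C (pmf \<mu> s *\<^sub>R (left_translation (- s) * x * left_translation s))" for s
    by (simp add: scaleC_mult_left scaleC_mult_right scaleR_scaleC scaleC_scaleC mult.commute)
  moreover have "bounded_linear (\<lambda>x. c *\<^sub>C (x :: ('a, 'b) ell2 bop))"
  proof (rule bounded_linear_intro[of _ "cmod c"])
    show "norm (c *\<^sub>C x) \<le> norm x * cmod c" for x :: "('a, 'b) ell2 bop"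
    proof (rule norm_bop_bound)
      fix \<xi>
      have "cmod c * norm (bop_apply x \<xi>) \<le> cmod c * (norm x * norm \<xi>)"
        by (intro mult_left_mono norm_bop_apply) simp
      then show "norm (bop_apply (c *\<^sub>C x) \<xi>) \<le> norm x * cmod c * norm \<xi>"
        by (simp add: bop_apply_scaleC_left norm_scaleC mult_ac)
    qed simp
  qed (simp_all add: scaleC_add_right scaleR_scaleC scaleC_scaleC mult.commute)
  ultimately show "(\<Sum>\<^sub>\<infinity>s. pmf \<mu> s *\<^sub>R (left_translation (- s) * (c *\<^sub>C x) * left_translation s))
      = c *\<^sub>C translation_average \<mu> x"
    using has_sum_bounded_linear[OF _ translation_average_has_sum[of \<mu> x], of "\<lambda>x. c *\<^sub>C x"]
    by (intro infsumI) simp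
qed

lemma norm_translation_average_le: "norm (translation_average \<mu> x) \<le> norm x"
proof -
  have "norm (translation_average \<mu> x) \<le> 1 * norm x"
  proof (rule norm_infsum_le)
    show "((\<lambda>s. pmf \<mu> s *\<^sub>R (left_translation (- s) * x * left_translation s))
        has_sum translation_average \<mu> x) UNIV"
      by (rule translation_average_has_sum)
    show "((\<lambda>s. pmf \<mu> s * norm x) has_sum 1 * norm x) UNIV"
      by (rule has_sum_cmult_left[OF pmf_has_sum])
    show "norm (pmf \<mu> s *\<^sub>R (left_translation (- s) * x * left_translation s)) \<le> pmf \<mu> s * norm x"
        for s
      using norm_translation_conj_le[of "- s" x s] by (simp add: abs_mult mult_left_mono)
  qed
  then show ?thesis
    by simp
qed

lemma state_translation_average_has_sum:
  assumes "state_on UNIV \<phi>"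
  shows "((\<lambda>s. complex_of_real (pmf \<mu> s) * \<phi> (left_translation (- s) * x * left_translation s))
    has_sum \<phi> (translation_average \<mu> x)) UNIV"
  using has_sum_bounded_linear[OF state_bounded_linear[OF assms] translation_average_has_sum[of \<mu>
      x]]
  by (simp add: scaleR_scaleC state_scaleC[OF assms])

lemma state_translation_average:
  assumes \<phi>: "state_on UNIV \<phi>"
  shows "state_on UNIV (\<lambda>x. \<phi> (translation_average \<mu> x))"
  unfolding state_on_def
proof (intro conjI ballI allI)
  fix x
  note s = state_translation_average_has_sum[OF \<phi>, of \<mu> "star x * x"]
  have "0 \<le> \<phi> (translation_average \<mu> (star x * x))"
    unfolding infsumI[OF s, symmetric]
  proof (rule infsum_nonneg_complex[OF has_sum_imp_summable[OF s]])
    fix s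
    define y where "y = x * left_translation s"
    have "left_translation (- s) * (star x * x) * left_translation s = star y * y"
      by (simp add: y_def star_mult star_left_translation mult.assoc)
    then have "0 \<le> \<phi> (left_translation (- s) * (star x * x) * left_translation s)"
      using state_nonneg[OF \<phi>, of y] by (simp add: complex_nonneg_Reals_iff less_eq_complex_def)
    then show "0 \<le> complex_of_real (pmf \<mu> s) * \<phi> (left_translation (- s) * (star x * x) *
        left_translation s)"
      by (simp add: less_eq_complex_def)
  qed
  then show "\<phi> (translation_average \<mu> (star x * x)) \<in> \<real>\<^sub>\<ge>\<^sub>0"
    by (simp add: complex_nonneg_Reals_iff less_eq_complex_def)
next
  have "((\<lambda>s. complex_of_real (pmf \<mu> s)) has_sum \<phi> (translation_average \<mu> 1)) UNIV"
    using state_translation_average_has_sum[OF \<phi>, of \<mu> 1] by (simp add: state_one[OF \<phi>])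
  moreover have "((\<lambda>s. complex_of_real (pmf \<mu> s)) has_sum complex_of_real 1) UNIV"
    using pmf_has_sum[of \<mu>] by (simp only: has_sum_of_real_iff)
  ultimately show "\<phi> (translation_average \<mu> 1) = 1"
    by (metis has_sum_unique of_real_1)
qed (simp_all add: translation_average_add translation_average_scaleC state_add[OF \<phi>]
    state_scaleC[OF \<phi>])

text \<open>Cesaro means over \<open>n + 1\<close> powers, starting with the identity. They become
  asymptotically invariant even when the powers of the average do not converge.\<close>

definition translation_mean ::
    "'g::group_add pmf \<Rightarrow> nat \<Rightarrow> ('g, 'h::chilbert_space) ell2 bop \<Rightarrow> ('g, 'h) ell2 bop" where
  "translation_mean \<mu> n x = (1 / real (Suc n)) *\<^sub>R (\<Sum>k\<le>n. (translation_average \<mu> ^^ k) x)"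

lemma state_translation_average_power:
  assumes \<phi>: "state_on UNIV \<phi>"
  shows "state_on UNIV (\<lambda>x. \<phi> ((translation_average \<mu> ^^ k) x))"
proof (induction k)
  case (Suc k)
  show ?case
    using state_translation_average[OF Suc] by (simp only: funpow_Suc_right o_def)
qed (use \<phi> in simp)

lemma state_translation_mean_eq:
  assumes \<phi>: "state_on UNIV \<phi>"
  shows "\<phi> (translation_mean \<mu> n x) = (\<Sum>k\<le>n. \<phi> ((translation_average \<mu> ^^ k) x)) / complex_of_real
      (real (Suc n))"
proof -
  interpret bounded_linear \<phi>
    by (rule state_bounded_linear[OF \<phi>])
  show ?thesis
    unfolding translation_mean_def by (simp add: scaleR sum scaleR_conv_of_real del: of_nat_Suc)
qed

lemma state_translation_mean:
  assumes \<phi>: "state_on UNIV \<phi>"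
  shows "state_on UNIV (\<lambda>x. \<phi> (translation_mean \<mu> n x))"
  unfolding state_on_def state_translation_mean_eq[OF \<phi>]
proof (intro conjI ballI allI)
  note p = state_translation_average_power[OF \<phi>]
  fix x y c
  show "(\<Sum>k\<le>n. \<phi> ((translation_average \<mu> ^^ k) (x + y))) / complex_of_real (real (Suc n))
     = (\<Sum>k\<le>n. \<phi> ((translation_average \<mu> ^^ k) x)) / complex_of_real (real (Suc n))
      + (\<Sum>k\<le>n. \<phi> ((translation_average \<mu> ^^ k) y)) / complex_of_real (real (Suc n))"
    by (simp add: state_add[OF p] sum.distrib add_divide_distrib del: of_nat_Suc)
  show "(\<Sum>k\<le>n. \<phi> ((translation_average \<mu> ^^ k) (c *\<^sub>C x))) / complex_of_real (real (Suc n))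
     = c * ((\<Sum>k\<le>n. \<phi> ((translation_average \<mu> ^^ k) x)) / complex_of_real (real (Suc n)))"
    by (simp add: state_scaleC[OF p] sum_distrib_left del: of_nat_Suc)
  have "(\<Sum>k\<le>n. \<phi> ((translation_average \<mu> ^^ k) (star x * x))) \<in> \<real>\<^sub>\<ge>\<^sub>0" for n
    by (induction n) (auto intro!: nonneg_Reals_add_I state_nonneg[OF p] state_nonneg[OF \<phi>] simp
        del: funpow.simps)
  then show "(\<Sum>k\<le>n. \<phi> ((translation_average \<mu> ^^ k) (star x * x))) / complex_of_real (real (Suc
      n)) \<in> \<real>\<^sub>\<ge>\<^sub>0"
    by (intro nonneg_Reals_divide_I) (simp_all add: nonneg_Reals_of_real_iff del: of_nat_Suc)
  show "(\<Sum>k\<le>n. \<phi> ((translation_average \<mu> ^^ k) 1)) / complex_of_real (real (Suc n)) = 1"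
    by (simp add: state_one[OF p] del: of_nat_Suc)
qed

lemma norm_translation_average_power_le: "norm ((translation_average \<mu> ^^ k) x) \<le> norm x"
proof (induction k)
  case (Suc k)
  then show ?case
    using norm_translation_average_le[of \<mu> "(translation_average \<mu> ^^ k) x"] by simp
qed simp

text \<open>Shifting the powers by one telescopes: only the first and the last remain, and both are
  bounded by \<open>norm x\<close>.\<close>

lemma translation_mean_asymp_invariant:
  "norm (translation_mean \<mu> n (translation_average \<mu> x) - translation_mean \<mu> n x)
      \<le> 2 * norm x / real (Suc n)"
proof -
  define T where "T k = (translation_average \<mu> ^^ k) x" for k
  have "(\<Sum>k\<le>n. T (Suc k)) - (\<Sum>k\<le>n. T k) = T (Suc n) - T 0"
    using sum_telescope[of T n] unfolding sum_subtractf by (simp add: algebra_simps)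
  then have "translation_mean \<mu> n (translation_average \<mu> x) - translation_mean \<mu> n x
      = (1 / real (Suc n)) *\<^sub>R (T (Suc n) - T 0)"
    by (simp add: translation_mean_def T_def funpow_swap1 flip: scaleR_diff_right del: of_nat_Suc)
  moreover have "norm (T (Suc n) - T 0) \<le> 2 * norm x"
    using norm_triangle_ineq4[of "T (Suc n)" "T 0"] norm_translation_average_power_le[of "Suc n" \<mu>
        x]
    by (simp add: T_def)
  ultimately show ?thesis
    by (simp add: divide_right_mono del: of_nat_Suc)
qed

text \<open>A Markov-Kakutani argument in which the state may change with \<open>n\<close>. The
  moving version takes vector states that witness large means; a constant sequence serves for states
  vanishing on an ideal. The filter is part of the result so that estimates along the sequence pass
  to the limit.\<close>

lemma stationary_cluster_point:
  fixes \<psi> :: "nat \<Rightarrow> ('g::group_add, 'h::chilbert_space) ell2 bop \<Rightarrow> complex"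
  assumes \<psi>: "\<And>n. state_on UNIV (\<psi> n)"
  obtains \<phi> G where "G \<noteq> bot" "state_on UNIV \<phi>" "\<And>x. \<phi> (translation_average \<mu> x) = \<phi> x"
    "\<And>x. ((\<lambda>n. \<psi> n (translation_mean \<mu> n x)) \<longlongrightarrow> \<phi> x) G"
proof -
  note st = state_translation_mean[OF \<psi>]
  obtain \<phi> G where G: "G \<noteq> bot" "G \<le> sequentially"
    and lim: "\<And>x. ((\<lambda>n. \<psi> n (translation_mean \<mu> n x)) \<longlongrightarrow> \<phi> x) G"
    using pointwise_cluster_point[where f = "\<lambda>n x. \<psi> n (translation_mean \<mu> n x)",
        OF trivial_limit_sequentially state_norm_le[OF st]] by blast
  have "\<phi> (translation_average \<mu> x) = \<phi> x" for x
  proof -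
    have "(\<lambda>n. 2 * norm x / real (Suc n)) \<longlonglongrightarrow> 0"
      by (intro LIMSEQ_Suc[of "\<lambda>n. 2 * norm x / real n"] lim_const_over_n)
    then have "((\<lambda>n. 2 * norm x / real (Suc n)) \<longlongrightarrow> 0) G"
      by (rule tendsto_mono[OF G(2)])
    then have "((\<lambda>n. \<psi> n (translation_mean \<mu> n (translation_average \<mu> x)) - \<psi> n (translation_mean
        \<mu> n x)) \<longlongrightarrow> 0) G"
    proof (rule Lim_null_comparison[rotated], intro always_eventually allI)
      fix n
      interpret bounded_linear "\<psi> n"
        by (rule state_bounded_linear[OF \<psi>])
      show "norm (\<psi> n (translation_mean \<mu> n (translation_average \<mu> x)) - \<psi> n (translation_mean \<mu> n
          x)) \<le> 2 * norm x / real (Suc n)"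
        unfolding diff[symmetric]
        by (rule order_trans[OF state_norm_le[OF \<psi>] translation_mean_asymp_invariant])
    qed
    moreover have "((\<lambda>n. \<psi> n (translation_mean \<mu> n (translation_average \<mu> x)) - \<psi> n
        (translation_mean \<mu> n x))
        \<longlongrightarrow> \<phi> (translation_average \<mu> x) - \<phi> x) G"
      by (intro tendsto_diff lim)
    ultimately show ?thesis
      using tendsto_unique[OF G(1)] by fastforce
  qed
  then show ?thesis
    using that[OF G(1) state_limit[OF G(1) st lim] _ lim] by blast
qed

subsection \<open>Averages in the crossed product\<close>

lemma norm_ell2_mono:
  assumes "\<And>t. norm (ell2_apply \<xi> t) \<le> norm (ell2_apply \<eta> t)"
  shows "norm \<xi> \<le> norm \<eta>"
  unfolding norm_ell2.rep_eq[of \<xi>]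
proof (rule ell2_le_L2_set[OF ell2_apply_summable])
  fix F :: "'a set"
  assume "finite F"
  have "L2_set (\<lambda>t. norm (ell2_apply \<xi> t)) F \<le> L2_set (\<lambda>t. norm (ell2_apply \<eta> t)) F"
    by (intro L2_set_mono assms) simp
  also have "\<dots> \<le> norm \<eta>"
    unfolding norm_ell2.rep_eq by (rule L2_set_le_ell2[OF ell2_apply_summable \<open>finite F\<close>])
  finally show "L2_set (\<lambda>t. norm (ell2_apply \<xi> t)) F \<le> norm \<eta>" .
qed

text \<open>Compares an operator on vector-valued functions with one on scalar functions. Unlike an
  inequality of norms, it survives sums and nonnegative weights term by term. Only the real part of
  \<open>f\<close> is constrained, since scalars are complex.\<close>

definition dominated_bop ::
    "('g, 'h::chilbert_space) ell2 bop \<Rightarrow> ('g, complex) ell2 bop \<Rightarrow> bool" where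
  "dominated_bop x y \<longleftrightarrow> (\<forall>\<xi> f. (\<forall>t. norm (ell2_apply \<xi> t) \<le> Re (ell2_apply f t)) \<longrightarrow>
    (\<forall>t. norm (ell2_apply (bop_apply x \<xi>) t) \<le> Re (ell2_apply (bop_apply y f) t)))"

text \<open>Take for \<open>f\<close> the pointwise norm of the vector, which has the same norm in
  the scalar space.\<close>

lemma dominated_bop_norm:
  fixes x :: "('g, 'h::chilbert_space) ell2 bop"
  assumes "dominated_bop x y"
  shows "norm x \<le> norm y"
proof (rule norm_bop_bound)
  fix \<xi> :: "('g, 'h) ell2"
  define f where "f = Abs_ell2 (\<lambda>t. complex_of_real (norm (ell2_apply \<xi> t)))"
  have f: "ell2_apply f t = complex_of_real (norm (ell2_apply \<xi> t))" for t
    using ell2_apply_summable[of \<xi>] by (simp add: f_def Abs_ell2_inverse)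
  have "norm (ell2_apply (bop_apply x \<xi>) t) \<le> norm (ell2_apply (bop_apply y f) t)" for t
  proof -
    have "norm (ell2_apply (bop_apply x \<xi>) t) \<le> Re (ell2_apply (bop_apply y f) t)"
      using assms f by (simp add: dominated_bop_def)
    then show ?thesis
      using complex_Re_le_cmod order_trans by blast
  qed
  then have "norm (bop_apply x \<xi>) \<le> norm (bop_apply y f)"
    by (rule norm_ell2_mono)
  also have "\<dots> \<le> norm y * norm f"
    by (rule norm_bop_apply)
  also have "norm f = norm \<xi>"
    by (simp add: norm_ell2.rep_eq f)
  finally show "norm (bop_apply x \<xi>) \<le> norm y * norm \<xi>" .
qed simp

lemma dominated_bop_0: "dominated_bop 0 0"
  by (simp add: dominated_bop_def zero_bop.rep_eq bop_apply.rep_eq zero_ell2.rep_eq)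

lemma dominated_bop_add:
  assumes "dominated_bop x y" "dominated_bop x' y'"
  shows "dominated_bop (x + x') (y + y')"
  unfolding dominated_bop_def
proof (intro allI impI)
  fix \<xi> :: "('a, 'b) ell2" and f t
  assume *: "\<forall>t. norm (ell2_apply \<xi> t) \<le> Re (ell2_apply f t)"
  have "norm (ell2_apply (bop_apply x \<xi>) t) \<le> Re (ell2_apply (bop_apply y f) t)"
    "norm (ell2_apply (bop_apply x' \<xi>) t) \<le> Re (ell2_apply (bop_apply y' f) t)"
    using assms * by (auto simp: dominated_bop_def)
  then show "norm (ell2_apply (bop_apply (x + x') \<xi>) t) \<le> Re (ell2_apply (bop_apply (y + y') f) t)"
    using norm_triangle_ineq[of "ell2_apply (bop_apply x \<xi>) t" "ell2_apply (bop_apply x' \<xi>) t"]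
    by (simp add: bop_apply_plus plus_ell2.rep_eq)
qed

lemma dominated_bop_scaleR:
  assumes "dominated_bop x y" "0 \<le> r"
  shows "dominated_bop (r *\<^sub>R x) (r *\<^sub>R y)"
  using assms by (simp add: dominated_bop_def bop_apply_scaleR scaleR_ell2.rep_eq mult_left_mono)

lemma dominated_bop_sum:
  "(\<And>i. i \<in> A \<Longrightarrow> dominated_bop (x i) (y i)) \<Longrightarrow> dominated_bop (sum x A) (sum y A)"
  by (induction A rule: infinite_finite_induct) (simp_all add: dominated_bop_0 dominated_bop_add)

lemma dominated_bop_translation_conj:
  assumes "dominated_bop x y"
  shows "dominated_bop (left_translation s * x * left_translation t) (left_translation s * y *
      left_translation t)"
  using assms by (simp add: dominated_bop_def bop_apply_times left_translation_apply)

lemma bounded_linear_ell2_coordinate: "bounded_linear (\<lambda>x. ell2_apply (bop_apply x \<xi>) t)"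
proof (rule bounded_linear_intro[of _ "norm \<xi>"])
  show "norm (ell2_apply (bop_apply x \<xi>) t) \<le> norm x * norm \<xi>" for x
    using norm_ell2_apply_le norm_bop_apply by (rule order_trans)
qed (simp_all add: bop_apply_plus plus_ell2.rep_eq bop_apply_scaleR scaleR_ell2.rep_eq)

text \<open>Evaluating at a vector and a point of the group is bounded and linear, so it passes
  through the norm-convergent sum. The comparison is then termwise, the weights being
  nonnegative.\<close>

lemma dominated_bop_translation_average:
  fixes x :: "('g::group_add, 'h::chilbert_space) ell2 bop"
  assumes xy: "dominated_bop x y"
  shows "dominated_bop (translation_average \<mu> x) (translation_average \<mu> y)"
  unfolding dominated_bop_def
proof (intro allI impI)
  fix \<xi> :: "('g, 'h) ell2" and f t
  assume *: "\<forall>t. norm (ell2_apply \<xi> t) \<le> Re (ell2_apply f t)"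
  show "norm (ell2_apply (bop_apply (translation_average \<mu> x) \<xi>) t)
      \<le> Re (ell2_apply (bop_apply (translation_average \<mu> y) f) t)"
  proof (rule norm_infsum_le)
    show "((\<lambda>s. ell2_apply (bop_apply (pmf \<mu> s *\<^sub>R (left_translation (- s) * x * left_translation
        s)) \<xi>) t)
        has_sum ell2_apply (bop_apply (translation_average \<mu> x) \<xi>) t) UNIV"
      by (rule has_sum_bounded_linear[OF bounded_linear_ell2_coordinate
          translation_average_has_sum])
    show "((\<lambda>s. Re (ell2_apply (bop_apply (pmf \<mu> s *\<^sub>R (left_translation (- s) * y *
        left_translation s)) f) t))
        has_sum Re (ell2_apply (bop_apply (translation_average \<mu> y) f) t)) UNIV"
      by (rule has_sum_bounded_linear[OF bounded_linear_compose[OF bounded_linear_Re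
            bounded_linear_ell2_coordinate] translation_average_has_sum])
    fix s
    have "dominated_bop (pmf \<mu> s *\<^sub>R (left_translation (- s) * x * left_translation s))
        (pmf \<mu> s *\<^sub>R (left_translation (- s) * y * left_translation s))"
      by (intro dominated_bop_scaleR dominated_bop_translation_conj xy pmf_nonneg)
    then show "norm (ell2_apply (bop_apply (pmf \<mu> s *\<^sub>R (left_translation (- s) * x *
        left_translation s)) \<xi>) t)
        \<le> Re (ell2_apply (bop_apply (pmf \<mu> s *\<^sub>R (left_translation (- s) * y * left_translation
            s)) f) t)"
      using * unfolding dominated_bop_def by blast
  qed
qed

lemma dominated_bop_translation_mean:
  assumes xy: "dominated_bop x y"
  shows "dominated_bop (translation_mean \<mu> n x) (translation_mean \<mu> n y)"
proof -
  have "dominated_bop ((translation_average \<mu> ^^ k) x) ((translation_average \<mu> ^^ k) y)" for k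
    by (induction k) (simp_all add: xy dominated_bop_translation_average)
  then show ?thesis
    unfolding translation_mean_def by (intro dominated_bop_scaleR dominated_bop_sum) simp_all
qed

lemma translation_mean_scaleR: "translation_mean \<mu> n (r *\<^sub>R x) = r *\<^sub>R translation_mean \<mu> n x"
proof -
  have "(translation_average \<mu> ^^ k) (r *\<^sub>R x) = r *\<^sub>R (translation_average \<mu> ^^ k) x" for k
    by (induction k) (simp_all add: scaleR_scaleC translation_average_scaleC)
  then show ?thesis
    by (simp add: translation_mean_def scaleR_sum_right mult.commute)
qed

text \<open>At the point \<open>t\<close> the product shifts the function and then applies an
  operator of norm at most \<open>norm a\<close>. However the coefficients are moved by the action,
  the cost is this one factor.\<close>

lemma norm_translation_mean_crossed_le:
  fixes \<pi> :: "'a::cstar_algebra \<Rightarrow> 'h::chilbert_space bop"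
  assumes \<alpha>: "gamma_cstar_algebra \<alpha>" and \<pi>: "star_hom \<pi>" "\<pi> 1 = 1"
  shows "norm (translation_mean \<mu> n (crossed_representation \<alpha> \<pi> a * left_translation s))
    \<le> norm a * norm (translation_mean \<mu> n (left_translation s :: ('g::group_add, complex) ell2
        bop))"
proof -
  have "dominated_bop (crossed_representation \<alpha> \<pi> a * left_translation s) (norm a *\<^sub>R
      left_translation s)"
    unfolding dominated_bop_def
  proof (intro allI impI)
    fix \<xi> :: "('g, 'h) ell2" and f t
    assume *: "\<forall>t. norm (ell2_apply \<xi> t) \<le> Re (ell2_apply f t)"
    have "norm (bop_apply (\<pi> (\<alpha> (- t) a)) (ell2_apply \<xi> (- s + t)))
        \<le> norm (\<pi> (\<alpha> (- t) a)) * norm (ell2_apply \<xi> (- s + t))"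
      by (rule norm_bop_apply)
    also have "\<dots> \<le> norm a * Re (ell2_apply f (- s + t))"
      using order_trans[OF star_hom_contractive[OF \<pi>] gamma_action_contractive[OF \<alpha>]] *
      by (intro mult_mono) simp_all
    finally show "norm (ell2_apply (bop_apply (crossed_representation \<alpha> \<pi> a * left_translation s)
        \<xi>) t)
        \<le> Re (ell2_apply (bop_apply (norm a *\<^sub>R left_translation s) f) t)"
      by (simp add: bop_apply_times crossed_representation_apply[OF \<alpha> \<pi>] left_translation_apply
          bop_apply_scaleR scaleR_ell2.rep_eq)
  qed
  from dominated_bop_norm[OF dominated_bop_translation_mean[OF this, of \<mu> n]] show ?thesis
    by (simp add: translation_mean_scaleR)
qed

section \<open>Smallness of the averages and vanishing of off-diagonal values\<close>

lemma polarization: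
  "4 * cinner \<eta> (bop_apply y \<xi>) = (\<Sum>c\<in>{1, -1, \<i>, -\<i>}. cnj c * cinner (\<eta> + c *\<^sub>C \<xi>) (bop_apply y (\<eta>
      + c *\<^sub>C \<xi>)))"
proof -
  have expand: "cinner (\<eta> + c *\<^sub>C \<xi>) (bop_apply y (\<eta> + c *\<^sub>C \<xi>))
      = cinner \<eta> (bop_apply y \<eta>) + c * cinner \<eta> (bop_apply y \<xi>)
      + cnj c * cinner \<xi> (bop_apply y \<eta>) + cnj c * c * cinner \<xi> (bop_apply y \<xi>)" for c
    by (simp add: linear_add[OF bounded_linear.linear[OF bounded_linear_bop_apply]] bop_apply_scaleC
        cinner_add_left cinner_add_right cinner_scaleC_left cinner_scaleC_right algebra_simps)
  have "4 * p = (\<Sum>c\<in>{1, -1, \<i>, -\<i>}. cnj c * (a + c * p + cnj c * q + cnj c * c * r))" for a p q r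
    by (simp add: complex_eq_iff)
  then show ?thesis
    unfolding expand .
qed

text \<open>The operator need not be self-adjoint, which costs the factor 2. The lemma turns a lower
  bound on a norm into a vector state with a large value.\<close>

lemma norm_le_numerical_radius:
  fixes y :: "'h::chilbert_space bop"
  assumes r: "0 \<le> r" and le: "\<And>\<xi>. norm \<xi> = 1 \<Longrightarrow> cmod (cinner \<xi> (bop_apply y \<xi>)) \<le> r"
  shows "norm y \<le> 2 * r"
proof (rule norm_bop_bound)
  have q: "cmod (cinner \<xi> (bop_apply y \<xi>)) \<le> r * (norm \<xi>)\<^sup>2" for \<xi>
  proof (cases "\<xi> = 0")
    case False
    define \<eta> where "\<eta> = inverse (norm \<xi>) *\<^sub>R \<xi>"
    have "norm \<eta> = 1" "\<xi> = norm \<xi> *\<^sub>R \<eta>"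
      using False by (simp_all add: \<eta>_def)
    then have "cinner \<xi> (bop_apply y \<xi>) = complex_of_real ((norm \<xi>)\<^sup>2) * cinner \<eta> (bop_apply y \<eta>)"
      by (metis (no_types, opaque_lifting) bop_apply_scaleC cinner_scaleC_left cinner_scaleC_right
          complex_cnj_complex_of_real mult.assoc of_real_mult power2_eq_square scaleR_scaleC)
    then show ?thesis
      using mult_left_mono[OF le[OF \<open>norm \<eta> = 1\<close>], of "(norm \<xi>)\<^sup>2"]
      by (simp add: norm_mult norm_power mult.commute)
  qed simp
  have pol: "cmod (cinner \<eta> (bop_apply y \<xi>)) \<le> r * ((norm \<eta>)\<^sup>2 + (norm \<xi>)\<^sup>2)" for \<eta> \<xi>
  proof -
    define S where "S = {1, -1, \<i>, -\<i>}"
    have "4 * cmod (cinner \<eta> (bop_apply y \<xi>)) = cmod (4 * cinner \<eta> (bop_apply y \<xi>))"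
      by (simp add: norm_mult)
    also have "\<dots> \<le> (\<Sum>c\<in>S. r * (norm (\<eta> + c *\<^sub>C \<xi>))\<^sup>2)"
      unfolding polarization S_def[symmetric]
    proof (rule sum_norm_le)
      fix c
      assume "c \<in> S"
      then have "cmod c = 1"
        by (auto simp: S_def)
      then show "cmod (cnj c * cinner (\<eta> + c *\<^sub>C \<xi>) (bop_apply y (\<eta> + c *\<^sub>C \<xi>)))
          \<le> r * (norm (\<eta> + c *\<^sub>C \<xi>))\<^sup>2"
        using q by (simp add: norm_mult)
    qed
    also have "\<dots> = 4 * (r * ((norm \<eta>)\<^sup>2 + (norm \<xi>)\<^sup>2))"
    proof -
      have "(norm (\<eta> + c *\<^sub>C \<xi>))\<^sup>2 = (norm \<eta>)\<^sup>2 + 2 * Re (c * cinner \<eta> \<xi>) + (cmod c * norm \<xi>)\<^sup>2"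
          for c
        by (simp only: power2_norm_add norm_scaleC cinner_scaleC_right)
      then show ?thesis
        by (simp add: S_def complex_eq_iff distrib_left)
    qed
    finally show ?thesis
      by simp
  qed
  fix \<xi>
  show "norm (bop_apply y \<xi>) \<le> 2 * r * norm \<xi>"
  proof (cases "bop_apply y \<xi> = 0 \<or> \<xi> = 0")
    case True
    then show ?thesis
      using r linear_0[OF bounded_linear.linear[OF bounded_linear_bop_apply]] by auto
  next
    case False
    \<comment> \<open>Rescales the image to the length of \<open>\<xi>\<close>, so that both squares
      in \<open>pol\<close> become equal.\<close>
    define k where "k = norm \<xi> / norm (bop_apply y \<xi>)"
    have k: "k * norm (bop_apply y \<xi>) = norm \<xi>" "k > 0"
      using False by (simp_all add: k_def)
    have "cinner (k *\<^sub>R bop_apply y \<xi>) (bop_apply y \<xi>)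
        = complex_of_real (norm \<xi> * norm (bop_apply y \<xi>))"
      by (simp add: cinner_scaleR_left cinner_self power2_eq_square flip: k(1))
    then have "norm \<xi> * norm (bop_apply y \<xi>) \<le> r * ((norm \<xi>)\<^sup>2 + (norm \<xi>)\<^sup>2)"
      using pol[of "k *\<^sub>R bop_apply y \<xi>" \<xi>] k by (simp add: norm_mult)
    then have "norm \<xi> * norm (bop_apply y \<xi>) \<le> norm \<xi> * (2 * r * norm \<xi>)"
      by (simp add: power2_eq_square algebra_simps)
    then show ?thesis
      using False by simp
  qed
qed (use r in simp)

lemma left_translation_in_reduced_group_cstar: "left_translation s \<in> reduced_group_cstar"
  by (auto simp: reduced_group_cstar_def cstar_generated_def)

text \<open>If no mean were small, each would have a vector state of large value on it. A cluster
  point of these states along the means is stationary, so it restricts to the trace, which vanishes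
  at \<open>s\<close>, while its value at \<open>s\<close> stays bounded away from 0.\<close>

lemma translation_mean_left_translation_small:
  fixes \<mu> :: "'g::group_add pmf"
  assumes \<mu>: "cstar_simple_measure \<mu>" and s: "s \<noteq> 0" and e: "e > 0"
  shows "\<exists>n. norm (translation_mean \<mu> n (left_translation s :: ('g, complex) ell2 bop)) < e"
proof (rule ccontr)
  define y where "y n = translation_mean \<mu> n (left_translation s :: ('g, complex) ell2 bop)" for n
  assume "\<not> ?thesis"
  then have ge: "e \<le> norm (y n)" for n
    by (auto simp: y_def not_less)
  \<comment> \<open>Half of \<open>e\<close> would already suffice for the numerical radius
    estimate; with \<open>e / 4\<close> the inequality is strict.\<close>
  have "\<not> norm (y n) \<le> 2 * (e / 4)" for n
    using e ge[of n] by simp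
  then have "\<exists>\<xi>. norm \<xi> = 1 \<and> e / 4 < cmod (cinner \<xi> (bop_apply (y n) \<xi>))" for n
    using norm_le_numerical_radius[of "e / 4" "y n"] e not_less
    by (metis divide_nonneg_pos less_imp_le zero_less_numeral)
  then obtain \<xi> where \<xi>: "\<And>n. norm (\<xi> n) = 1" "\<And>n. e / 4
      < cmod (cinner (\<xi> n) (bop_apply (y n) (\<xi> n)))"
    by metis
  obtain \<phi> G where G: "G \<noteq> bot" and \<phi>: "state_on UNIV \<phi>" "\<And>x. \<phi> (translation_average \<mu> x) = \<phi> x"
    and lim: "\<And>x. ((\<lambda>n. cinner (\<xi> n) (bop_apply (translation_mean \<mu> n x) (\<xi> n))) \<longlongrightarrow> \<phi> x) G"
    by (rule stationary_cluster_point[where \<psi> = "\<lambda>n x. cinner (\<xi> n) (bop_apply x (\<xi> n))" and \<mu> = \<mu>,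
          OF vector_state[OF \<xi>(1)]]) (rule that)
  have "state_convolution \<mu> inner_action \<phi> a = \<phi> a" for a
    using infsumI[OF state_translation_average_has_sum[OF \<phi>(1), of \<mu> a]]
    by (simp add: state_convolution_def inner_action_def star_left_translation \<phi>(2))
  moreover have "state_on reduced_group_cstar \<phi>"
    using \<phi>(1) by (simp add: state_on_def)
  ultimately have "\<phi> (left_translation s) = canonical_trace (left_translation s)"
    using \<mu> left_translation_in_reduced_group_cstar[of s]
    unfolding cstar_simple_measure_def stationary_state_on_def by blast
  then have "\<phi> (left_translation s) = 0"
    using s by (simp add: canonical_trace_left_translation)
  moreover have "e / 4 \<le> cmod (\<phi> (left_translation s))"
    by (rule tendsto_lowerbound[OF tendsto_norm[OF lim] _ G])
      (use \<xi>(2) in \<open>auto intro!: always_eventually less_imp_le simp: y_def\<close>)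
  ultimately show False
    using e by simp
qed

text \<open>A stationary state has the same value on an element and on all its means, and the means
  of this element become arbitrarily small.\<close>

lemma stationary_state_crossed_zero:
  fixes \<pi> :: "'a::cstar_algebra \<Rightarrow> 'h::chilbert_space bop"
    and \<phi> :: "('g::group_add, 'h) ell2 bop \<Rightarrow> complex"
  assumes \<mu>: "cstar_simple_measure \<mu>" and \<alpha>: "gamma_cstar_algebra \<alpha>" and \<pi>: "star_hom \<pi>" "\<pi> 1 = 1"
    and \<phi>: "state_on UNIV \<phi>" "\<And>x. \<phi> (translation_average \<mu> x) = \<phi> x" and s: "s \<noteq> 0"
  shows "\<phi> (crossed_representation \<alpha> \<pi> a * left_translation s) = 0"
proof (rule ccontr)
  define x where "x = crossed_representation \<alpha> \<pi> a * left_translation s"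
  have "\<phi> ((translation_average \<mu> ^^ k) x) = \<phi> x" for k
    by (induction k) (simp_all add: \<phi>)
  then have mean: "\<phi> (translation_mean \<mu> n x) = \<phi> x" for n
    by (simp add: state_translation_mean_eq[OF \<phi>(1)] del: of_nat_Suc)
  assume "\<phi> (crossed_representation \<alpha> \<pi> a * left_translation s) \<noteq> 0"
  then have x: "cmod (\<phi> x) > 0"
    by (simp add: x_def)
  have pos: "norm a + 1 > 0"
    by (simp add: add_nonneg_pos)
  \<comment> \<open>The \<open>+ 1\<close> covers \<open>norm a = 0\<close> and makes the final
    inequality strict.\<close>
  obtain n where n: "norm (translation_mean \<mu> n (left_translation s :: ('g, complex) ell2 bop))
      < cmod (\<phi> x) / (norm a + 1)"
    using translation_mean_left_translation_small[OF \<mu> s divide_pos_pos[OF x pos]] by blast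
  have "cmod (\<phi> x) \<le> norm (translation_mean \<mu> n x)"
    using state_norm_le[OF \<phi>(1), of "translation_mean \<mu> n x"] by (simp add: mean)
  also have "\<dots> \<le> norm a * norm (translation_mean \<mu> n (left_translation s :: ('g, complex) ell2
      bop))"
    unfolding x_def by (rule norm_translation_mean_crossed_le[OF \<alpha> \<pi>])
  also have "\<dots> \<le> norm a * (cmod (\<phi> x) / (norm a + 1))"
    by (rule mult_left_mono[OF less_imp_le[OF n]]) simp
  also have "\<dots> = cmod (\<phi> x) * (norm a / (norm a + 1))"
    by (simp only: times_divide_eq_right mult.commute)
  also have "\<dots> < cmod (\<phi> x) * 1"
    using pos by (intro mult_strict_left_mono x) simp
  finally show False
    by simp
qed

subsection \<open>States vanishing on an ideal\<close>

lemma cinner_sum_star_mult_self: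
  "cinner \<xi> (bop_apply (\<Sum>x\<in>F. star x * x) \<xi>) = complex_of_real (\<Sum>x\<in>F. (norm (bop_apply x \<xi>))\<^sup>2)"
proof (induction F rule: infinite_finite_induct)
  case (insert x F)
  have "cinner \<xi> (bop_apply (star x * x + (\<Sum>x\<in>F. star x * x)) \<xi>)
      = complex_of_real ((norm (bop_apply x \<xi>))\<^sup>2)
          + complex_of_real (\<Sum>x\<in>F. (norm (bop_apply x \<xi>))\<^sup>2)"
    by (simp only: bop_apply_plus cinner_add_right cinner_star_mult_self insert.IH)
  then show ?case
    using insert.hyps by simp
qed (simp_all add: zero_bop.rep_eq bop_apply.rep_eq)

lemma ideal_sum:
  assumes "closed_ideal I B" "\<And>i. i \<in> F \<Longrightarrow> f i \<in> I"
  shows "sum f F \<in> I"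
  using assms(2) by (induction F rule: infinite_finite_induct) (use assms(1) in \<open>auto simp:
      closed_ideal_def\<close>)

text \<open>The partial sums of the geometric series lie in \<open>B\<close>, so
  \<open>1 - z ^ n\<close> lies in the ideal and tends to 1.\<close>

lemma ideal_one_if_near_one:
  fixes z :: "'a::cstar_algebra"
  assumes B: "cstar_subalgebra B" "1 \<in> B" and I: "closed_ideal I B"
    and z: "z \<in> B" "1 - z \<in> I" "norm z < 1"
  shows "1 \<in> I"
proof -
  have geom: "(1 - z) * (\<Sum>k<n. z ^ k) = 1 - z ^ n" for n
  proof (induction n)
    case (Suc n)
    have "(1 - z) * (\<Sum>k<Suc n. z ^ k) = (1 - z ^ n) + (1 - z) * z ^ n"
      by (simp add: distrib_left Suc.IH)
    then show ?case
      by (simp add: left_diff_distrib)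
  qed simp
  have "(\<Sum>k<n. z ^ k) \<in> B" for n
    by (intro cstar_subalgebra_sum cstar_subalgebra_power B z)
  then have "1 - z ^ n \<in> I" for n
    using I z(2) unfolding geom[symmetric] closed_ideal_def by blast
  moreover have "(\<lambda>n. 1 - z ^ n) \<longlonglongrightarrow> 1 - 0"
  proof (intro tendsto_diff tendsto_const)
    show "(\<lambda>n. z ^ n) \<longlonglongrightarrow> 0"
    proof (rule Lim_null_comparison)
      show "\<forall>\<^sub>F n in sequentially. norm (z ^ n) \<le> norm z ^ n"
        by (simp add: norm_power_le)
      show "(\<lambda>n. norm z ^ n) \<longlonglongrightarrow> 0"
        using z(3) by (intro LIMSEQ_power_zero) simp
    qed
  qed
  moreover have "closed I"
    using I by (simp add: closed_ideal_def)
  ultimately show ?thesis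
    by (metis closed_sequentially diff_zero)
qed

text \<open>Otherwise \<open>\<Sum>x\<in>F. star x * x\<close> would be bounded below, hence invertible.\<close>

lemma ideal_approximate_kernel:
  fixes B :: "'h::chilbert_space bop set"
  assumes B: "cstar_subalgebra B" "1 \<in> B" and I: "closed_ideal I B" "1 \<notin> I" and fin: "finite F"
      and F: "F \<subseteq> I"
  shows "\<exists>\<xi>. norm \<xi> = 1 \<and> (\<forall>x\<in>F. norm (bop_apply x \<xi>) \<le> 1)"
proof (rule ccontr)
  assume "\<not> ?thesis"
  then have neg: "\<exists>x\<in>F. 1 < norm (bop_apply x \<xi>)" if "norm \<xi> = 1" for \<xi>
    using that by (auto simp: not_le)
  define S where "S = (\<Sum>x\<in>F. star x * x)"
  have "star x * x \<in> I" if "x \<in> F" for x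
    using that F B I(1) unfolding closed_ideal_def cstar_subalgebra_def by blast
  then have SI: "S \<in> I"
    unfolding S_def by (rule ideal_sum[OF I(1)])
  then have SB: "S \<in> B"
    using I(1) by (auto simp: closed_ideal_def)
  have lower: "(norm \<xi>)\<^sup>2 \<le> Re (cinner \<xi> (bop_apply S \<xi>))" for \<xi>
  proof (cases "\<xi> = 0")
    case False
    define \<eta> where "\<eta> = inverse (norm \<xi>) *\<^sub>R \<xi>"
    have \<eta>: "norm \<eta> = 1" "\<xi> = norm \<xi> *\<^sub>R \<eta>"
      using False by (simp_all add: \<eta>_def)
    obtain x where x: "x \<in> F" "1 < norm (bop_apply x \<eta>)"
      using neg[OF \<eta>(1)] by blast
    have "norm (bop_apply x \<xi>) = norm \<xi> * norm (bop_apply x \<eta>)"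
      by (subst \<eta>(2)) (simp only: scaleR_scaleC bop_apply_scaleC norm_scaleC norm_of_real
          abs_norm_cancel)
    then have "norm \<xi> \<le> norm (bop_apply x \<xi>)"
      using x(2) mult_left_mono[of 1 "norm (bop_apply x \<eta>)" "norm \<xi>"] by simp
    then have "(norm \<xi>)\<^sup>2 \<le> (norm (bop_apply x \<xi>))\<^sup>2"
      by (rule power_mono) simp
    also have "\<dots> \<le> (\<Sum>x\<in>F. (norm (bop_apply x \<xi>))\<^sup>2)"
      by (rule member_le_sum[OF x(1) _ fin]) simp
    finally show ?thesis
      unfolding S_def cinner_sum_star_mult_self by simp
  qed simp
  \<comment> \<open>Since the square of \<open>norm S\<close> is at most \<open>r\<close>, the
    quadratic term for \<open>z\<close> costs at most 1/r, half of what the linear term gains. The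
    \<open>+ 1\<close> ensures \<open>1 \<le> r\<close>.\<close>
  define r where "r = (norm S)\<^sup>2 + 1"
  have r: "1 \<le> r"
    by (simp add: r_def)
  define z where "z = 1 - (1 / r) *\<^sub>R S"
  have zn: "norm z \<le> sqrt (1 - 1 / r)"
  proof (rule norm_bop_bound)
    show "0 \<le> sqrt (1 - 1 / r)"
      using r by simp
    fix \<xi>
    have "(norm (bop_apply S \<xi>))\<^sup>2 \<le> (norm S * norm \<xi>)\<^sup>2"
      by (intro power_mono norm_bop_apply) simp
    also have "\<dots> \<le> r * (norm \<xi>)\<^sup>2"
      by (simp add: power_mult_distrib r_def algebra_simps)
    finally have "(norm (bop_apply S \<xi>))\<^sup>2 / r\<^sup>2 \<le> r * (norm \<xi>)\<^sup>2 / r\<^sup>2"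
      by (rule divide_right_mono) simp
    also have "\<dots> = (norm \<xi>)\<^sup>2 / r"
      using r by (simp add: power2_eq_square)
    finally have S2: "(norm (bop_apply S \<xi>))\<^sup>2 / r\<^sup>2 \<le> (norm \<xi>)\<^sup>2 / r" .
    have "bop_apply z \<xi> = \<xi> + (- 1 / r) *\<^sub>R bop_apply S \<xi>"
      by (simp add: z_def bop_apply_diff bop_apply_one bop_apply_scaleR)
    then have "(norm (bop_apply z \<xi>))\<^sup>2 = (norm \<xi>)\<^sup>2 - 2 * (Re (cinner \<xi> (bop_apply S \<xi>)) / r)
        + (norm (bop_apply S \<xi>))\<^sup>2 / r\<^sup>2"
      by (simp only: power2_norm_add cinner_scaleR_right) (simp add: power_mult_distrib
          power_divide)
    also have "\<dots> \<le> (norm \<xi>)\<^sup>2 - 2 * ((norm \<xi>)\<^sup>2 / r) + (norm \<xi>)\<^sup>2 / r"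
      using divide_right_mono[OF lower[of \<xi>], of r] r S2 by simp
    also have "\<dots> = (1 - 1 / r) * (norm \<xi>)\<^sup>2"
      by (simp add: algebra_simps)
    also have "\<dots> = (sqrt (1 - 1 / r) * norm \<xi>)\<^sup>2"
      using r by (simp add: power_mult_distrib)
    finally show "norm (bop_apply z \<xi>) \<le> sqrt (1 - 1 / r) * norm \<xi>"
      by (rule power2_le_imp_le) (use r in simp)
  qed
  also have "\<dots> < 1"
    using r by simp
  finally have "norm z < 1" .
  moreover have zI: "1 - z \<in> I"
    using SI I(1) by (simp add: z_def scaleR_scaleC closed_ideal_def)
  moreover have "z \<in> B"
  proof -
    have "(- complex_of_real (1 / r)) *\<^sub>C S \<in> B"
      using B(1) SB unfolding cstar_subalgebra_def by blast
    moreover have "z = 1 + (- complex_of_real (1 / r)) *\<^sub>C S"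
      using scaleR_scaleC[of "- (1 / r)" S] by (simp add: z_def)
    ultimately show ?thesis
      using B unfolding cstar_subalgebra_def by metis
  qed
  ultimately show False
    using ideal_one_if_near_one[OF B I(1)] I(2) by blast
qed

text \<open>The bound 1 on finite sets suffices because the ideal contains all multiples: the limit
  along the finite subsets satisfies |t| |\<phi> x| \<le> 1 for every real t.\<close>

lemma state_vanishing_on_ideal:
  fixes B :: "'h::chilbert_space bop set"
  assumes B: "cstar_subalgebra B" "1 \<in> B" and I: "closed_ideal I B" "1 \<notin> I"
  obtains \<phi> where "state_on UNIV \<phi>" "\<And>x. x \<in> I \<Longrightarrow> \<phi> x = 0"
proof -
  \<comment> \<open>The instance with the empty set supplies a default unit vector when
    \<open>F\<close> is not a finite subset of the ideal.\<close>
  have "\<exists>\<xi>. norm \<xi> = 1 \<and> (finite F \<and> F \<subseteq> I \<longrightarrow> (\<forall>x\<in>F. norm (bop_apply x \<xi>) \<le> 1))" for F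
    using ideal_approximate_kernel[OF B I, of F] ideal_approximate_kernel[OF B I, of "{}"] by auto
  then obtain \<xi> where \<xi>: "\<And>F. norm (\<xi> F) = 1"
    and small: "\<And>F x. finite F \<Longrightarrow> F \<subseteq> I \<Longrightarrow> x \<in> F \<Longrightarrow> norm (bop_apply x (\<xi> F)) \<le> 1"
    by metis
  define \<psi> where "\<psi> F x = cinner (\<xi> F) (bop_apply x (\<xi> F))" for F x
  have \<psi>: "state_on UNIV (\<psi> F)" for F
    unfolding \<psi>_def by (rule vector_state[OF \<xi>])
  obtain \<phi> G where G: "G \<noteq> bot" "G \<le> finite_subsets_at_top I"
    and lim: "\<And>x. ((\<lambda>F. \<psi> F x) \<longlongrightarrow> \<phi> x) G"
    by (rule pointwise_cluster_point[where f = \<psi>, OF finite_subsets_at_top_neq_bot[of I]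
        state_norm_le[OF \<psi>]]) (rule that)
  have "\<phi> x = 0" if x: "x \<in> I" for x
  proof -
    have "cmod (\<phi> (complex_of_real t *\<^sub>C x)) \<le> 1" for t
    proof (rule tendsto_upperbound[OF tendsto_norm[OF lim] _ G(1)])
      have tx: "complex_of_real t *\<^sub>C x \<in> I"
        using x I(1) by (simp add: closed_ideal_def)
      have "eventually (\<lambda>F. finite F \<and> F \<subseteq> I \<and> complex_of_real t *\<^sub>C x
          \<in> F) (finite_subsets_at_top I)"
        unfolding eventually_finite_subsets_at_top
        using tx by (intro exI[of _ "{complex_of_real t *\<^sub>C x}"]) auto
      then have "eventually (\<lambda>F. finite F \<and> F \<subseteq> I \<and> complex_of_real t *\<^sub>C x \<in> F) G"
        using G(2) by (simp add: le_filter_def)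
      then show "eventually (\<lambda>F. cmod (\<psi> F (complex_of_real t *\<^sub>C x)) \<le> 1) G"
      proof (rule eventually_mono)
        fix F
        assume "finite F \<and> F \<subseteq> I \<and> complex_of_real t *\<^sub>C x \<in> F"
        then have "norm (bop_apply (complex_of_real t *\<^sub>C x) (\<xi> F)) \<le> 1"
          using small by blast
        then show "cmod (\<psi> F (complex_of_real t *\<^sub>C x)) \<le> 1"
          using Cauchy_Schwarz_cinner[of "\<xi> F" "bop_apply (complex_of_real t *\<^sub>C x) (\<xi> F)"]
          by (simp add: \<psi>_def \<xi>)
      qed
    qed
    then have le: "\<bar>t\<bar> * cmod (\<phi> x) \<le> 1" for t
      by (simp add: state_scaleC[OF state_limit[OF G(1) \<psi> lim]] norm_mult)
    show ?thesis
    proof (rule ccontr)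
      assume "\<phi> x \<noteq> 0"
      then show False
        using le[of "2 / cmod (\<phi> x)"] by simp
    qed
  qed
  then show ?thesis
    using that state_limit[OF G(1) \<psi> lim] by blast
qed

section \<open>Stationary states that vanish on an ideal\<close>

lemma translation_average_in_ideal:
  assumes I: "closed_ideal I B" and tr: "range left_translation \<subseteq> B" and x: "x \<in> I"
  shows "translation_average \<mu> x \<in> I"
proof -
  have "left_translation (- s) * x * left_translation s \<in> I" for s
    using I x tr unfolding closed_ideal_def by (metis range_subsetD)
  then have "pmf \<mu> s *\<^sub>R (left_translation (- s) * x * left_translation s) \<in> I" for s
    using I by (simp add: closed_ideal_def scaleR_scaleC)
  then have "eventually (\<lambda>F. (\<Sum>s\<in>F. pmf \<mu> s *\<^sub>R (left_translation (- s) * x * left_translation s))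
      \<in> I) (finite_subsets_at_top UNIV)"
    by (intro always_eventually allI ideal_sum[OF I])
  moreover have "((\<lambda>F. \<Sum>s\<in>F. pmf \<mu> s *\<^sub>R (left_translation (- s) * x * left_translation s))
      \<longlongrightarrow> translation_average \<mu> x) (finite_subsets_at_top UNIV)"
    using translation_average_has_sum[of \<mu> x] by (simp add: has_sum_def)
  moreover have "closed I"
    using I by (simp add: closed_ideal_def)
  ultimately show ?thesis
    using Lim_in_closed_set[OF _ _ finite_subsets_at_top_neq_bot] by blast
qed

lemma translation_mean_in_ideal:
  assumes I: "closed_ideal I B" and tr: "range left_translation \<subseteq> B" and x: "x \<in> I"
  shows "translation_mean \<mu> n x \<in> I"
proof -
  have "(translation_average \<mu> ^^ k) x \<in> I" for k
    by (induction k) (simp_all add: x translation_average_in_ideal[OF I tr])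
  then have "(\<Sum>k\<le>n. (translation_average \<mu> ^^ k) x) \<in> I"
    by (intro ideal_sum[OF I])
  then show ?thesis
    using I by (simp add: closed_ideal_def translation_mean_def scaleR_scaleC)
qed

lemma stationary_state_vanishing_on_ideal:
  fixes B :: "('g::group_add, 'h::chilbert_space) ell2 bop set"
  assumes B: "cstar_subalgebra B" "1 \<in> B" and I: "closed_ideal I B" "1 \<notin> I"
    and tr: "range left_translation \<subseteq> B"
  obtains \<phi> where "state_on UNIV \<phi>" "\<And>x. \<phi> (translation_average \<mu> x) = \<phi> x" "\<And>x. x \<in> I \<Longrightarrow> \<phi> x = 0"
proof -
  obtain \<psi> where \<psi>: "state_on UNIV \<psi>" "\<And>x. x \<in> I \<Longrightarrow> \<psi> x = 0"
    by (rule state_vanishing_on_ideal[OF B I]) (rule that)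
  obtain \<phi> G where G: "G \<noteq> bot" and \<phi>: "state_on UNIV \<phi>" "\<And>x. \<phi> (translation_average \<mu> x) = \<phi> x"
    and lim: "\<And>x. ((\<lambda>n. \<psi> (translation_mean \<mu> n x)) \<longlongrightarrow> \<phi> x) G"
    by (rule stationary_cluster_point[where \<psi> = "\<lambda>_. \<psi>" and \<mu> = \<mu>, OF \<psi>(1)]) (rule that)
  have "\<phi> x = 0" if "x \<in> I" for x
    using tendsto_unique[OF G lim[of x]] \<psi>(2)[OF translation_mean_in_ideal[OF I(1) tr that]] by simp
  then show ?thesis
    by (rule that[OF \<phi>])
qed

text \<open>The degenerate case of Cauchy-Schwarz. The factor \<open>u\<close> is arbitrary, so it
  may lie outside \<open>B\<close>.\<close>

lemma state_left_kernel:
  assumes \<phi>: "state_on UNIV \<phi>" and y: "\<phi> (star y * y) = 0"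
  shows "\<phi> (star u * y) = 0"
proof (rule ccontr)
  define p where "p = \<phi> (star u * y)"
  assume "\<phi> (star u * y) \<noteq> 0"
  then have p: "cmod p > 0"
    by (simp add: p_def)
  have yu: "\<phi> (star y * u) = cnj p"
    using state_star(1)[OF cstar_subalgebra_UNIV _ \<phi>, of "star u * y"]
    by (simp add: star_mult p_def)
  \<comment> \<open>Chosen so that the state takes the value -1 on the square of
    \<open>u + c y\<close>.\<close>
  define t where "t = (Re (\<phi> (star u * u)) + 1) / (2 * (cmod p)\<^sup>2)"
  define c where "c = - complex_of_real t * cnj p"
  have "star (u + c *\<^sub>C y) * (u + c *\<^sub>C y)
      = (star u * u + c *\<^sub>C (star u * y)) + (cnj c *\<^sub>C (star y * u) + (cnj c * c) *\<^sub>C (star y * y))"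
    by (simp add: star_add star_scaleC distrib_left distrib_right scaleC_mult_left
        scaleC_mult_right scaleC_scaleC scaleC_add_right mult.commute add_ac)
  then have "\<phi> (star (u + c *\<^sub>C y) * (u + c *\<^sub>C y)) = \<phi> (star u * u) + c * p + cnj (c * p)"
    by (simp add: state_add[OF \<phi>] state_scaleC[OF \<phi>] y yu flip: p_def)
  moreover have "c * p = - complex_of_real (t * (cmod p)\<^sup>2)"
    using complex_norm_square[of p] by (simp add: c_def mult_ac)
  ultimately have "Re (\<phi> (star (u + c *\<^sub>C y) * (u + c *\<^sub>C y)))
      = Re (\<phi> (star u * u)) - 2 * t * (cmod p)\<^sup>2"
    by (simp del: of_real_mult of_real_power)
  also have "2 * t * (cmod p)\<^sup>2 = Re (\<phi> (star u * u)) + 1"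
    using p by (simp add: t_def)
  finally show False
    using state_nonneg[OF \<phi>, of "u + c *\<^sub>C y"] by (simp add: complex_nonneg_Reals_iff)
qed

subsection \<open>Coefficients in the reduced crossed product\<close>

context
  fixes \<alpha> :: "'g::group_add \<Rightarrow> 'a::cstar_algebra \<Rightarrow> 'a" and \<pi> :: "'a \<Rightarrow> 'h::chilbert_space bop"
  assumes \<alpha>: "gamma_cstar_algebra \<alpha>" and \<pi>: "star_hom \<pi>" "\<pi> 1 = 1"
begin

private abbreviation "\<sigma> \<equiv> crossed_representation \<alpha> \<pi>"

private lemma action:
  "\<alpha> s (x + y) = \<alpha> s x + \<alpha> s y" "\<alpha> s (c *\<^sub>C x) = c *\<^sub>C \<alpha> s x" "\<alpha> s (x * y) = \<alpha> s x * \<alpha> s y"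
  "\<alpha> s (star x) = star (\<alpha> s x)" "\<alpha> s (\<alpha> t x) = \<alpha> (s + t) x" "\<alpha> 0 x = x"
  using \<alpha> by (simp_all add: gamma_cstar_algebra_def star_hom_def)

private lemma hom:
  "\<pi> (x + y) = \<pi> x + \<pi> y" "\<pi> (c *\<^sub>C x) = c *\<^sub>C \<pi> x" "\<pi> (x * y) = \<pi> x * \<pi> y" "\<pi> (star x)
      = star (\<pi> x)"
  using \<pi> by (simp_all add: star_hom_def)

private lemmas \<sigma>_apply = crossed_representation_apply[OF \<alpha> \<pi>]

lemma crossed_representation_star_hom: "star_hom (crossed_representation \<alpha> \<pi>)"
  unfolding star_hom_def
proof (intro conjI allI)
  fix x y c
  show "\<sigma> (x + y) = \<sigma> x + \<sigma> y"
    by (rule bop_eqI, rule ell2_eqI) (simp add: \<sigma>_apply bop_apply_plus plus_ell2.rep_eq action hom)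
  show "\<sigma> (c *\<^sub>C x) = c *\<^sub>C \<sigma> x"
    by (rule bop_eqI, rule ell2_eqI) (simp add: \<sigma>_apply bop_apply_scaleC_left scaleC_ell2.rep_eq
        action hom)
  show "\<sigma> (x * y) = \<sigma> x * \<sigma> y"
    by (rule bop_eqI, rule ell2_eqI) (simp add: \<sigma>_apply bop_apply_times action hom)
  have "star (\<sigma> x) = \<sigma> (star x)"
    by (rule star_bop_eqI) (simp add: cinner_ell2.rep_eq \<sigma>_apply action hom cinner_star)
  then show "\<sigma> (star x) = star (\<sigma> x)"
    by simp
qed

lemma crossed_representation_one: "crossed_representation \<alpha> \<pi> 1 = 1"
proof -
  have "\<alpha> s 1 = 1" for s
    using \<alpha> by (intro star_hom_surj_one) (auto simp: gamma_cstar_algebra_def bij_is_surj)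
  then show ?thesis
    by (intro bop_eqI ell2_eqI) (simp add: \<sigma>_apply \<pi> bop_apply_one)
qed

lemma crossed_representation_covariant:
  "left_translation s * crossed_representation \<alpha> \<pi> a
      = crossed_representation \<alpha> \<pi> (\<alpha> s a) * left_translation s"
  by (rule bop_eqI, rule ell2_eqI)
    (simp add: bop_apply_times left_translation_apply \<sigma>_apply action minus_add del:
        add_uminus_conv_diff)

lemma crossed_representation_conj:
  "left_translation (- s) * crossed_representation \<alpha> \<pi> a * left_translation s
      = crossed_representation \<alpha> \<pi> (\<alpha> (- s) a)"
  unfolding crossed_representation_covariant by (simp only: mult.assoc left_translation_inverse
      mult_1_right)

text \<open>Scalars are absorbed into the coefficient, so monomials and sums already give a
  subalgebra closed under \<open>star\<close>.\<close>

inductive_set crossed_polynomials :: "('g, 'h) ell2 bop set" where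
  monomial: "\<sigma> a * left_translation s \<in> crossed_polynomials"
| add: "x \<in> crossed_polynomials \<Longrightarrow> y \<in> crossed_polynomials \<Longrightarrow> x + y \<in> crossed_polynomials"

end

lemma cstar_subalgebra_closure:
  assumes zero: "0 \<in> S" and add: "\<And>x y. x \<in> S \<Longrightarrow> y \<in> S \<Longrightarrow> x + y \<in> S"
    and mult: "\<And>x y. x \<in> S \<Longrightarrow> y \<in> S \<Longrightarrow> x * y \<in> S"
    and scale: "\<And>c x. x \<in> S \<Longrightarrow> c *\<^sub>C x \<in> S" and star: "\<And>x. x \<in> S \<Longrightarrow> star x \<in> S"
  shows "cstar_subalgebra (closure S)"
  unfolding cstar_subalgebra_def
proof (intro conjI ballI allI)
  have lim: "w \<in> closure S" if "\<And>n. W n \<in> S" "W \<longlonglongrightarrow> w" for W w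
    unfolding closure_sequential using that by blast
  show "closed (closure S)" "0 \<in> closure S"
    using zero closure_subset by auto
  fix x
  assume "x \<in> closure S"
  then obtain X where X: "\<And>n. X n \<in> S" "X \<longlonglongrightarrow> x"
    by (auto simp: closure_sequential)
  show "star x \<in> closure S"
    by (rule lim[OF star[OF X(1)] bounded_linear.tendsto[OF bounded_linear_star X(2)]])
  fix c
  \<comment> \<open>Scalar multiplication is continuous because it is multiplication by a scalar
    multiple of 1.\<close>
  have "(\<lambda>n. (c *\<^sub>C 1) * X n) \<longlonglongrightarrow> (c *\<^sub>C 1) * x"
    by (intro tendsto_mult tendsto_const X(2))
  then have "(\<lambda>n. c *\<^sub>C X n) \<longlonglongrightarrow> c *\<^sub>C x"
    by (simp add: scaleC_mult_left)
  then show "c *\<^sub>C x \<in> closure S"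
    by (rule lim[OF scale[OF X(1)]])
  fix y
  assume "y \<in> closure S"
  then obtain Y where Y: "\<And>n. Y n \<in> S" "Y \<longlonglongrightarrow> y"
    by (auto simp: closure_sequential)
  show "x + y \<in> closure S"
    by (rule lim[OF add[OF X(1) Y(1)] tendsto_add[OF X(2) Y(2)]])
  show "x * y \<in> closure S"
    by (rule lim[OF mult[OF X(1) Y(1)] tendsto_mult[OF X(2) Y(2)]])
qed

text \<open>Covariance moves every translation to the right, so products and adjoints of monomials
  are monomials. The closure is then one of the subalgebras containing the generators.\<close>

lemma reduced_crossed_product_subset:
  fixes \<alpha> :: "'g::group_add \<Rightarrow> 'a::cstar_algebra \<Rightarrow> 'a" and \<pi> :: "'a \<Rightarrow> 'h::chilbert_space bop"
  assumes \<alpha>: "gamma_cstar_algebra \<alpha>" and \<pi>: "star_hom \<pi>" "\<pi> 1 = 1"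
  shows "reduced_crossed_product \<alpha> \<pi> \<subseteq> closure (crossed_polynomials \<alpha> \<pi>)"
proof -
  let ?S = "crossed_polynomials \<alpha> \<pi>"
  let ?\<sigma> = "crossed_representation \<alpha> \<pi>"
  note intro = crossed_polynomials.intros[OF \<alpha> \<pi>]
  note induct = crossed_polynomials.induct[OF \<alpha> \<pi>, consumes 1, case_names monomial add]
  note hom = crossed_representation_star_hom[OF \<alpha> \<pi>, unfolded star_hom_def]
  note cov = crossed_representation_covariant[OF \<alpha> \<pi>]
  have mono: "(?\<sigma> a * left_translation s) * (?\<sigma> b * left_translation t)
      = ?\<sigma> (a * \<alpha> s b) * left_translation (s + t)" for a b s t
  proof -
    have "(?\<sigma> a * left_translation s) * (?\<sigma> b * left_translation t)
        = ?\<sigma> a * (left_translation s * ?\<sigma> b) * left_translation t"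
      by (simp only: mult.assoc)
    also have "\<dots> = ?\<sigma> (a * \<alpha> s b) * left_translation (s + t)"
      using hom by (simp add: cov mult.assoc left_translation_mult)
    finally show ?thesis .
  qed
  have "cstar_subalgebra (closure ?S)"
  proof (rule cstar_subalgebra_closure)
    have "?\<sigma> 0 = 0"
      using hom by (metis scaleC_zero_left)
    then show "0 \<in> ?S"
      using intro(1)[of 0 0] by simp
    show "x + y \<in> ?S" if "x \<in> ?S" "y \<in> ?S" for x y
      using that by (rule intro(2))
    show "x * y \<in> ?S" if x: "x \<in> ?S" and y: "y \<in> ?S" for x y
      using x
    proof (induction rule: induct)
      case (monomial a s)
      show ?case
        using y
      proof (induction rule: induct)
        case (monomial b t)
        then show ?case
          unfolding mono by (rule intro(1))
      qed (simp add: distrib_left intro(2))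
    qed (simp add: distrib_right intro(2))
    show "c *\<^sub>C x \<in> ?S" if "x \<in> ?S" for c x
      using that
    proof (induction rule: induct)
      case (monomial a s)
      have "c *\<^sub>C (?\<sigma> a * left_translation s) = ?\<sigma> (c *\<^sub>C a) * left_translation s"
        using hom by (simp add: scaleC_mult_left)
      then show ?case
        by (simp add: intro(1))
    qed (simp add: scaleC_add_right intro(2))
    show "star x \<in> ?S" if "x \<in> ?S" for x
      using that
    proof (induction rule: induct)
      case (monomial a s)
      have "star (?\<sigma> a * left_translation s) = left_translation (- s) * ?\<sigma> (star a)"
        using hom by (simp add: star_mult star_left_translation)
      then show ?case
        by (simp add: cov intro(1))
    qed (simp add: star_add intro(2))
  qed
  moreover have "left_translation s \<in> ?S" for s
    using intro(1)[of 1 s] by (simp add: crossed_representation_one[OF \<alpha> \<pi>])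
  moreover have "?\<sigma> a \<in> ?S" for a
    using intro(1)[of a 0] by (simp add: left_translation_0)
  ultimately show ?thesis
    unfolding reduced_crossed_product_def cstar_generated_def
    using closure_subset[of ?S] by (intro Inter_lower) auto
qed

section \<open>Matrix entries and the coefficient at the neutral element\<close>

lift_definition ell2_single :: "'g \<Rightarrow> 'h::chilbert_space \<Rightarrow> ('g, 'h) ell2" is "\<lambda>s \<eta> t. if t
    = s then \<eta> else 0"
proof -
  fix s :: 'g and \<eta> :: 'h
  have "(\<lambda>t. (norm (if t = s then \<eta> else 0))\<^sup>2) summable_on {s}"
    by simp
  then show "(\<lambda>t. (norm (if t = s then \<eta> else 0))\<^sup>2) summable_on UNIV"
    by (rule summable_on_cong_neutral[THEN iffD1, rotated -1]) auto
qed

lemma cinner_ell2_single: "cinner (ell2_single s \<eta>) \<xi> = cinner \<eta> (ell2_apply \<xi> s)"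
proof -
  have "cinner (ell2_single s \<eta>) \<xi> = (\<Sum>\<^sub>\<infinity>t\<in>{s}. cinner (ell2_apply (ell2_single s \<eta>) t)
      (ell2_apply \<xi> t))"
    unfolding cinner_ell2.rep_eq by (rule infsum_cong_neutral) (auto simp: ell2_single.rep_eq)
  then show ?thesis
    by (simp add: ell2_single.rep_eq)
qed

lemma norm_ell2_single: "norm (ell2_single s \<eta>) = norm \<eta>"
proof -
  have "complex_of_real ((norm (ell2_single s \<eta>))\<^sup>2) = complex_of_real ((norm \<eta>)\<^sup>2)"
    by (simp only: cinner_self[symmetric] cinner_ell2_single) (simp add: ell2_single.rep_eq)
  then have "(norm (ell2_single s \<eta>))\<^sup>2 = (norm \<eta>)\<^sup>2"
    by (simp only: of_real_eq_iff)
  then show ?thesis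
    by (simp add: power2_eq_iff_nonneg)
qed

text \<open>Passing to the adjoint avoids a density argument: pairing with point-supported vectors
  reads off every coordinate of \<open>star x\<close> applied to a vector.\<close>

lemma bop_eq_0_if_single:
  fixes x :: "('g, 'h::chilbert_space) ell2 bop"
  assumes "\<And>t \<eta>. bop_apply x (ell2_single t \<eta>) = 0"
  shows "x = 0"
proof -
  have "bop_apply (star x) \<zeta> = 0" for \<zeta>
  proof (rule ell2_eqI)
    fix t
    define \<eta> where "\<eta> = ell2_apply (bop_apply (star x) \<zeta>) t"
    have "cinner \<eta> \<eta> = cinner (bop_apply x (ell2_single t \<eta>)) \<zeta>"
      by (simp only: cinner_star[symmetric] cinner_ell2_single \<eta>_def)
    then have "\<eta> = 0"
      by (simp add: assms cinner_self)
    then show "ell2_apply (bop_apply (star x) \<zeta>) t = ell2_apply 0 t"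
      by (simp add: \<eta>_def zero_ell2.rep_eq)
  qed
  then have "star x = 0"
    by (rule bop_eq_0I)
  then show ?thesis
    by (metis norm_eq_zero norm_star)
qed

lemma star_hom_bounded_linear:
  fixes f :: "'a::cstar_algebra \<Rightarrow> 'b::cstar_algebra"
  assumes "star_hom f" "f 1 = 1"
  shows "bounded_linear f"
  using star_hom_contractive[OF assms] assms(1)
  by (intro bounded_linear_intro[of _ 1]) (simp_all add: star_hom_def scaleR_scaleC)

text \<open>The coefficient of \<open>y\<close> at the neutral element exists in the algebra because \<open>\<pi>\<close> is isometric.\<close>

lemma crossed_product_coefficient:
  fixes \<alpha> :: "'g::group_add \<Rightarrow> 'a::cstar_algebra \<Rightarrow> 'a" and \<pi> :: "'a \<Rightarrow> 'h::chilbert_space bop"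
  assumes \<alpha>: "gamma_cstar_algebra \<alpha>" and \<pi>: "faithful_representation \<pi>"
    and \<phi>: "state_on UNIV \<phi>"
    and vanish: "\<And>a s. s \<noteq> 0 \<Longrightarrow> \<phi> (crossed_representation \<alpha> \<pi> a * left_translation s) = 0"
    and y: "y \<in> closure (crossed_polynomials \<alpha> \<pi>)"
  shows "\<exists>a. (\<forall>\<eta>. ell2_apply (bop_apply y (ell2_single 0 \<eta>)) 0 = bop_apply (\<pi> a) \<eta>)
    \<and> (\<forall>b. \<phi> (crossed_representation \<alpha> \<pi> b * y) = \<phi> (crossed_representation \<alpha> \<pi> (b * a)))"
proof -
  let ?\<sigma> = "crossed_representation \<alpha> \<pi>"
  \<comment> \<open>A relation suffices here: both equations pass to sums and, once the coefficients
    converge, to limits.\<close>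
  define R where "R y a \<longleftrightarrow> (\<forall>\<eta>. ell2_apply (bop_apply y (ell2_single 0 \<eta>)) 0 = bop_apply (\<pi> a) \<eta>)
      \<and> (\<forall>b. \<phi> (?\<sigma> b * y) = \<phi> (?\<sigma> (b * a)))" for y a
  have \<pi>1: "star_hom \<pi>" "\<pi> 1 = 1"
    using \<pi> by (simp_all add: faithful_representation_def)
  note \<pi>hom = \<pi>1(1)[unfolded star_hom_def]
  note hom = crossed_representation_star_hom[OF \<alpha> \<pi>1]
  note \<sigma>hom = hom[unfolded star_hom_def]
  have R_add: "R (x + y) (a + b)" if "R x a" "R y b" for x y a b
    using that \<pi>hom \<sigma>hom by (simp add: R_def bop_apply_plus plus_ell2.rep_eq distrib_left
        state_add[OF \<phi>])
  have R_ex: "\<exists>a. R y a" if "y \<in> crossed_polynomials \<alpha> \<pi>" for y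
    using that
  proof (induction rule: crossed_polynomials.induct[OF \<alpha> \<pi>1, consumes 1, case_names monomial add])
    case (monomial c s)
    have pi0: "\<pi> 0 = 0"
      using \<pi>hom by (metis scaleC_zero_left)
    have sigma0: "?\<sigma> 0 = 0"
      using \<sigma>hom by (metis scaleC_zero_left)
    have "\<alpha> 0 c = c"
      using \<alpha> by (simp add: gamma_cstar_algebra_def)
    then have coeff: "ell2_apply (bop_apply (?\<sigma> c * left_translation s) (ell2_single 0 \<eta>)) 0
        = bop_apply (\<pi> c) (if s = 0 then \<eta> else 0)" for \<eta>
      by (simp add: bop_apply_times crossed_representation_apply[OF \<alpha> \<pi>1] left_translation_apply
          ell2_single.rep_eq)
    have state: "\<phi> (?\<sigma> b * (?\<sigma> c * left_translation s)) = \<phi> (?\<sigma> (b * c) * left_translation s)" for b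
      using \<sigma>hom by (simp flip: mult.assoc)
    \<comment> \<open>Away from the neutral element the corner entry is 0, and \<open>vanish\<close>
      makes the second equation agree with it.\<close>
    have "R (?\<sigma> c * left_translation s) (if s = 0 then c else 0)"
    proof (cases "s = 0")
      case True
      then show ?thesis
        using coeff state by (simp add: R_def left_translation_0)
    next
      case False
      then show ?thesis
        using coeff state vanish linear_0[OF bounded_linear.linear[OF bounded_linear_bop_apply]]
          linear_0[OF bounded_linear.linear[OF state_bounded_linear[OF \<phi>]]]
        by (simp add: R_def pi0 sigma0 zero_bop.rep_eq bop_apply.rep_eq)
    qed
    then show ?case
      by blast
  qed (use R_add in blast)
  obtain Y where Y: "\<And>n. Y n \<in> crossed_polynomials \<alpha> \<pi>" "Y \<longlonglongrightarrow> y"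
    using y by (auto simp: closure_sequential)
  have "\<exists>a. R (Y n) a" for n
    by (rule R_ex[OF Y(1)])
  then obtain A where A: "\<And>n. R (Y n) (A n)"
    by metis
  \<comment> \<open>The difference of coefficients is a corner of \<open>Y m - Y n\<close>; the
    isometry of \<open>\<pi>\<close> brings the estimate back to the algebra, where completeness
    applies.\<close>
  have diff: "norm (A m - A n) \<le> norm (Y m - Y n)" for m n
  proof -
    have "\<pi> (A m - A n) = \<pi> (A m) - \<pi> (A n)"
      by (rule linear_diff[OF bounded_linear.linear[OF star_hom_bounded_linear[OF \<pi>1]]])
    then have "bop_apply (\<pi> (A m - A n)) \<eta> = ell2_apply (bop_apply (Y m - Y n) (ell2_single 0 \<eta>))
        0" for \<eta>
      using A by (simp add: R_def bop_apply_diff minus_ell2.rep_eq)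
    then have "norm (bop_apply (\<pi> (A m - A n)) \<eta>) \<le> norm (Y m - Y n) * norm \<eta>" for \<eta>
      using order_trans[OF norm_ell2_apply_le norm_bop_apply, of "Y m - Y n" "ell2_single 0 \<eta>" 0]
      by (simp add: norm_ell2_single)
    then have "norm (\<pi> (A m - A n)) \<le> norm (Y m - Y n)"
      by (intro norm_bop_bound) simp_all
    then show ?thesis
      by (simp add: faithful_representation_norm[OF \<pi>])
  qed
  have "Cauchy A"
  proof (rule CauchyI)
    fix e :: real
    assume "e > 0"
    then obtain M where M: "\<forall>m\<ge>M. \<forall>n\<ge>M. norm (Y m - Y n) < e"
      using CauchyD[OF LIMSEQ_imp_Cauchy[OF Y(2)]] by blast
    have "norm (A m - A n) < e" if "m \<ge> M" "n \<ge> M" for m n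
      using M that by (intro le_less_trans[OF diff]) simp
    then show "\<exists>M. \<forall>m\<ge>M. \<forall>n\<ge>M. norm (A m - A n) < e"
      by blast
  qed
  then obtain a where a: "A \<longlonglongrightarrow> a"
    using Cauchy_convergent convergent_def by blast
  have "R y a"
    unfolding R_def
  proof (intro conjI allI)
    fix \<eta>
    show "ell2_apply (bop_apply y (ell2_single 0 \<eta>)) 0 = bop_apply (\<pi> a) \<eta>"
    proof (rule LIMSEQ_unique)
      show "(\<lambda>n. ell2_apply (bop_apply (Y n) (ell2_single 0 \<eta>)) 0)
          \<longlonglongrightarrow> ell2_apply (bop_apply y (ell2_single 0 \<eta>)) 0"
        by (rule bounded_linear.tendsto[OF bounded_linear_ell2_coordinate Y(2)])
      have "bounded_linear (\<lambda>x. bop_apply x \<eta>)"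
        by (rule bounded_linear_intro[of _ "norm \<eta>"]) (simp_all add: bop_apply_plus
            bop_apply_scaleR norm_bop_apply)
      then have "(\<lambda>n. bop_apply (\<pi> (A n)) \<eta>) \<longlonglongrightarrow> bop_apply (\<pi> a) \<eta>"
        by (intro bounded_linear.tendsto[OF bounded_linear_compose, OF _
            star_hom_bounded_linear[OF \<pi>1] a])
      then show "(\<lambda>n. ell2_apply (bop_apply (Y n) (ell2_single 0 \<eta>)) 0) \<longlonglongrightarrow> bop_apply (\<pi> a) \<eta>"
        using A by (simp add: R_def)
    qed
  next
    fix b
    show "\<phi> (?\<sigma> b * y) = \<phi> (?\<sigma> (b * a))"
    proof (rule LIMSEQ_unique)
      show "(\<lambda>n. \<phi> (?\<sigma> b * Y n)) \<longlonglongrightarrow> \<phi> (?\<sigma> b * y)"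
        by (intro bounded_linear.tendsto[OF state_bounded_linear[OF \<phi>]] tendsto_mult tendsto_const
            Y(2))
      have "(\<lambda>n. \<phi> (?\<sigma> (b * A n))) \<longlonglongrightarrow> \<phi> (?\<sigma> (b * a))"
        by (intro bounded_linear.tendsto[OF state_bounded_linear[OF \<phi>]] tendsto_mult tendsto_const a
            bounded_linear.tendsto[OF star_hom_bounded_linear[OF hom crossed_representation_one[OF
                \<alpha> \<pi>1]]])
      then show "(\<lambda>n. \<phi> (?\<sigma> b * Y n)) \<longlonglongrightarrow> \<phi> (?\<sigma> (b * a))"
        using A by (simp add: R_def)
    qed
  qed
  then show ?thesis
    by (auto simp: R_def)
qed

text \<open>Translations implement the action on the image of \<open>crossed_representation\<close>,
  so invariance under the average becomes stationarity for \<alpha>.\<close>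

lemma stationary_state_on_crossed_representation:
  fixes \<alpha> :: "'g::group_add \<Rightarrow> 'a::cstar_algebra \<Rightarrow> 'a" and \<pi> :: "'a \<Rightarrow> 'h::chilbert_space bop"
  assumes \<alpha>: "gamma_cstar_algebra \<alpha>" and \<pi>: "star_hom \<pi>" "\<pi> 1 = 1"
    and \<phi>: "state_on UNIV \<phi>" "\<And>x. \<phi> (translation_average \<mu> x) = \<phi> x"
  shows "stationary_state_on \<mu> \<alpha> UNIV (\<lambda>a. \<phi> (crossed_representation \<alpha> \<pi> a))"
proof -
  have "state_on UNIV (\<lambda>a. \<phi> (crossed_representation \<alpha> \<pi> a))"
    using crossed_representation_star_hom[OF \<alpha> \<pi>] crossed_representation_one[OF \<alpha> \<pi>] \<phi>(1)
    by (simp add: state_on_def star_hom_def)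
  moreover have "state_convolution \<mu> \<alpha> (\<lambda>a. \<phi> (crossed_representation \<alpha> \<pi> a)) a
      = \<phi> (crossed_representation \<alpha> \<pi> a)" for a
    using infsumI[OF state_translation_average_has_sum[OF \<phi>(1), of \<mu> "crossed_representation \<alpha> \<pi>
        a"]]
    by (simp add: state_convolution_def crossed_representation_conj[OF \<alpha> \<pi>] \<phi>(2))
  ultimately show ?thesis
    by (simp add: stationary_state_on_def)
qed

theorem corollary1p2:
  fixes \<alpha> :: "'g::{group_add, countable} \<Rightarrow> 'a::cstar_algebra \<Rightarrow> 'a"
    and \<pi> :: "'a \<Rightarrow> 'h::chilbert_space bop"
    and \<mu> :: "'g pmf"
    and B :: "('g, 'h) ell2 bop set"
  assumes "simple_cstar (reduced_group_cstar :: ('g, complex) ell2 bop set)"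
    and "gamma_cstar_algebra \<alpha>"
    and "cstar_simple_measure \<mu>"
    and "\<And>\<tau>. stationary_state_on \<mu> \<alpha> UNIV \<tau> \<Longrightarrow> faithful_state_on UNIV \<tau>"
    and "faithful_representation \<pi>"
    and "cstar_subalgebra B"
    and "reduced_group_cstar \<subseteq> B"
    and "B \<subseteq> reduced_crossed_product \<alpha> \<pi>"
  shows "simple_cstar B"
  unfolding simple_cstar_def
proof (intro allI impI)
  fix I
  assume I: "closed_ideal I B"
  note \<alpha> = assms(2) and \<mu> = assms(3) and B = assms(6)
  let ?\<sigma> = "crossed_representation \<alpha> \<pi>"
  have \<pi>: "star_hom \<pi>" "\<pi> 1 = 1"
    using assms(5) by (simp_all add: faithful_representation_def)
  have tr: "left_translation s \<in> B" for s
    using assms(7) left_translation_in_reduced_group_cstar by blast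
  then have tr': "range left_translation \<subseteq> B"
    by blast
  have IB: "I \<subseteq> B" and zero: "0 \<in> I"
    and ideal: "\<And>a x. a \<in> B \<Longrightarrow> x \<in> I \<Longrightarrow> a * x \<in> I" "\<And>a x. a \<in> B \<Longrightarrow> x \<in> I \<Longrightarrow> x * a \<in> I"
    using I by (simp_all add: closed_ideal_def)
  have oneB: "1 \<in> B"
    using tr[of 0] by (simp add: left_translation_0)
  show "I = {0} \<or> I = B"
  proof (cases "1 \<in> I")
    case True
    have "x \<in> I" if "x \<in> B" for x
      using ideal(1)[OF that True] by simp
    then show ?thesis
      using IB by blast
  next
    case False
    obtain \<phi> where \<phi>: "state_on UNIV \<phi>" "\<And>x. \<phi> (translation_average \<mu> x) = \<phi> x"
      and null: "\<And>x. x \<in> I \<Longrightarrow> \<phi> x = 0"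
      by (rule stationary_state_vanishing_on_ideal[OF B oneB I False tr', of \<mu>]) (rule that)
    have faithful: "a = 0" if "\<phi> (?\<sigma> (star a * a)) = 0" for a
      using assms(4)[OF stationary_state_on_crossed_representation[OF \<alpha> \<pi> \<phi>]] that
      by (simp add: faithful_state_on_def)
    have star_crossed: "?\<sigma> (star a) = star (?\<sigma> a)" for a
      using crossed_representation_star_hom[OF \<alpha> \<pi>] unfolding star_hom_def by blast
    have coeff: "ell2_apply (bop_apply y (ell2_single 0 \<eta>)) 0 = 0" if y: "y \<in> I" for y \<eta>
    proof -
      have yB: "y \<in> B"
        using IB y by (rule subsetD)
      then have "y \<in> closure (crossed_polynomials \<alpha> \<pi>)"
        by (intro subsetD[OF reduced_crossed_product_subset[OF \<alpha> \<pi>]] subsetD[OF assms(8)])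
      then obtain a where a: "ell2_apply (bop_apply y (ell2_single 0 \<eta>)) 0 = bop_apply (\<pi> a) \<eta>"
        and state: "\<forall>b. \<phi> (?\<sigma> b * y) = \<phi> (?\<sigma> (b * a))"
        using crossed_product_coefficient[OF \<alpha> assms(5) \<phi>(1) stationary_state_crossed_zero[OF \<mu> \<alpha>
            \<pi> \<phi>], of y]
        by blast
      have "star y \<in> B"
        using B yB by (simp add: cstar_subalgebra_def)
      then have "star y * y \<in> I"
        using y by (rule ideal(1))
      \<comment> \<open>Only \<open>star y * y\<close> has to belong to the ideal;
        \<open>?\<sigma> a\<close> may lie outside \<open>B\<close>.\<close>
      then have "\<phi> (star (?\<sigma> a) * y) = 0"
        by (rule state_left_kernel[OF \<phi>(1) null])
      then have "\<phi> (?\<sigma> (star a * a)) = 0"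
        unfolding state[rule_format, symmetric] star_crossed .
      then have "a = 0"
        by (rule faithful)
      moreover have "\<pi> 0 = 0"
        using \<pi>(1) unfolding star_hom_def by (metis scaleC_zero_left)
      ultimately show ?thesis
        unfolding a by (simp add: zero_bop.rep_eq bop_apply.rep_eq)
    qed
    \<comment> \<open>The entry of \<open>x\<close> at \<open>s\<close>, \<open>t\<close> is the
      corner entry of an element obtained by multiplying \<open>x\<close> with translations, which
      stays in the ideal.\<close>
    have "x = 0" if x: "x \<in> I" for x
    proof (rule bop_eq_0_if_single, rule ell2_eqI)
      fix t s \<eta>
      have "left_translation (- s) * x * left_translation t \<in> I"
        by (intro ideal tr x)
      then have "ell2_apply (bop_apply x (bop_apply (left_translation t) (ell2_single 0 \<eta>))) s = 0"
        using coeff[of "left_translation (- s) * x * left_translation t" \<eta>]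
        by (simp add: bop_apply_times left_translation_apply)
      moreover have "bop_apply (left_translation t) (ell2_single 0 \<eta>) = ell2_single t \<eta>"
      proof (rule ell2_eqI)
        fix u
        have "- t + u = 0 \<longleftrightarrow> u = t"
          using neg_eq_iff_add_eq_0[of "- t" u] by auto
        then show "ell2_apply (bop_apply (left_translation t) (ell2_single 0 \<eta>)) u
            = ell2_apply (ell2_single t \<eta>) u"
          by (simp add: left_translation_apply ell2_single.rep_eq)
      qed
      ultimately show "ell2_apply (bop_apply x (ell2_single t \<eta>)) s = ell2_apply 0 s"
        by (simp add: zero_ell2.rep_eq)
    qed
    then show ?thesis
      using zero by blast
  qed
qed

end
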